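(* Let $B=\mathbf{I}$ and let $f:\mathbb{R}^d\to\mathbb{R}$ be Lipschitz continuous with constant $L_0>0$ with respect to the Euclidean norm. Let $0<\delta<1$, $0<\gamma\le\min\{5L_0,1\}$ and let $\mu>0$ satisfy $\mu\le\frac{\delta}{\sqrt{d\pi e}}\left(\frac{\gamma}{4L_0}\right)^{1/d}$. Let $L_1(f_\mu)>0$ be the Lipschitz constant of the gradient of $f_\mu$, and let $\sigma\ge 0$ satisfy $E_u[\|G_\mu(z;u)-F_\mu(z)\|^2]\le\sigma^2$ for all $z\in\mathbb{R}^d$. Suppose that for some $\rho\in[0,\frac{1}{4L_1(f_\mu)})$ there is $z^*\in\mathbb{R}^d$ such that $\langle F_\mu(z),z-z^*\rangle+\frac{\rho}{2}\|F_\mu(z)\|^2\ge0$ for all $z\in\mathbb{R}^d$. Let $\{z_k\},\{\hat z_k\}$ be generated by the variance-reduced zeroth-order extragradient algorithm (unconstrained) with constant sample size $t_k=t\in\mathbb{N}$, $t\ge1$, and constant step sizes $h_1,h_2>0$ satisfying $h_1\le\frac{1}{L_1(f_\mu)}$ and $h_2\in\left(\sqrt{\frac{\rho}{L_1(f_\mu)}},\frac{h_1}{2}\right]$. Let $r_0=\|z_0-z^*\|$ and $\epsilon>0$. If $$\mu\le\frac{\delta}{\sqrt{d\pi e}}\left(\frac{\epsilon}{8L_0}\right)^{1/d},\quad N\ge\left\lceil\left(\frac{16r_0^2L_1(f_\mu)}{L_1(f_\mu)h_2^2-\rho}\right)\epsilon^{-2}-1\right\rceil,\quad t\ge\left\lceil\frac{24\sigma^2}{L_1(f_\mu)(L_1(f_\mu)h_2^2-\rho)}\epsilon^{-2}\right\rceil,$$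 then there exists $k\in\{0,\dots,N\}$ such that the iterate $\hat z_k$ of the algorithm is, in expectation, a $(\delta,\epsilon)$-Goldstein stationary point of $f$, i.e. $$E_{\mathcal{U}_k}\left[\min\{\|g\|:g\in\partial_\delta f(\hat z_k)\}\right]\le\epsilon.$$
   Context: $n,m\in\mathbb{N}$, $d=n+m$, points $z=(x,y)\in\mathbb{R}^n\times\mathbb{R}^m=\mathbb{R}^d$; since $B=\mathbf{I}$, $\|\cdot\|$ is the Euclidean norm and $\langle\cdot,\cdot\rangle$ the Euclidean inner product. In $\sqrt{d\pi e}$, $e$ is Euler's number. For $\mu>0$ the Gaussian smoothing of $f$ is $f_\mu(z)=E_u[f(z+\mu u)]$ with $u\sim\mathcal{N}(0,\mathbf{I})$ (it is continuously differentiable with Lipschitz gradient when $f$ is Lipschitz), and $F_\mu(z)=(\nabla_x f_\mu(z),-\nabla_y f_\mu(z))$. For $u=(u_1,u_2)\in\mathbb{R}^n\times\mathbb{R}^m$ the random oracle is $G_\mu(z;u)=\frac{f(z+\mu u)-f(z)}{\mu}\,(u_1,-u_2)$. Variance-reduced ZO-EG (unconstrained): given $z_0\in\mathbb{R}^d$, for $k=0,1,\dots,N$: sample $\hat u_k^1,\dots,\hat u_k^{t_k}\sim\mathcal{N}(0,\mathbf{I})$ and set $\hat z_k=z_k-h_1\frac{1}{t_k}\sum_{i=1}^{t_k}G_\mu(z_k;\hat u_k^i)$; sample $u_k^1,\dots,u_k^{t_k}\sim\mathcal{N}(0,\mathbf{I})$ and set $z_{k+1}=z_k-h_2\frac{1}{t_k}\sum_{i=1}^{t_k}G_\mu(\hat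 z_k;u_k^i)$. All sampled vectors are independent. $\mathcal{U}_k=[(u_0,\hat u_0),\dots,(u_k,\hat u_k)]$, where $u_j,\hat u_j$ denote the batches sampled at iteration $j$, and $E_{\mathcal{U}_k}$ is expectation over $\mathcal{U}_k$. $\partial f(z)$ denotes the Clarke generalized gradient: the convex hull of all limits $\lim\nabla f(w_j)$ with $w_j\to z$ and $f$ differentiable at $w_j$. The $\delta$-Goldstein subdifferential is $\partial_\delta f(z)=\operatorname{conv}\big(\bigcup_{z'\in\mathbb{B}_\delta(z)}\partial f(z')\big)$, $\mathbb{B}_\delta(z)$ being the closed ball of radius $\delta$ around $z$. A point $z$ is $(\delta,\epsilon)$-Goldstein stationary if $\min\{\|g\|:g\in\partial_\delta f(z)\}\le\epsilon$. *)

theory Defs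
  imports "HOL-Probability.Probability"
begin

text \<open>Standard normal distribution \<open>N(0, I)\<close> on a Euclidean space.\<close>

definition std_gaussian :: "'a::euclidean_space measure" where
  "std_gaussian = density lborel (\<lambda>u. ennreal (\<Prod>b\<in>Basis. std_normal_density (u \<bullet> b)))"

definition gaussian_smoothing :: "real \<Rightarrow> ('a::euclidean_space \<Rightarrow> real) \<Rightarrow> 'a \<Rightarrow> real" where
  "gaussian_smoothing \<mu> f z = (\<integral>u. f (z + \<mu> *\<^sub>R u) \<partial>std_gaussian)"

text \<open>\<open>grad f z\<close> is meaningful only where \<open>f\<close> is differentiable; there the vector is unique.\<close>

definition grad :: "('a::euclidean_space \<Rightarrow> real) \<Rightarrow> 'a \<Rightarrow> 'a" where
  "grad f z = (THE g. GDERIV f z :> g)"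

definition saddle_grad ::
    "real \<Rightarrow> ('a::euclidean_space \<times> 'b::euclidean_space \<Rightarrow> real) \<Rightarrow> 'a \<times> 'b \<Rightarrow> 'a \<times> 'b" where
  "saddle_grad \<mu> f z =
     (grad (\<lambda>x. gaussian_smoothing \<mu> f (x, snd z)) (fst z),
      - grad (\<lambda>y. gaussian_smoothing \<mu> f (fst z, y)) (snd z))"

definition zo_oracle ::
    "real \<Rightarrow> ('a::euclidean_space \<times> 'b::euclidean_space \<Rightarrow> real) \<Rightarrow> 'a \<times> 'b \<Rightarrow> 'a \<times> 'b \<Rightarrow> 'a \<times> 'b"
  where
  "zo_oracle \<mu> f z u = ((f (z + \<mu> *\<^sub>R u) - f z) / \<mu>) *\<^sub>R (fst u, - snd u)"

definition batch_oracle ::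
    "real \<Rightarrow> ('a::euclidean_space \<times> 'b::euclidean_space \<Rightarrow> real) \<Rightarrow> nat \<Rightarrow> (nat \<Rightarrow> 'a \<times> 'b)
      \<Rightarrow> 'a \<times> 'b \<Rightarrow> 'a \<times> 'b" where
  "batch_oracle \<mu> f t v z = (1 / real t) *\<^sub>R (\<Sum>i=1..t. zo_oracle \<mu> f z (v i))"

text \<open>
  One realisation of the extragradient iteration: \<open>uh k i\<close> and \<open>u k i\<close> are the \<open>i\<close>-th vectors
  (\<open>1 \<le> i \<le> t k\<close>) sampled in iteration \<open>k\<close> for the extrapolation and the update step.
\<close>

definition zoeg_extrapolate ::
    "('a::euclidean_space \<times> 'b::euclidean_space \<Rightarrow> real) \<Rightarrow> real \<Rightarrow> real \<Rightarrow> (nat \<Rightarrow> nat)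
      \<Rightarrow> (nat \<Rightarrow> nat \<Rightarrow> 'a \<times> 'b) \<Rightarrow> nat \<Rightarrow> 'a \<times> 'b \<Rightarrow> 'a \<times> 'b" where
  "zoeg_extrapolate f \<mu> h1 t uh k z = z - h1 *\<^sub>R batch_oracle \<mu> f (t k) (uh k) z"

primrec zoeg_z ::
    "('a::euclidean_space \<times> 'b::euclidean_space \<Rightarrow> real) \<Rightarrow> real \<Rightarrow> real \<Rightarrow> real \<Rightarrow> (nat \<Rightarrow> nat)
      \<Rightarrow> 'a \<times> 'b \<Rightarrow> (nat \<Rightarrow> nat \<Rightarrow> 'a \<times> 'b) \<Rightarrow> (nat \<Rightarrow> nat \<Rightarrow> 'a \<times> 'b) \<Rightarrow> nat \<Rightarrow> 'a \<times> 'b" where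
  "zoeg_z f \<mu> h1 h2 t z0 uh u 0 = z0"
| "zoeg_z f \<mu> h1 h2 t z0 uh u (Suc k) =
     zoeg_z f \<mu> h1 h2 t z0 uh u k
     - h2 *\<^sub>R batch_oracle \<mu> f (t k) (u k)
          (zoeg_extrapolate f \<mu> h1 t uh k (zoeg_z f \<mu> h1 h2 t z0 uh u k))"

definition zoeg_zhat ::
    "('a::euclidean_space \<times> 'b::euclidean_space \<Rightarrow> real) \<Rightarrow> real \<Rightarrow> real \<Rightarrow> real \<Rightarrow> (nat \<Rightarrow> nat)
      \<Rightarrow> 'a \<times> 'b \<Rightarrow> (nat \<Rightarrow> nat \<Rightarrow> 'a \<times> 'b) \<Rightarrow> (nat \<Rightarrow> nat \<Rightarrow> 'a \<times> 'b) \<Rightarrow> nat \<Rightarrow> 'a \<times> 'b" where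
  "zoeg_zhat f \<mu> h1 h2 t z0 uh u k =
     zoeg_extrapolate f \<mu> h1 t uh k (zoeg_z f \<mu> h1 h2 t z0 uh u k)"

definition clarke_gradient :: "('a::euclidean_space \<Rightarrow> real) \<Rightarrow> 'a \<Rightarrow> 'a set" where
  "clarke_gradient f z = convex hull
     {g. \<exists>w. w \<longlonglongrightarrow> z \<and> (\<forall>j::nat. f differentiable (at (w j))) \<and> (\<lambda>j. grad f (w j)) \<longlonglongrightarrow> g}"

definition goldstein_subdifferential :: "real \<Rightarrow> ('a::euclidean_space \<Rightarrow> real) \<Rightarrow> 'a \<Rightarrow> 'a set" where
  "goldstein_subdifferential \<delta> f z = convex hull (\<Union>z'\<in>cball z \<delta>. clarke_gradient f z')"

text \<open>
  For Lipschitz \<open>f\<close> the Goldstein subdifferential is nonempty and compact, so the infimum below is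
  a minimum.
\<close>

definition goldstein_min_norm :: "real \<Rightarrow> ('a::euclidean_space \<Rightarrow> real) \<Rightarrow> 'a \<Rightarrow> real" where
  "goldstein_min_norm \<delta> f z = (INF g\<in>goldstein_subdifferential \<delta> f z. norm g)"

end

theory Submission
  imports Defs
begin

text \<open>
  Write \<open>F\<close> for the signed gradient of the smoothing. One extragradient step satisfies, under the weak Minty
  condition and with \<open>a = h2\<^sup>2 - \<rho> / L1\<close>,
  \<open>E |z' - zs|\<^sup>2 + a E |F zh|\<^sup>2 \<le> E |z - zs|\<^sup>2 + (h2\<^sup>2 + 3 h1 h2) \<sigma>\<^sup>2 / t\<close>,
  since the oracle is unbiased (Gaussian integration by parts) and the batch is independent of the past. Telescoping
  gives an index \<open>k\<close> with \<open>E |F zh|\<^sup>2 \<le> \<epsilon>\<^sup>2 / 4\<close>.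

  By Rademacher's theorem the gradient of the smoothing at \<open>z\<close> is the Gaussian average of \<open>\<nabla>f (z + \<mu> u)\<close>. Pairing it
  with the shortest element \<open>m\<close> of the Goldstein subdifferential, which satisfies \<open>m \<bullet> g \<ge> |m|\<^sup>2\<close> for all its
  elements \<open>g\<close>, shows \<open>|m| \<le> |F z| + 2 L0 P(|\<mu> u| > \<delta>)\<close>; the condition on \<open>\<mu>\<close> makes the last term at most
  \<open>\<epsilon> / 4\<close>.
\<close>


section \<open>Rademacher's theorem\<close>

text \<open>The Clarke gradient sees \<open>f\<close> only at points of differentiability, so
  differentiability almost everywhere is needed twice: to make the Goldstein subdifferential
  nonempty, and to express the gradient of the smoothing through gradients of \<open>f\<close>. It
  is obtained on the real line by comparing measures and carried to higher dimension by Fubini.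

  The single moment E exp(|u|^2 / 4) = (sqrt 2)^d does double duty: it dominates the integrands that
  grow with |u|, and as a Chernoff bound it controls the mass where |\<mu> u| > \<delta>.

  Nothing is known in advance about second moments of the iterates. The recursion therefore lives in
  nonnegative extended integrals, and finiteness is read off only after telescoping. The
  extrapolation noise enters \<open>F zh\<close> nonlinearly and does not average out directly.
  Splitting at the noiseless extrapolated point leaves a part linear in the noise, whose mean is
  zero, and a part bounded by the squared noise; the latter produces the coefficient
  \<open>3 h1 h2\<close>.\<close>

lemma emeasure_le_Vitali_cover:
  fixes M N :: "'a::euclidean_space measure"
  assumes M[measurable_cong]: "sets M = sets borel"
    and N[measurable_cong]: "sets N = sets borel" "emeasure N (space N) \<noteq> \<infinity>"
    and ac: "absolutely_continuous lborel M"
    and A[measurable]: "A \<in> sets borel"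
    and cover: "\<And>x e. x \<in> A \<Longrightarrow> 0 < e \<Longrightarrow>
      \<exists>a r. 0 < r \<and> r < e \<and> x \<in> cball a r \<and> emeasure M (cball a r) \<le> emeasure N (cball a r)"
  shows "emeasure M A \<le> emeasure N A"
proof -
  \<comment> \<open>The comparison is made inside an arbitrary open \<open>U\<close> around
    \<open>A\<close>: countably many disjoint good balls within \<open>U\<close> cover
    \<open>A\<close> up to a Lebesgue null set, which is also \<open>M\<close>-null. Outer
    regularity of the finite measure \<open>N\<close> then shrinks \<open>U\<close> to
    \<open>A\<close>.\<close>
  have "emeasure M A \<le> emeasure N U" if U: "A \<subseteq> U" "open U" for U
  proof -
    define K where "K = {p::'a \<times> real. 0 < snd p \<and> cball (fst p) (snd p) \<subseteq> U \<and>
      emeasure M (cball (fst p) (snd p)) \<le> emeasure N (cball (fst p) (snd p))}"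
    have *: "\<exists>i. i \<in> K \<and> x \<in> cball (fst i) (snd i) \<and> snd i < d" if x: "x \<in> A" and "0 < d" for x d
    proof -
      obtain e where e: "e > 0" "ball x e \<subseteq> U" using U x openE by blast
      \<comment> \<open>A ball of radius below \<open>e / 2\<close> that contains \<open>x\<close>
        stays within distance \<open>e\<close> of \<open>x\<close>, although \<open>x\<close> need
        not be its centre.\<close>
      have "0 < min d (e / 2)" using e \<open>0 < d\<close> by auto
      from cover[OF x this] obtain a r where ar: "0 < r" "r < min d (e / 2)" "x \<in> cball a r"
        "emeasure M (cball a r) \<le> emeasure N (cball a r)" by blast
      have "cball a r \<subseteq> ball x e"
      proof
        fix y assume "y \<in> cball a r"
        then show "y \<in> ball x e" using ar dist_triangle[of x y a] by (auto simp: dist_commute)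
      qed
      then have "(a, r) \<in> K" using ar e by (auto simp: K_def)
      then show ?thesis using ar by (intro exI[of _ "(a, r)"]) auto
    qed
    obtain C where C: "countable C" "C \<subseteq> K"
      "pairwise (\<lambda>i j. disjnt (cball (fst i) (snd i)) (cball (fst j) (snd j))) C"
      "negligible (A - (\<Union>i\<in>C. cball (fst i) (snd i)))"
      by (rule Vitali_covering_theorem_cballs[of K snd A fst]) (use * in \<open>auto simp: K_def\<close>)
    let ?B = "\<lambda>i::'a \<times> real. cball (fst i) (snd i)"
    have [measurable]: "(\<Union>i\<in>C. ?B i) \<in> sets borel"
      using C(1) by (intro sets.countable_UN'') auto
    have dj: "disjoint_family_on ?B C"
      using C(3) by (auto simp: disjoint_family_on_def pairwise_def disjnt_def)
    have "A - (\<Union>i\<in>C. ?B i) \<in> null_sets lborel"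
      using C(4) by (subst null_sets_completion_iff[symmetric]) (auto simp: negligible_iff_null_sets)
    then have null: "A - (\<Union>i\<in>C. ?B i) \<in> null_sets M"
      using ac by (auto simp: absolutely_continuous_def)
    have "emeasure M A \<le> emeasure M ((\<Union>i\<in>C. ?B i) \<union> (A - (\<Union>i\<in>C. ?B i)))"
      by (intro emeasure_mono) (auto simp: M)
    also have "\<dots> = emeasure M (\<Union>i\<in>C. ?B i)"
      using null by (intro emeasure_Un_null_set) (auto simp: M)
    also have "\<dots> = (\<integral>\<^sup>+i. emeasure M (?B i) \<partial>count_space C)"
      using C(1) dj by (intro emeasure_UN_countable) (auto simp: M)
    also have "\<dots> \<le> (\<integral>\<^sup>+i. emeasure N (?B i) \<partial>count_space C)"
      using C(2) by (intro nn_integral_mono) (auto simp: K_def)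
    also have "\<dots> = emeasure N (\<Union>i\<in>C. ?B i)"
      using C(1) dj by (intro emeasure_UN_countable[symmetric]) (auto simp: N)
    also have "\<dots> \<le> emeasure N U"
      using C(2) U by (intro emeasure_mono) (auto simp: N K_def)
    finally show ?thesis .
  qed
  then show ?thesis
    unfolding outer_regular[OF N A] by (intro INF_greatest) auto
qed

section \<open>Oscillation of difference quotients\<close>

definition diff_quot :: "('a::real_vector \<Rightarrow> real) \<Rightarrow> 'a \<Rightarrow> 'a \<Rightarrow> real \<Rightarrow> real" where
  "diff_quot f v x t = (f (x + t *\<^sub>R v) - f x) / t"

text \<open>For \<open>p < q\<close> a point of this set has no directional derivative along
  \<open>v\<close>. Conversely, a bounded difference quotient without a limit oscillates across some
  rational pair, so countably many of these sets exhaust the bad points.\<close>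

definition osc_set :: "('a::real_vector \<Rightarrow> real) \<Rightarrow> 'a \<Rightarrow> real \<Rightarrow> real \<Rightarrow> 'a set" where
  "osc_set f v p q = {x. (\<exists>\<^sub>F t in at 0. diff_quot f v x t < p) \<and> (\<exists>\<^sub>F t in at 0. q < diff_quot f v x t)}"

lemma lipschitz_on_absD:
  fixes f :: "'a::real_normed_vector \<Rightarrow> real"
  assumes "L-lipschitz_on UNIV f"
  shows "\<bar>f x - f y\<bar> \<le> L * norm (x - y)"
  using lipschitz_onD[OF assms, of x y] by (simp add: dist_norm dist_real_def)

lemma diff_quot_bound:
  fixes f :: "'a::real_normed_vector \<Rightarrow> real"
  assumes "L-lipschitz_on UNIV f"
  shows "\<bar>diff_quot f v x t\<bar> \<le> L * norm v"
proof (cases "t = 0")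
  case True
  then show ?thesis using lipschitz_on_nonneg[OF assms] by (simp add: diff_quot_def)
next
  case False
  then show ?thesis
    using lipschitz_on_absD[OF assms, of "x + t *\<^sub>R v" x]
    by (simp add: diff_quot_def abs_divide pos_divide_le_eq ac_simps)
qed

lemma frequently_at_0_real:
  "(\<exists>\<^sub>F t in at (0::real). P t) \<longleftrightarrow> (\<forall>n. \<exists>t. t \<noteq> 0 \<and> \<bar>t\<bar> < 1 / Suc n \<and> P t)"
proof
  assume "\<exists>\<^sub>F t in at (0::real). P t"
  then show "\<forall>n. \<exists>t. t \<noteq> 0 \<and> \<bar>t\<bar> < 1 / Suc n \<and> P t"
    by (auto simp: frequently_at dist_real_def)
next
  assume *: "\<forall>n. \<exists>t. t \<noteq> 0 \<and> \<bar>t\<bar> < 1 / Suc n \<and> P t"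
  show "\<exists>\<^sub>F t in at (0::real). P t"
    unfolding frequently_at
  proof (intro allI impI)
    fix d :: real assume "d > 0"
    then obtain n where "1 / Suc n < d" using nat_approx_posE by blast
    with * show "\<exists>x\<in>UNIV. x \<noteq> 0 \<and> dist x 0 < d \<and> P x"
      by (metis UNIV_I dist_0_norm dist_commute less_trans real_norm_def)
  qed
qed

text \<open>For fixed \<open>t\<close> the conditions on \<open>x\<close> are open, so even the
  uncountable unions over \<open>t\<close> are open. Only the intersection over the radii has to be
  countable, which is why the radii are taken of the form \<open>1 / Suc n\<close>.\<close>

lemma osc_set_borel:
  fixes f :: "'a::euclidean_space \<Rightarrow> real"
  assumes "continuous_on UNIV f"
  shows "osc_set f v p q \<in> sets borel"
proof -
  have cont: "continuous_on UNIV (\<lambda>x. diff_quot f v x t)" for t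
    unfolding diff_quot_def divide_inverse
    by (intro continuous_intros continuous_on_compose2[OF assms]) auto
  have eq: "osc_set f v p q =
      (\<Inter>n::nat. \<Union>t\<in>{t. t \<noteq> 0 \<and> \<bar>t\<bar> < 1 / Suc n}. {x. diff_quot f v x t < p}) \<inter>
      (\<Inter>n::nat. \<Union>t\<in>{t. t \<noteq> 0 \<and> \<bar>t\<bar> < 1 / Suc n}. {x. q < diff_quot f v x t})"
    unfolding osc_set_def frequently_at_0_real by blast
  show ?thesis
    unfolding eq
    by (intro sets.Int sets.countable_INT'' borel_open open_UN ballI open_Collect_less cont continuous_on_const) auto
qed

text \<open>The limit is the lower limit \<open>Sup S\<close>. For \<open>a\<close> above it, take
  rationals \<open>p < q\<close> in between: \<open>h\<close> is frequently below \<open>p\<close>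
  because \<open>p\<close> is not in \<open>S\<close>, so by assumption it cannot frequently exceed
  \<open>q\<close>.\<close>

lemma tendsto_if_no_oscillation:
  fixes h :: "'a \<Rightarrow> real"
  assumes F: "F \<noteq> bot" and bnd: "\<And>t. \<bar>h t\<bar> \<le> B"
    and no: "\<And>p q. p \<in> \<rat> \<Longrightarrow> q \<in> \<rat> \<Longrightarrow> p < q \<Longrightarrow>
      \<not> ((\<exists>\<^sub>F t in F. h t < p) \<and> (\<exists>\<^sub>F t in F. q < h t))"
  shows "\<exists>D. (h \<longlongrightarrow> D) F"
proof -
  define S where "S = {r. \<forall>\<^sub>F t in F. r \<le> h t}"
  have "- B \<in> S" using bnd by (auto simp: S_def abs_le_iff minus_le_iff intro!: always_eventually)
  then have ne: "S \<noteq> {}" by auto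
  have "r \<le> B" if "r \<in> S" for r
  proof -
    have "\<exists>t. r \<le> h t"
      using that F eventually_happens unfolding S_def by blast
    then show ?thesis using bnd by (meson abs_le_D1 order_trans)
  qed
  then have bd: "bdd_above S" by (rule bdd_aboveI)
  have "(h \<longlongrightarrow> Sup S) F"
  proof (rule order_tendstoI)
    fix a assume "a < Sup S"
    then obtain r where "r \<in> S" "a < r" using ne bd less_cSup_iff by blast
    then show "\<forall>\<^sub>F t in F. a < h t" by (auto simp: S_def elim!: eventually_mono)
  next
    fix a assume a: "Sup S < a"
    obtain q where q: "q \<in> \<rat>" "Sup S < q" "q < a" using a Rats_dense_in_real by blast
    obtain p where p: "p \<in> \<rat>" "Sup S < p" "p < q" using q Rats_dense_in_real by blast
    have "p \<notin> S" using p(2) bd cSup_upper by fastforce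
    then have "\<exists>\<^sub>F t in F. h t < p" by (simp add: S_def frequently_def not_less)
    with no p q have "\<forall>\<^sub>F t in F. \<not> q < h t" by (auto simp: frequently_def)
    then show "\<forall>\<^sub>F t in F. h t < a" using q by (auto elim!: eventually_mono)
  qed
  then show ?thesis ..
qed

text \<open>With \<open>c = L + 1\<close> the function \<open>g x = f x + c * x\<close> is an increasing bijection, and \<open>\<nu>\<close>, the image
  of Lebesgue measure under its inverse, gives an interval the increment of \<open>g\<close> over it. Comparing \<open>\<nu>\<close> with
  Lebesgue measure through the two Vitali covers yields \<open>(q + c) \<lambda>(E) \<le> \<nu>(E) \<le> (p + c) \<lambda>(E)\<close> on bounded parts
  \<open>E\<close> of the set.\<close>

lemma osc_set_real_null:
  fixes f :: "real \<Rightarrow> real"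
  assumes lip: "L-lipschitz_on UNIV f" and pq: "p < q"
  shows "osc_set f 1 p q \<in> null_sets lborel"
proof -
  define c where "c = L + 1"
  define g where "g = (\<lambda>x. f x + c * x)"
  define E where "E = osc_set f 1 p q"
  have L: "0 \<le> L" using lipschitz_on_nonneg[OF lip] .
  have contf: "continuous_on UNIV f" using lip by (rule lipschitz_on_continuous_on)
  have contg: "continuous_on UNIV g" unfolding g_def by (intro continuous_intros contf)
  \<comment> \<open>The extra \<open>1\<close> in \<open>c\<close> leaves a slope of at least one,
    which gives injectivity and, through growth at both ends, surjectivity.\<close>
  have inc: "y - x \<le> g y - g x" if "x \<le> y" for x y
    using lipschitz_on_absD[OF lip, of y x] that by (auto simp: g_def c_def algebra_simps abs_if split: if_splits)
  have mono: "g x < g y \<longleftrightarrow> x < y" for x y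
    using inc[of x y] inc[of y x] by linarith
  then have mono': "g x \<le> g y \<longleftrightarrow> x \<le> y" for x y by (meson not_less)
  have inj: "inj g" by (metis injI mono linorder_neqE_linordered_idom less_irrefl)
  have surj: "\<exists>x. g x = y" for y
  proof -
    let ?r = "\<bar>y - g 0\<bar>"
    have "g (- ?r) \<le> y" "y \<le> g ?r" using inc[of "- ?r" 0] inc[of 0 ?r] by linarith+
    then show ?thesis
      using IVT'[of g "- ?r" y ?r] continuous_on_subset[OF contg] by auto
  qed
  define k where "k = inv g"
  have gk: "g (k y) = y" for y unfolding k_def using surj by (metis f_inv_into_f rangeI)
  have kg: "k (g x) = x" for x unfolding k_def using inj by simp
  have "mono k" by (rule monoI) (metis gk mono')
  then have k[measurable]: "k \<in> borel_measurable borel" by (rule borel_measurable_mono)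
  define \<nu> where "\<nu> = distr lborel borel k"
  have sets\<nu>[measurable_cong, simp]: "sets \<nu> = sets borel" by (simp add: \<nu>_def)
  have vim: "k -` A = g ` A" for A by (auto simp: kg) (metis gk image_eqI)
  \<comment> \<open>The \<nu>-measure of \<open>N\<close> is the Lebesgue measure of its image under
    \<open>g\<close>, and the Lipschitz map \<open>g\<close> preserves null sets.\<close>
  have "absolutely_continuous lborel \<nu>"
    unfolding absolutely_continuous_def
  proof
    fix N :: "real set" assume N: "N \<in> null_sets lborel"
    then have [measurable]: "N \<in> sets borel" by auto
    have "negligible N" using N by (simp add: negligible_iff_null_sets null_sets_completion_iff)
    then have "negligible (g ` N)"
    proof (rule negligible_locally_Lipschitz_image[rotated])
      fix x assume "x \<in> N"
      have "norm (g y - g x) \<le> (L + c) * norm (y - x)" for y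
      proof -
        have "\<bar>(f y - f x) + c * (y - x)\<bar> \<le> L * \<bar>y - x\<bar> + c * \<bar>y - x\<bar>"
          using lipschitz_on_absD[OF lip, of y x] L
            abs_triangle_ineq[of "f y - f x" "c * (y - x)"]
          by (simp add: c_def abs_mult)
        then show ?thesis by (simp add: g_def algebra_simps)
      qed
      then show "\<exists>T B. open T \<and> x \<in> T \<and> (\<forall>y\<in>N \<inter> T. norm (g y - g x) \<le> B * norm (y - x))"
        by (intro exI[of _ UNIV] exI[of _ "L + c"]) auto
    qed simp
    then have "g ` N \<in> null_sets lebesgue" by (simp add: negligible_iff_null_sets)
    moreover have "g ` N \<in> sets borel" unfolding vim[symmetric] using measurable_sets_borel[OF k] by simp
    ultimately have "g ` N \<in> null_sets lborel" by (simp add: null_sets_completion_iff)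
    then show "N \<in> null_sets \<nu>"
      by (auto simp: null_sets_def \<nu>_def emeasure_distr vim)
  qed
  note ac = this
  have Icc: "emeasure \<nu> {a..b} = ennreal (g b - g a)" if "a \<le> b" for a b
  proof -
    have "k -` {a..b} = {g a..g b}" by (auto simp: ) (metis gk mono')+
    then show ?thesis using that by (simp add: \<nu>_def emeasure_distr mono')
  qed
  \<comment> \<open>The interval between \<open>x\<close> and \<open>x + t\<close> is written as a
    ball about its midpoint. On it the ratio of \<nu> to Lebesgue measure is exactly the difference
    quotient plus \<open>c\<close>.\<close>
  have cell: "\<exists>a r s. 0 < r \<and> r < e \<and> x \<in> cball a r \<and> cball a r \<subseteq> ball x (2 * e) \<and>
        P s \<and> emeasure \<nu> (cball a r) = ennreal (s + c) * emeasure lborel (cball a r)"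
    if fr: "\<exists>\<^sub>F t in at 0. P (diff_quot f 1 x t)" and e: "0 < e" for P x e
  proof -
    obtain t where t: "t \<noteq> 0" "\<bar>t\<bar> < e" "P (diff_quot f 1 x t)"
      using fr e unfolding frequently_at by (auto simp: dist_real_def)
    let ?a = "x + t / 2" and ?r = "\<bar>t\<bar> / 2"
    have ivl: "cball ?a ?r = {?a - ?r..?a + ?r}" by (simp add: cball_eq_atLeastAtMost)
    have ends: "?a + ?r = max x (x + t)" "?a - ?r = min x (x + t)"
      by (cases "t \<ge> 0"; simp add: max_def min_def)+
    have "t * diff_quot f 1 x t = f (x + t) - f x" using t(1) by (simp add: diff_quot_def)
    then have "g (?a + ?r) - g (?a - ?r) = (diff_quot f 1 x t + c) * \<bar>t\<bar>"
      unfolding ends by (cases "t \<ge> 0") (simp_all add: g_def max_def min_def algebra_simps)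
    moreover have "0 \<le> diff_quot f 1 x t + c"
      using diff_quot_bound[OF lip, of 1 x t] by (simp add: c_def)
    ultimately have "emeasure \<nu> (cball ?a ?r) = ennreal (diff_quot f 1 x t + c) * emeasure lborel (cball ?a ?r)"
      unfolding ivl by (subst Icc) (auto simp: ennreal_mult)
    moreover have "cball ?a ?r \<subseteq> ball x (2 * e)" "x \<in> cball ?a ?r"
      using t by (auto simp: dist_real_def abs_if split: if_splits)
    ultimately show ?thesis using t by (intro exI[of _ ?a] exI[of _ ?r] exI[of _ "diff_quot f 1 x t"]) auto
  qed
  have [measurable]: "E \<in> sets borel" unfolding E_def by (rule osc_set_borel[OF contf])
  have "E \<inter> (ball 0 (real n) :: real set) \<in> null_sets lborel" for n
  proof -
    let ?B = "ball 0 (real n) :: real set"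
    let ?A = "E \<inter> ?B"
    have [measurable]: "?B \<in> sets borel" by simp
    have small: "\<exists>e'. 0 < e' \<and> e' \<le> e \<and> ball x (2 * e') \<subseteq> ?B" if x: "x \<in> ?A" "0 < e" for x e :: real
    proof -
      obtain d where d: "d > 0" "ball x d \<subseteq> ?B"
        using x openE[OF open_ball, of x 0 "real n"] by blast
      then show ?thesis
        using x by (intro exI[of _ "min e (d / 2)"] conjI order_trans[OF subset_ball d(2)]) auto
    qed
    have finB: "emeasure \<nu> ?B \<noteq> \<infinity>"
    proof -
      have "emeasure \<nu> ?B \<le> emeasure \<nu> {- real n..real n}"
        by (intro emeasure_mono) (auto simp: dist_real_def)
      then show ?thesis by (subst (asm) Icc) (auto simp: top_unique)
    qed
    \<comment> \<open>Cutting the larger measure down to \<open>?B\<close> makes it finite, as the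
      covering comparison requires. The balls are chosen inside \<open>?B\<close>, so their measures
      do not change.\<close>
    have "emeasure (density lborel (\<lambda>_. ennreal (q + c))) ?A \<le> emeasure (density \<nu> (indicator ?B)) ?A"
    proof (rule emeasure_le_Vitali_cover)
      show "emeasure (density \<nu> (indicator ?B)) (space (density \<nu> (indicator ?B))) \<noteq> \<infinity>"
        using finB by (subst emeasure_restricted) (simp_all add: \<nu>_def)
      show "absolutely_continuous lborel (density lborel (\<lambda>_. ennreal (q + c)))"
        by (rule absolutely_continuousI_density) simp
      fix x and e :: real assume x: "x \<in> ?A" and e: "0 < e"
      obtain e' where e': "0 < e'" "e' \<le> e" "ball x (2 * e') \<subseteq> ?B" using small[OF x e] by blast
      have "\<exists>\<^sub>F t in at 0. q < diff_quot f 1 x t" using x by (simp add: E_def osc_set_def)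
      from cell[of "\<lambda>s. q < s", OF this e'(1)] obtain a r s where *: "0 < r" "r < e'" "x \<in> cball a r"
        "cball a r \<subseteq> ball x (2 * e')" "q < s"
        "emeasure \<nu> (cball a r) = ennreal (s + c) * emeasure lborel (cball a r)" by blast
      have "emeasure (density \<nu> (indicator ?B)) (cball a r) = emeasure \<nu> (cball a r)"
        using * e' by (subst emeasure_restricted) (simp_all add: Int_absorb1 order_trans[OF *(4) e'(3)])
      then have "emeasure (density lborel (\<lambda>_. ennreal (q + c))) (cball a r) \<le> emeasure (density \<nu> (indicator ?B)) (cball a r)"
        using *(5) by (simp add: emeasure_density_const *(6) mult_right_mono ennreal_leI)
      then show "\<exists>a r. 0 < r \<and> r < e \<and> x \<in> cball a r \<and>
        emeasure (density lborel (\<lambda>_. ennreal (q + c))) (cball a r) \<le> emeasure (density \<nu> (indicator ?B)) (cball a r)"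
        using * e' by (intro exI[of _ a] exI[of _ r]) auto
    qed auto
    also have "\<dots> = emeasure \<nu> ?A"
      by (subst emeasure_restricted) (auto intro!: arg_cong[of _ _ "emeasure \<nu>"])
    also have "\<dots> \<le> emeasure (density lborel (\<lambda>x. ennreal (p + c) * indicator ?B x)) ?A"
    proof (rule emeasure_le_Vitali_cover)
      show "emeasure (density lborel (\<lambda>x. ennreal (p + c) * indicator ?B x))
          (space (density lborel (\<lambda>x. ennreal (p + c) * indicator ?B x))) \<noteq> \<infinity>"
      proof -
        have [measurable]: "?B \<in> sets borel" by simp
        have "emeasure (density lborel (\<lambda>x. ennreal (p + c) * indicator ?B x)) UNIV =
            (\<integral>\<^sup>+x. ennreal (p + c) * indicator ?B x \<partial>lborel)"
          by (subst emeasure_density) auto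
        also have "\<dots> = ennreal (p + c) * emeasure lborel ?B"
          by (rule nn_integral_cmult_indicator) simp
        finally show ?thesis
          using emeasure_lborel_ball_finite[of "0::real" "real n"]
          by (auto simp: ennreal_mult_eq_top_iff)
      qed
      show "absolutely_continuous lborel \<nu>" by (rule ac)
      fix x and e :: real assume x: "x \<in> ?A" and e: "0 < e"
      obtain e' where e': "0 < e'" "e' \<le> e" "ball x (2 * e') \<subseteq> ?B" using small[OF x e] by blast
      have "\<exists>\<^sub>F t in at 0. diff_quot f 1 x t < p" using x by (simp add: E_def osc_set_def)
      from cell[of "\<lambda>s. s < p", OF this e'(1)] obtain a r s where *: "0 < r" "r < e'" "x \<in> cball a r"
        "cball a r \<subseteq> ball x (2 * e')" "s < p"
        "emeasure \<nu> (cball a r) = ennreal (s + c) * emeasure lborel (cball a r)" by blast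
      have sub: "cball a r \<subseteq> ?B" using *(4) e'(3) by (rule order_trans)
      have "ennreal (p + c) * indicator ?B y * indicator (cball a r) y = ennreal (p + c) * indicator (cball a r) y" for y
        by (metis sub Int_absorb1 indicator_inter_arith mult.assoc)
      then have "emeasure (density lborel (\<lambda>x. ennreal (p + c) * indicator ?B x)) (cball a r) =
          (\<integral>\<^sup>+x. ennreal (p + c) * indicator (cball a r) x \<partial>lborel)"
        by (subst emeasure_density) auto
      also have "\<dots> = ennreal (p + c) * emeasure lborel (cball a r)"
        by (rule nn_integral_cmult_indicator) simp
      finally have "emeasure \<nu> (cball a r) \<le> emeasure (density lborel (\<lambda>x. ennreal (p + c) * indicator ?B x)) (cball a r)"
        using *(5) by (simp add: *(6) mult_right_mono ennreal_leI)
      then show "\<exists>a r. 0 < r \<and> r < e \<and> x \<in> cball a r \<and>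
        emeasure \<nu> (cball a r) \<le> emeasure (density lborel (\<lambda>x. ennreal (p + c) * indicator ?B x)) (cball a r)"
        using * e' by (intro exI[of _ a] exI[of _ r]) auto
    qed auto
    also have "\<dots> = (\<integral>\<^sup>+x. ennreal (p + c) * indicator ?A x \<partial>lborel)"
      by (subst emeasure_density) (auto intro!: nn_integral_cong split: split_indicator)
    also have "\<dots> = ennreal (p + c) * emeasure lborel ?A"
      by (rule nn_integral_cmult_indicator) simp
    finally have le: "ennreal (q + c) * emeasure lborel ?A \<le> ennreal (p + c) * emeasure lborel ?A"
      by (simp add: emeasure_density_const)
    have "emeasure lborel ?A \<le> emeasure lborel ?B" by (intro emeasure_mono) auto
    then have fin: "emeasure lborel ?A \<noteq> \<infinity>"
      using emeasure_lborel_ball_finite[of "0::real" "real n"] by (auto simp: top_unique)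
    then obtain m where m: "emeasure lborel ?A = ennreal m" "0 \<le> m"
      by (cases "emeasure lborel ?A") auto
    have "m = 0"
    proof (rule ccontr)
      assume "m \<noteq> 0"
      \<comment> \<open>A point of the set supplies a difference quotient in between
        \<open>-L\<close> and \<open>p\<close>, hence \<open>p + c > 0\<close>. This rules out that
        \<open>ennreal\<close> has truncated a negative factor to 0.\<close>
      have "?A \<noteq> {}"
      proof
        assume "?A = {}"
        with m have "ennreal m = 0" by (metis emeasure_empty)
        with m \<open>m \<noteq> 0\<close> show False by simp
      qed
      then obtain x where x: "x \<in> osc_set f 1 p q" by (auto simp: E_def)
      obtain t where "diff_quot f 1 x t < p"
        using x unfolding osc_set_def by (blast dest: frequently_ex)
      then have "p + c > 0" using diff_quot_bound[OF lip, of 1 x t] by (simp add: c_def)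
      then have "(q + c) * m \<le> (p + c) * m"
        using le m pq unfolding m(1) by (subst (asm) (1 2) ennreal_mult[symmetric]) auto
      then have "q + c \<le> p + c" using m(2) \<open>m \<noteq> 0\<close> by (intro mult_right_le_imp_le[of "q + c" m "p + c"]) auto
      then show False using pq by simp
    qed
    then show ?thesis using m by (simp add: null_sets_def)
  qed
  then have "(\<Union>n. E \<inter> ball 0 (real n)) \<in> null_sets lborel" by (intro null_sets_UN) auto
  also have "(\<Union>n. E \<inter> ball 0 (real n)) = E"
    by (auto simp: dist_real_def intro: reals_Archimedean2)
  finally show ?thesis by (simp add: E_def)
qed


text \<open>By translation invariance the measure of the set is the average, over \<open>s \<in> {0..1}\<close>, of the measures of its
  translates by \<open>s *\<^sub>R v\<close>; after Fubini only its one-dimensional sections along \<open>v\<close> matter.\<close>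

lemma osc_set_null:
  fixes f :: "'a::euclidean_space \<Rightarrow> real"
  assumes lip: "L-lipschitz_on UNIV f" and pq: "p < q"
  shows "osc_set f v p q \<in> null_sets lborel"
proof -
  let ?N = "osc_set f v p q"
  have N[measurable]: "?N \<in> sets borel"
    using lip by (intro osc_set_borel lipschitz_on_continuous_on)
  have line: "(\<integral>\<^sup>+s. indicator ?N (x + s *\<^sub>R v) * indicator {0..1::real} s \<partial>lborel) = 0" for x
  proof -
    have "\<bar>f (x + s *\<^sub>R v) - f (x + t *\<^sub>R v)\<bar> \<le> L * norm v * \<bar>s - t\<bar>" for s t
      using lipschitz_on_absD[OF lip, of "x + s *\<^sub>R v" "x + t *\<^sub>R v"]
      by (simp add: scaleR_diff_left[symmetric] ac_simps)
    then have "(L * norm v)-lipschitz_on UNIV (\<lambda>s. f (x + s *\<^sub>R v))"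
      using lipschitz_on_nonneg[OF lip] by (intro lipschitz_onI) (auto simp: dist_real_def)
    from osc_set_real_null[OF this pq]
    have "{s. x + s *\<^sub>R v \<in> ?N} \<in> null_sets lborel"
      by (simp add: osc_set_def diff_quot_def algebra_simps)
    then have "AE s in lborel. s \<notin> {s. x + s *\<^sub>R v \<in> ?N}" by (rule AE_not_in)
    then show ?thesis
      by (subst nn_integral_0_iff_AE) (auto elim!: eventually_mono split: split_indicator)
  qed
  have "emeasure lborel ?N = (\<integral>\<^sup>+s. emeasure lborel ?N * indicator {0..1::real} s \<partial>lborel)"
    by (subst nn_integral_cmult) auto
  also have "\<dots> = (\<integral>\<^sup>+s. (\<integral>\<^sup>+x. indicator ?N (x + s *\<^sub>R v) * indicator {0..1::real} s \<partial>lborel) \<partial>lborel)"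
  proof (intro nn_integral_cong)
    fix s :: real
    have "emeasure lborel ?N = (\<integral>\<^sup>+x. indicator ?N x \<partial>distr lborel borel ((+) (s *\<^sub>R v)))"
      by (simp add: lborel_distr_plus)
    also have "\<dots> = (\<integral>\<^sup>+x. indicator ?N (x + s *\<^sub>R v) \<partial>lborel)"
      by (subst nn_integral_distr) (auto simp: add.commute)
    finally show "emeasure lborel ?N * indicator {0..1::real} s =
        (\<integral>\<^sup>+x. indicator ?N (x + s *\<^sub>R v) * indicator {0..1::real} s \<partial>lborel)"
      by (subst nn_integral_multc) auto
  qed
  also have "\<dots> = (\<integral>\<^sup>+x. (\<integral>\<^sup>+s. indicator ?N (x + s *\<^sub>R v) * indicator {0..1::real} s \<partial>lborel) \<partial>lborel)"
    by (rule lborel_pair.Fubini') measurable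
  also have "\<dots> = 0" by (simp add: line)
  finally show ?thesis by (simp add: null_sets_def)
qed

section \<open>Directional derivatives and their additivity\<close>

text \<open>An unspecified value where the limit does not exist.\<close>

definition dir_deriv :: "('a::real_vector \<Rightarrow> real) \<Rightarrow> 'a \<Rightarrow> 'a \<Rightarrow> real" where
  "dir_deriv f v x = lim (\<lambda>n. diff_quot f v x (1 / Suc n))"

lemma filterlim_inverse_Suc_at_0: "filterlim (\<lambda>n. 1 / real (Suc n)) (at 0) sequentially"
  unfolding filterlim_at using LIMSEQ_Suc[OF lim_1_over_n] by (auto simp del: of_nat_Suc)

lemma borel_measurable_diff_quot:
  fixes f :: "'a::euclidean_space \<Rightarrow> real"
  assumes [measurable]: "f \<in> borel_measurable borel"
  shows "(\<lambda>x. diff_quot f v x t) \<in> borel_measurable borel"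
  unfolding diff_quot_def by measurable

lemma borel_measurable_dir_deriv:
  fixes f :: "'a::euclidean_space \<Rightarrow> real"
  assumes "f \<in> borel_measurable borel"
  shows "dir_deriv f v \<in> borel_measurable borel"
  unfolding dir_deriv_def[abs_def]
  by (intro borel_measurable_lim_metric borel_measurable_diff_quot assms)

lemma dir_deriv_eqI:
  assumes "(diff_quot f v x \<longlongrightarrow> D) (at 0)"
  shows "dir_deriv f v x = D"
  unfolding dir_deriv_def
  by (intro limI filterlim_compose[OF assms filterlim_inverse_Suc_at_0])

lemma AE_dir_deriv:
  fixes f :: "'a::euclidean_space \<Rightarrow> real"
  assumes lip: "L-lipschitz_on UNIV f"
  shows "AE x in lborel. (diff_quot f v x \<longlongrightarrow> dir_deriv f v x) (at 0)"
proof -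
  have "AE x in lborel. p < q \<longrightarrow> x \<notin> osc_set f v p q" for p q
    using AE_not_in[OF osc_set_null[OF lip, of p q v]] by (cases "p < q") auto
  then have "AE x in lborel. \<forall>p\<in>\<rat>. \<forall>q\<in>\<rat>. p < q \<longrightarrow> x \<notin> osc_set f v p q"
    by (simp add: AE_ball_countable countable_rat)
  then show ?thesis
  proof (rule eventually_mono)
    fix x assume *: "\<forall>p\<in>\<rat>. \<forall>q\<in>\<rat>. p < q \<longrightarrow> x \<notin> osc_set f v p q"
    have "\<exists>D. (diff_quot f v x \<longlongrightarrow> D) (at 0)"
      by (rule tendsto_if_no_oscillation[OF _ diff_quot_bound[OF lip]])
        (use * in \<open>auto simp: osc_set_def\<close>)
    then show "(diff_quot f v x \<longlongrightarrow> dir_deriv f v x) (at 0)"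
      using dir_deriv_eqI by blast
  qed
qed

lemma AE_abs_dir_deriv_le:
  fixes f :: "'a::euclidean_space \<Rightarrow> real"
  assumes lip: "L-lipschitz_on UNIV f"
  shows "AE x in lborel. \<bar>dir_deriv f v x\<bar> \<le> L * norm v"
  using AE_dir_deriv[OF lip, of v]
proof eventually_elim
  case (elim x)
  show ?case
    by (rule tendsto_upperbound[OF tendsto_rabs[OF elim]])
      (auto intro: always_eventually diff_quot_bound[OF lip])
qed

text \<open>The shift by \<open>w / (n + 1)\<close> is harmless because it can be moved onto the indicator of the box, whose
  boundary is a null set.\<close>

lemma dir_deriv_box_integral:
  fixes f :: "'a::euclidean_space \<Rightarrow> real" and a b :: 'a
  assumes lip: "L-lipschitz_on UNIV f"
  shows "(\<lambda>n. \<integral>x. indicator (box a b) x * diff_quot f v (x + (1 / Suc n) *\<^sub>R w) (1 / Suc n) \<partial>lborel)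
      \<longlonglongrightarrow> (\<integral>x. indicator (box a b) x * dir_deriv f v x \<partial>lborel)"
proof -
  have [measurable]: "f \<in> borel_measurable borel"
    using lip by (intro borel_measurable_continuous_onI lipschitz_on_continuous_on)
  note [measurable] = borel_measurable_diff_quot borel_measurable_dir_deriv
  define t where "t = (\<lambda>n::nat. 1 / real (Suc n))"
  have t: "\<bar>t n\<bar> \<le> 1" for n by (simp add: t_def)
  have t0: "t \<longlonglongrightarrow> 0" unfolding t_def by (rule LIMSEQ_Suc[OF lim_1_over_n])
  obtain R where R: "box a b \<subseteq> ball 0 R"
    using bounded_box bounded_subset_ballD by blast
  \<comment> \<open>The steps \<open>t n\<close> are at most 1, so every shifted box stays in this
    ball, which supports one dominating function for all \<open>n\<close>.\<close>
  let ?R = "ball (0::'a) (R + norm w)"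
  have shift: "(\<integral>x. indicator (box a b) x * diff_quot f v (x + t n *\<^sub>R w) (t n) \<partial>lborel) =
      (\<integral>x. indicator (box a b) (x - t n *\<^sub>R w) * diff_quot f v x (t n) \<partial>lborel)" for n
  proof -
    have "(\<integral>x. indicator (box a b) (x - t n *\<^sub>R w) * diff_quot f v x (t n) \<partial>lborel) =
        (\<integral>x. indicator (box a b) (x - t n *\<^sub>R w) * diff_quot f v x (t n) \<partial>distr lborel borel ((+) (t n *\<^sub>R w)))"
      by (simp add: lborel_distr_plus)
    also have "\<dots> = (\<integral>x. indicator (box a b) x * diff_quot f v (x + t n *\<^sub>R w) (t n) \<partial>lborel)"
      by (subst integral_distr) (auto simp: add.commute)
    finally show ?thesis ..
  qed
  have "(\<lambda>n. \<integral>x. indicator (box a b) (x - t n *\<^sub>R w) * diff_quot f v x (t n) \<partial>lborel)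
      \<longlonglongrightarrow> (\<integral>x. indicator (box a b) x * dir_deriv f v x \<partial>lborel)"
  proof (rule integral_dominated_convergence[where w = "\<lambda>x. indicator ?R x * (L * norm v)"])
    have "integrable lborel (indicator ?R :: 'a \<Rightarrow> real)"
      using emeasure_lborel_ball_finite by (intro integrable_real_indicator) auto
    then show "integrable lborel (\<lambda>x. indicator ?R x * (L * norm v))"
      by (rule integrable_mult_left)
    show "AE x in lborel. norm (indicator (box a b) (x - t n *\<^sub>R w) * diff_quot f v x (t n))
        \<le> indicator ?R x * (L * norm v)" for n
    proof (rule AE_I2)
      fix x
      show "norm (indicator (box a b) (x - t n *\<^sub>R w) * diff_quot f v x (t n)) \<le> indicator ?R x * (L * norm v)"
      proof (cases "x - t n *\<^sub>R w \<in> box a b")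
        case True
        then have "norm (x - t n *\<^sub>R w) < R" using R by auto
        moreover have "norm (t n *\<^sub>R w) \<le> norm w" using t[of n] by (simp add: mult_left_le_one_le)
        ultimately have "x \<in> ?R" using norm_triangle_ineq[of "x - t n *\<^sub>R w" "t n *\<^sub>R w"] by simp
        then show ?thesis using True diff_quot_bound[OF lip] by simp
      next
        case False
        then show ?thesis using lipschitz_on_nonneg[OF lip] by simp
      qed
    qed
    have "cbox a b - box a b \<in> null_sets lborel"
      using negligible_frontier_interval[of a b]
      by (subst null_sets_completion_iff[symmetric]) (auto simp: negligible_iff_null_sets)
    from AE_not_in[OF this] AE_dir_deriv[OF lip, of v]
    show "AE x in lborel. (\<lambda>n. indicator (box a b) (x - t n *\<^sub>R w) * diff_quot f v x (t n))
        \<longlonglongrightarrow> indicator (box a b) x * dir_deriv f v x"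
    proof eventually_elim
      case (elim x)
      have lim: "(\<lambda>n. x - t n *\<^sub>R w) \<longlonglongrightarrow> x"
        using tendsto_diff[OF tendsto_const tendsto_scaleR[OF t0 tendsto_const], of x w] by simp
      have "\<forall>\<^sub>F n in sequentially. indicator (box a b) (x - t n *\<^sub>R w) = (indicator (box a b) x :: real)"
      proof (cases "x \<in> box a b")
        case True
        from topological_tendstoD[OF lim open_box this] show ?thesis
          by eventually_elim (use True in simp)
      next
        case False
        then have "x \<in> - cbox a b" using elim by auto
        from topological_tendstoD[OF lim _ this] have "\<forall>\<^sub>F n in sequentially. x - t n *\<^sub>R w \<in> - cbox a b"
          by auto
        then show ?thesis
          by eventually_elim (use False box_subset_cbox in \<open>auto split: split_indicator\<close>)
      qed
      then have "(\<lambda>n. indicator (box a b) (x - t n *\<^sub>R w) :: real) \<longlonglongrightarrow> indicator (box a b) x"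
        by (rule tendsto_eventually)
      moreover have "(\<lambda>n. diff_quot f v x (t n)) \<longlonglongrightarrow> dir_deriv f v x"
        unfolding t_def by (rule filterlim_compose[OF elim(2) filterlim_inverse_Suc_at_0])
      ultimately show ?case by (rule tendsto_mult)
    qed
  qed auto
  then show ?thesis unfolding shift[symmetric] by (simp add: t_def)
qed

text \<open>Adding the bound \<open>B\<close> makes \<open>h\<close> a nonnegative density. The
  measures with densities \<open>h + B\<close> and \<open>B\<close> agree on boxes, an
  intersection-stable generator, hence everywhere, and densities are unique almost
  everywhere.\<close>

lemma AE_zero_if_box_integrals_zero:
  fixes h :: "'a::euclidean_space \<Rightarrow> real"
  assumes h[measurable]: "h \<in> borel_measurable borel" and bnd: "AE x in lborel. \<bar>h x\<bar> \<le> B"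
    and box: "\<And>a b. (\<integral>x. indicator (box a b) x * h x \<partial>lborel) = 0"
  shows "AE x in lborel. h x = 0"
proof -
  let ?M = "density lborel (\<lambda>x. ennreal (h x + B))" and ?N = "density lborel (\<lambda>x::'a. ennreal B)"
  let ?E = "range (\<lambda>(a, b). box a b::'a set)"
  have B: "0 \<le> B"
  proof -
    have "ae_filter (lborel :: 'a measure) \<noteq> bot" by (simp add: ae_filter_eq_bot_iff)
    then have "\<exists>x. \<bar>h x\<bar> \<le> B" using eventually_happens[OF bnd] by blast
    then show ?thesis using abs_ge_zero order_trans by blast
  qed
  have eq: "emeasure ?M (box a b) = emeasure ?N (box a b)" for a b
  proof -
    have fin: "emeasure lborel (box a b) < \<infinity>" by (rule emeasure_lborel_box_finite)
    have int: "integrable lborel (\<lambda>x. indicator (box a b) x * h x)"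
    proof (rule Bochner_Integration.integrable_bound)
      show "integrable lborel (\<lambda>x. indicator (box a b) x * B)"
        using fin by (intro integrable_mult_left integrable_real_indicator) auto
      show "AE x in lborel. norm (indicator (box a b) x * h x) \<le> norm (indicator (box a b) x * B)"
        using bnd by eventually_elim (auto simp: B split: split_indicator)
    qed measurable
    have int2: "integrable lborel (\<lambda>x. indicator (box a b) x * B)"
      using fin by (intro integrable_mult_left integrable_real_indicator) auto
    have "emeasure ?M (box a b) = (\<integral>\<^sup>+x. ennreal (indicator (box a b) x * h x + indicator (box a b) x * B) \<partial>lborel)"
      by (subst emeasure_density) (auto intro!: nn_integral_cong split: split_indicator)
    also have "\<dots> = ennreal (\<integral>x. indicator (box a b) x * h x + indicator (box a b) x * B \<partial>lborel)"
    proof (rule nn_integral_eq_integral)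
      show "AE x in lborel. 0 \<le> indicator (box a b) x * h x + indicator (box a b) x * B"
        using bnd by eventually_elim (auto split: split_indicator)
    qed (use int int2 in auto)
    also have "\<dots> = ennreal (\<integral>x. indicator (box a b) x * B \<partial>lborel)"
      using int int2 box by simp
    also have "\<dots> = emeasure ?N (box a b)"
      using int2 B by (subst nn_integral_eq_integral[symmetric])
        (auto simp: emeasure_density intro!: nn_integral_cong split: split_indicator)
    finally show ?thesis .
  qed
  have "?M = ?N"
  proof (rule measure_eqI_generator_eq)
    show "Int_stable ?E"
      by (auto simp: Int_stable_def box_Int_box)
    show "?E \<subseteq> Pow UNIV" "sets ?M = sigma_sets UNIV ?E" "sets ?N = sigma_sets UNIV ?E"
      by (simp_all add: borel_eq_box)
    let ?A = "\<lambda>n::nat. box (- (real n *\<^sub>R One)) (real n *\<^sub>R One) :: 'a set"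
    show "range ?A \<subseteq> ?E" "(\<Union>i. ?A i) = UNIV"
      unfolding UN_box_eq_UNIV by auto
    show "emeasure ?M (?A i) \<noteq> \<infinity>" for i
      unfolding eq using emeasure_lborel_box_finite[of "- (real i *\<^sub>R One)" "real i *\<^sub>R One :: 'a"]
      by (auto simp: emeasure_density_const ennreal_mult_eq_top_iff)
    show "emeasure ?M X = emeasure ?N X" if "X \<in> ?E" for X
      using that eq by auto
  qed
  then have "AE x in lborel. ennreal (h x + B) = ennreal B"
    by (intro sigma_finite_measure.density_unique[OF sigma_finite_lborel]) auto
  then show ?thesis
    using bnd by eventually_elim (use B in \<open>auto simp: ennreal_inj\<close>)
qed

text \<open>At a fixed step size additivity is exact if the quotient along \<open>v\<close> is taken
  at the point shifted by the step along \<open>w\<close>. Integrating over boxes and letting the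
  step tend to 0 removes the shift; box integrals then determine the function.\<close>

lemma AE_dir_deriv_add:
  fixes f :: "'a::euclidean_space \<Rightarrow> real"
  assumes lip: "L-lipschitz_on UNIV f"
  shows "AE x in lborel. dir_deriv f (v + w) x = dir_deriv f v x + dir_deriv f w x"
proof -
  have [measurable]: "f \<in> borel_measurable borel"
    using lip by (intro borel_measurable_continuous_onI lipschitz_on_continuous_on)
  note [measurable] = borel_measurable_diff_quot borel_measurable_dir_deriv
  define h where "h = (\<lambda>x. dir_deriv f (v + w) x - dir_deriv f v x - dir_deriv f w x)"
  have bnd: "AE x in lborel. \<bar>h x\<bar> \<le> L * norm (v + w) + L * norm v + L * norm w"
    using AE_abs_dir_deriv_le[OF lip, of "v + w"] AE_abs_dir_deriv_le[OF lip, of v]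
      AE_abs_dir_deriv_le[OF lip, of w]
    by eventually_elim (auto simp: h_def)
  have "AE x in lborel. h x = 0"
  proof (rule AE_zero_if_box_integrals_zero[OF _ bnd])
    show "h \<in> borel_measurable borel" unfolding h_def by measurable
    fix a b :: 'a
    have fin: "emeasure lborel (box a b) < \<infinity>" by (rule emeasure_lborel_box_finite)
    have int: "integrable lborel (\<lambda>x. indicator (box a b) x * g x)"
      if [measurable]: "g \<in> borel_measurable borel" and g: "AE x in lborel. \<bar>g x\<bar> \<le> C" for g :: "'a \<Rightarrow> real" and C
    proof (rule Bochner_Integration.integrable_bound)
      show "integrable lborel (\<lambda>x. indicator (box a b) x * C)"
        using fin by (intro integrable_mult_left integrable_real_indicator) auto
      show "AE x in lborel. norm (indicator (box a b) x * g x) \<le> norm (indicator (box a b) x * C)"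
        using g by eventually_elim (auto split: split_indicator)
    qed measurable
    let ?t = "\<lambda>n. 1 / real (Suc n)"
    have split: "(\<integral>x. indicator (box a b) x * diff_quot f (v + w) x (?t n) \<partial>lborel) =
        (\<integral>x. indicator (box a b) x * diff_quot f v (x + ?t n *\<^sub>R w) (?t n) \<partial>lborel) +
        (\<integral>x. indicator (box a b) x * diff_quot f w x (?t n) \<partial>lborel)" for n
    proof -
      have "diff_quot f (v + w) x (?t n) = diff_quot f v (x + ?t n *\<^sub>R w) (?t n) + diff_quot f w x (?t n)" for x
        by (simp add: diff_quot_def algebra_simps)
      moreover have "integrable lborel (\<lambda>x. indicator (box a b) x * diff_quot f v (x + ?t n *\<^sub>R w) (?t n))"
        by (rule int[where C = "L * norm v"]) (auto intro: AE_I2 diff_quot_bound[OF lip])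
      moreover have "integrable lborel (\<lambda>x. indicator (box a b) x * diff_quot f w x (?t n))"
        by (rule int[where C = "L * norm w"]) (auto intro: AE_I2 diff_quot_bound[OF lip])
      ultimately show ?thesis
        by (simp add: distrib_left)
    qed
    have l1: "(\<lambda>n. \<integral>x. indicator (box a b) x * diff_quot f u x (?t n) \<partial>lborel)
      \<longlonglongrightarrow> (\<integral>x. indicator (box a b) x * dir_deriv f u x \<partial>lborel)" for u
      using dir_deriv_box_integral[OF lip, of a b u 0] by simp
    have "(\<integral>x. indicator (box a b) x * dir_deriv f (v + w) x \<partial>lborel) =
        (\<integral>x. indicator (box a b) x * dir_deriv f v x \<partial>lborel) +
        (\<integral>x. indicator (box a b) x * dir_deriv f w x \<partial>lborel)"
      by (rule LIMSEQ_unique[OF l1[of "v + w"]])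
        (unfold split, intro tendsto_add dir_deriv_box_integral[OF lip] l1)
    then show "(\<integral>x. indicator (box a b) x * h x \<partial>lborel) = 0"
      using int[OF _ AE_abs_dir_deriv_le[OF lip, of v]] int[OF _ AE_abs_dir_deriv_le[OF lip, of w]]
        int[OF _ AE_abs_dir_deriv_le[OF lip, of "v + w"]]
      by (simp add: h_def algebra_simps)
  qed
  then show ?thesis by eventually_elim (simp add: h_def)
qed

text \<open>Being built from limits of difference quotients it is Borel on the whole space, so it
  can be integrated; it stands in for \<open>grad f\<close> under integrals.\<close>

definition ae_grad :: "('a::euclidean_space \<Rightarrow> real) \<Rightarrow> 'a \<Rightarrow> 'a" where
  "ae_grad f x = (\<Sum>b\<in>Basis. dir_deriv f b x *\<^sub>R b)"

lemma borel_measurable_ae_grad: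
  assumes "f \<in> borel_measurable borel"
  shows "ae_grad f \<in> borel_measurable borel"
  unfolding ae_grad_def[abs_def]
  by (intro borel_measurable_sum borel_measurable_scaleR borel_measurable_dir_deriv assms) simp

text \<open>The directions for which this holds form a subspace, by additivity and rescaling of the
  step, and it contains the basis. The exceptional null set still depends on
  \<open>v\<close>.\<close>

lemma AE_diff_quot_tendsto_ae_grad:
  fixes f :: "'a::euclidean_space \<Rightarrow> real"
  assumes lip: "L-lipschitz_on UNIV f"
  shows "AE x in lborel. (diff_quot f v x \<longlongrightarrow> ae_grad f x \<bullet> v) (at 0)"
proof -
  define P where "P = (\<lambda>v. AE x in lborel. (diff_quot f v x \<longlongrightarrow> ae_grad f x \<bullet> v) (at 0))"
  have "P v" if "v \<in> span Basis" for v
    using that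
  proof (rule span_induct)
    fix b :: 'a assume "b \<in> Basis"
    then have "ae_grad f x \<bullet> b = dir_deriv f b x" for x
      by (simp add: ae_grad_def inner_sum_left inner_Basis if_distrib sum.delta cong: if_cong)
    then show "P b" unfolding P_def using AE_dir_deriv[OF lip, of b] by simp
  next
    show "subspace {v. P v}"
    proof (rule subspaceI, safe)
      show "P 0" unfolding P_def diff_quot_def by simp
    next
      fix v w assume "P v" "P w"
      then show "P (v + w)"
        unfolding P_def using AE_dir_deriv[OF lip, of "v + w"] AE_dir_deriv_add[OF lip, of v w]
      proof eventually_elim
        case (elim x)
        from dir_deriv_eqI[OF elim(1)] dir_deriv_eqI[OF elim(2)] elim(3,4)
        show ?case by (simp add: inner_add_right)
      qed
    next
      fix c v assume v: "P v"
      show "P (c *\<^sub>R v)"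
      proof (cases "c = 0")
        case True
        then show ?thesis unfolding P_def diff_quot_def by simp
      next
        case False
        have eq: "diff_quot f (c *\<^sub>R v) x = (\<lambda>t. c * diff_quot f v x (c * t))" for x
          using False by (auto simp: diff_quot_def fun_eq_iff ac_simps)
        have "((\<lambda>t. c * t) \<longlongrightarrow> c * 0) (at 0)" by (intro tendsto_intros)
        then have c: "filterlim (\<lambda>t. c * t) (at 0) (at (0::real))"
          using False unfolding filterlim_at by (auto simp: eventually_at_filter)
        from v show ?thesis
          unfolding P_def eq
        proof eventually_elim
          case (elim x)
          show ?case
            using tendsto_mult[OF tendsto_const filterlim_compose[OF elim c], of c] by simp
        qed
      qed
    qed
  qed
  then show ?thesis unfolding P_def by simp
qed

text \<open>Convergence holds outside one null set for all directions of a countable dense set.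
  Compactness of the unit sphere reduces to finitely many of them, and the Lipschitz bound transfers
  the estimate to every direction uniformly, giving a total derivative.\<close>

theorem Rademacher:
  fixes f :: "'a::euclidean_space \<Rightarrow> real"
  assumes lip: "L-lipschitz_on UNIV f"
  shows "AE x in lborel. GDERIV f x :> ae_grad f x"
proof -
  obtain Q :: "'a set" where Q: "countable Q" "\<And>X. open X \<Longrightarrow> X \<noteq> {} \<Longrightarrow> \<exists>d\<in>Q. d \<in> X"
    using countable_dense_exists by blast
  have "AE x in lborel. \<forall>v\<in>Q. (diff_quot f v x \<longlongrightarrow> ae_grad f x \<bullet> v) (at 0)"
    using Q(1) AE_diff_quot_tendsto_ae_grad[OF lip] by (simp add: AE_ball_countable)
  then show ?thesis
  proof (rule eventually_mono)
    fix x assume x: "\<forall>v\<in>Q. (diff_quot f v x \<longlongrightarrow> ae_grad f x \<bullet> v) (at 0)"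
    define D where "D = ae_grad f x"
    have L: "0 \<le> L" using lipschitz_on_nonneg[OF lip] .
    have "\<exists>d>0. \<forall>y. norm (y - x) < d \<longrightarrow> norm (f y - f x - (y - x) \<bullet> D) \<le> e * norm (y - x)"
      if e: "0 < e" for e
    proof -
      \<comment> \<open>Three errors share \<open>e\<close>: moving the direction inside
        \<open>f\<close> costs \<open>L * e'\<close>, the difference quotient along the nearby
        direction costs \<open>e'\<close>, and moving the direction inside the linear map costs
        \<open>norm D * e'\<close>.\<close>
      define e' where "e' = e / (L + 1 + norm D)"
      have pos: "0 < L + 1 + norm D" using L norm_ge_zero[of D] by linarith
      then have e': "0 < e'" using e by (simp add: e'_def)
      have "sphere (0::'a) 1 \<subseteq> (\<Union>v\<in>Q. ball v e')"
      proof
        fix u :: 'a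
        obtain v where "v \<in> Q" "v \<in> ball u e'" using Q(2)[of "ball u e'"] e' by auto
        then show "u \<in> (\<Union>v\<in>Q. ball v e')" by (auto simp: dist_commute)
      qed
      then obtain F where F: "F \<subseteq> Q" "finite F" "sphere (0::'a) 1 \<subseteq> (\<Union>v\<in>F. ball v e')"
        using compactE_image[OF compact_sphere, of Q "\<lambda>v. ball v e'" "0::'a" 1] open_ball by metis
      have "\<forall>\<^sub>F t in at 0. \<forall>v\<in>F. \<bar>diff_quot f v x t - D \<bullet> v\<bar> < e'"
        using F x e' by (intro eventually_ball_finite) (auto dest!: tendstoD simp: D_def dist_real_def subset_iff)
      then obtain d where d: "d > 0"
        "\<And>t v. t \<noteq> 0 \<Longrightarrow> \<bar>t\<bar> < d \<Longrightarrow> v \<in> F \<Longrightarrow> \<bar>diff_quot f v x t - D \<bullet> v\<bar> < e'"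
        unfolding eventually_at by (auto simp: dist_real_def)
      have "norm (f y - f x - (y - x) \<bullet> D) \<le> e * norm (y - x)" if y: "norm (y - x) < d" for y
      proof (cases "y = x")
        case False
        define t where "t = norm (y - x)"
        define u where "u = (1 / t) *\<^sub>R (y - x)"
        have t: "t > 0" using False by (simp add: t_def)
        have yx: "y = x + t *\<^sub>R u" using t by (simp add: u_def)
        have "u \<in> sphere 0 1" using t by (simp add: u_def t_def)
        then obtain v where v: "v \<in> F" "norm (u - v) < e'" using F(3) by (auto simp: dist_norm norm_minus_commute)
        have 1: "\<bar>f (x + t *\<^sub>R u) - f (x + t *\<^sub>R v)\<bar> \<le> t * (L * e')"
        proof -
          have "\<bar>f (x + t *\<^sub>R u) - f (x + t *\<^sub>R v)\<bar> \<le> L * (t * norm (u - v))"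
            using lipschitz_on_absD[OF lip, of "x + t *\<^sub>R u" "x + t *\<^sub>R v"] t
            by (simp add: scaleR_diff_right[symmetric])
          also have "\<dots> \<le> L * (t * e')" using v t L by (intro mult_left_mono) auto
          finally show ?thesis by (simp add: ac_simps)
        qed
        have "\<bar>t * (diff_quot f v x t - D \<bullet> v)\<bar> \<le> t * e'"
          using d(2)[of t v] t v y by (simp add: abs_mult t_def)
        moreover have "t * diff_quot f v x t = f (x + t *\<^sub>R v) - f x"
          using t by (simp add: diff_quot_def)
        ultimately have 2: "\<bar>f (x + t *\<^sub>R v) - f x - t * (D \<bullet> v)\<bar> \<le> t * e'"
          by (simp add: right_diff_distrib)
        have "\<bar>D \<bullet> (v - u)\<bar> \<le> norm D * e'"
          using v(2) by (intro order_trans[OF Cauchy_Schwarz_ineq2] mult_left_mono) (auto simp: norm_minus_commute)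
        then have 3: "\<bar>t * (D \<bullet> v) - t * (D \<bullet> u)\<bar> \<le> t * (norm D * e')"
          using t by (simp add: right_diff_distrib[symmetric] inner_diff_right[symmetric] abs_mult)
        have "\<bar>f y - f x - (y - x) \<bullet> D\<bar> \<le> t * (L * e') + t * e' + t * (norm D * e')"
          using 1 2 3 unfolding yx by (simp add: inner_commute)
        also have "\<dots> = t * (e' * (L + 1 + norm D))" by (simp add: algebra_simps)
        also have "e' * (L + 1 + norm D) = e" using pos by (simp add: e'_def)
        finally show ?thesis by (simp add: t_def mult.commute)
      qed simp
      with d(1) show ?thesis by blast
    qed
    then show "GDERIV f x :> ae_grad f x"
      unfolding gderiv_def has_derivative_at_alt D_def[symmetric]
      by (auto intro: bounded_linear_inner_left)
  qed
qed


section \<open>Gaussian measure and Gaussian smoothing\<close>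

lemma sets_std_gaussian[simp, measurable_cong]: "sets std_gaussian = sets borel"
  by (simp add: std_gaussian_def)

lemma space_std_gaussian[simp]: "space std_gaussian = UNIV"
  by (simp add: std_gaussian_def)

lemma prod_std_normal_density:
  "(\<Prod>b\<in>Basis. std_normal_density (u \<bullet> b)) =
    (1 / sqrt (2 * pi)) ^ DIM('a) * exp (- (norm u)\<^sup>2 / 2)" for u :: "'a::euclidean_space"
proof -
  have "(\<Sum>b\<in>Basis. - (u \<bullet> b)\<^sup>2 / 2) = - (norm u)\<^sup>2 / 2"
    unfolding power2_norm_eq_inner euclidean_inner[of u u] sum_negf[symmetric] sum_divide_distrib
    by (simp add: power2_eq_square)
  then show ?thesis
    by (simp add: std_normal_density_def prod.distrib prod_dividef exp_sum[symmetric] power_one_over)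
qed

definition gauss_density :: "'a::euclidean_space \<Rightarrow> real" where
  "gauss_density u = (1 / sqrt (2 * pi)) ^ DIM('a) * exp (- (norm u)\<^sup>2 / 2)"

lemma gauss_density_pos: "0 < gauss_density u"
  by (simp add: gauss_density_def)

lemma borel_measurable_gauss_density[measurable]: "gauss_density \<in> borel_measurable borel"
  unfolding gauss_density_def[abs_def] by measurable

lemma std_gaussian_eq: "std_gaussian = density lborel (\<lambda>u. ennreal (gauss_density u))"
  unfolding std_gaussian_def prod_std_normal_density gauss_density_def ..

lemma AE_std_gaussianI:
  "AE u in lborel. P u \<Longrightarrow> AE u in std_gaussian. P u"
  unfolding std_gaussian_eq by (subst AE_density) auto

lemma integral_std_gaussian:
  fixes g :: "'a::euclidean_space \<Rightarrow> 'b::{banach, second_countable_topology}"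
  assumes "g \<in> borel_measurable borel"
  shows "(\<integral>u. g u \<partial>std_gaussian) = (\<integral>u. gauss_density u *\<^sub>R g u \<partial>lborel)"
  unfolding std_gaussian_eq using assms
  by (intro integral_density) (auto intro: AE_I2 less_imp_le gauss_density_pos)

text \<open>In each coordinate the factor turns the standard normal density into
  \<open>sqrt 2\<close> times the centred normal density of variance 2.\<close>

lemma nn_integral_exp_std_gaussian:
  "(\<integral>\<^sup>+u. ennreal (exp ((norm u)\<^sup>2 / 4)) \<partial>(std_gaussian :: 'a::euclidean_space measure)) =
    ennreal (sqrt 2 ^ DIM('a))"
proof -
  have norm1: "(\<integral>\<^sup>+x. ennreal (normal_density 0 (sqrt 2) x) \<partial>lborel) = 1"
    using prob_space.emeasure_space_1[OF prob_space_normal_density[of "sqrt 2" 0]]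
    by (simp add: emeasure_density)
  have "(\<integral>\<^sup>+u. ennreal (exp ((norm u)\<^sup>2 / 4)) \<partial>(std_gaussian :: 'a measure)) =
      (\<integral>\<^sup>+u. (\<Prod>b\<in>Basis. ennreal (sqrt 2 * normal_density 0 (sqrt 2) ((u :: 'a) \<bullet> b))) \<partial>lborel)"
  proof (subst std_gaussian_eq, subst nn_integral_density, goal_cases)
    case 3
    show ?case
    proof (intro nn_integral_cong)
      fix u :: 'a
      have "(\<Sum>b\<in>Basis. - (u \<bullet> b)\<^sup>2 / 4) = - (norm u)\<^sup>2 / 4"
        unfolding power2_norm_eq_inner euclidean_inner[of u u] sum_negf[symmetric] sum_divide_distrib
        by (simp add: power2_eq_square)
      moreover have "sqrt 2 * normal_density 0 (sqrt 2) x = (1 / sqrt (2 * pi)) * exp (- x\<^sup>2 / 4)" for x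
        by (simp add: normal_density_def real_sqrt_mult field_simps)
      ultimately have "(\<Prod>b\<in>Basis. sqrt 2 * normal_density 0 (sqrt 2) (u \<bullet> b)) =
          (1 / sqrt (2 * pi)) ^ DIM('a) * exp (- (norm u)\<^sup>2 / 4)"
        by (simp only: prod.distrib prod_constant exp_sum[symmetric] finite_Basis)
      also have "\<dots> = gauss_density u * exp ((norm u)\<^sup>2 / 4)"
        unfolding gauss_density_def by (simp add: mult_exp_exp mult.assoc)
      finally show "ennreal (gauss_density u) * ennreal (exp ((norm u)\<^sup>2 / 4)) =
          (\<Prod>b\<in>Basis. ennreal (sqrt 2 * normal_density 0 (sqrt 2) (u \<bullet> b)))"
        using gauss_density_pos[of u]
        by (subst prod_ennreal) (simp_all only: ennreal_mult'[symmetric] less_imp_le[of 0], simp)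
    qed
  qed auto
  also have "\<dots> = (\<Prod>b\<in>(Basis::'a set). (\<integral>\<^sup>+x. ennreal (sqrt 2 * normal_density 0 (sqrt 2) x) \<partial>lborel))"
    by (rule nn_integral_lborel_prod) auto
  also have "\<dots> = ennreal (sqrt 2) ^ DIM('a)"
    by (simp add: ennreal_mult nn_integral_cmult norm1)
  finally show ?thesis by (simp add: ennreal_power)
qed

lemma prob_space_std_gaussian: "prob_space (std_gaussian :: 'a::euclidean_space measure)"
proof
  have norm1: "(\<integral>\<^sup>+x. ennreal (std_normal_density x) \<partial>lborel) = 1"
    using prob_space.emeasure_space_1[OF prob_space_normal_density[of 1 0]]
    by (simp add: emeasure_density)
  have "emeasure (std_gaussian :: 'a measure) UNIV =
      (\<integral>\<^sup>+u. (\<Prod>b\<in>Basis. ennreal (std_normal_density ((u :: 'a) \<bullet> b))) \<partial>lborel)"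
    unfolding std_gaussian_def by (subst emeasure_density) (auto simp: prod_ennreal)
  also have "\<dots> = (\<Prod>b\<in>(Basis::'a set). (\<integral>\<^sup>+x. ennreal (std_normal_density x) \<partial>lborel))"
    by (rule nn_integral_lborel_prod) auto
  finally show "emeasure (std_gaussian :: 'a measure) (space std_gaussian) = 1"
    by (simp add: norm1)
qed

interpretation std_gaussian: prob_space "std_gaussian :: 'a::euclidean_space measure"
  by (rule prob_space_std_gaussian)

lemma measure_std_gaussian_UNIV[simp]: "measure (std_gaussian :: 'a::euclidean_space measure) UNIV = 1"
  using std_gaussian.prob_space[where 'a = 'a] by simp

lemma has_bochner_integral_exp_std_gaussian:
  "has_bochner_integral (std_gaussian :: 'a::euclidean_space measure)
    (\<lambda>u. exp ((norm u)\<^sup>2 / 4)) (sqrt 2 ^ DIM('a))"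
  by (rule has_bochner_integral_nn_integral) (auto simp: nn_integral_exp_std_gaussian)

lemma integrable_std_gaussian:
  fixes g :: "'a::euclidean_space \<Rightarrow> 'b::{banach, second_countable_topology}"
  assumes "g \<in> borel_measurable borel" and "\<And>u. norm (g u) \<le> K * exp ((norm u)\<^sup>2 / 4)"
  shows "integrable std_gaussian g"
proof (rule Bochner_Integration.integrable_bound)
  show "integrable std_gaussian (\<lambda>u::'a. K * exp ((norm u)\<^sup>2 / 4))"
    using has_bochner_integral_exp_std_gaussian by (auto simp: has_bochner_integral_iff)
  show "AE u in std_gaussian. norm (g u) \<le> norm (K * exp ((norm u)\<^sup>2 / 4))"
    using assms(2) by (intro AE_I2) (metis abs_ge_self order_trans real_norm_def)
qed (use assms(1) in simp)

lemma norm_le_exp: "norm u \<le> exp ((norm u)\<^sup>2 / 4)"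
proof -
  have "norm u \<le> 1 + (norm u)\<^sup>2 / 4"
    using zero_le_power2[of "norm u / 2 - 1"] by (simp add: power2_eq_square algebra_simps)
  then show ?thesis using exp_ge_add_one_self order_trans by blast
qed

lemma norm_pow4_le_exp: "norm u ^ 4 \<le> 32 * exp ((norm u)\<^sup>2 / 4)"
proof -
  have "norm u ^ 4 / 32 = ((norm u)\<^sup>2 / 4)\<^sup>2 / 2" by (simp add: power_divide)
  also have "\<dots> \<le> exp ((norm u)\<^sup>2 / 4)"
    using exp_lower_Taylor_quadratic[of "(norm u)\<^sup>2 / 4"] zero_le_power2[of "norm u"] by linarith
  finally show ?thesis by simp
qed


section \<open>Gradients and difference quotients\<close>

lemma GDERIV_unique:
  assumes "GDERIV f x :> D" "GDERIV f x :> D'"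
  shows "D = D'"
proof -
  have "(\<lambda>h. h \<bullet> D) = (\<lambda>h. h \<bullet> D')"
    using assms unfolding gderiv_def by (rule has_derivative_unique)
  then show ?thesis by (metis inner_commute vector_eq_rdot)
qed

lemma grad_eq:
  assumes "GDERIV f x :> D"
  shows "grad f x = D"
  unfolding grad_def using assms GDERIV_unique by blast

lemma GDERIV_grad:
  fixes f :: "'a::euclidean_space \<Rightarrow> real"
  assumes "f differentiable (at x)"
  shows "GDERIV f x :> grad f x"
proof -
  obtain f' where f': "(f has_derivative f') (at x)" using assms by (auto simp: differentiable_def)
  then interpret linear f' by (rule has_derivative_linear)
  define D where "D = (\<Sum>b\<in>Basis. f' b *\<^sub>R b)"
  have "f' h = h \<bullet> D" for h
  proof -
    have "f' h = f' (\<Sum>b\<in>Basis. (h \<bullet> b) *\<^sub>R b)" by (simp add: euclidean_representation)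
    also have "\<dots> = (\<Sum>b\<in>Basis. (h \<bullet> b) * f' b)" by (simp add: sum scale)
    finally show ?thesis by (simp add: D_def inner_sum_right ac_simps)
  qed
  then have "f' = (\<lambda>h. h \<bullet> D)" by (rule ext)
  then have "GDERIV f x :> D" unfolding gderiv_def using f' by simp
  then show ?thesis using grad_eq by metis
qed

lemma GDERIV_diff_quot:
  assumes "GDERIV f x :> D"
  shows "(diff_quot f v x \<longlongrightarrow> v \<bullet> D) (at 0)"
proof -
  have 1: "((\<lambda>t. x + t *\<^sub>R v) has_derivative (\<lambda>t. t *\<^sub>R v)) (at 0)"
    by (auto intro!: derivative_eq_intros)
  have 2: "(f has_derivative (\<lambda>h. h \<bullet> D)) (at (x + 0 *\<^sub>R v))"
    using assms by (simp add: gderiv_def)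
  have "((\<lambda>t. f (x + t *\<^sub>R v)) has_derivative (\<lambda>t. (t *\<^sub>R v) \<bullet> D)) (at 0)"
    by (rule has_derivative_compose[OF 1 2])
  then have "((\<lambda>t. f (x + t *\<^sub>R v)) has_field_derivative (v \<bullet> D)) (at 0)"
    unfolding has_field_derivative_def by (simp add: mult_commute_abs)
  then show ?thesis
    unfolding DERIV_def diff_quot_def by simp
qed

text \<open>Along the direction \<open>D\<close> itself the difference quotients tend to |D|^2 while
  staying below \<open>L * norm D\<close>.\<close>

lemma norm_gradient_le:
  fixes f :: "'a::real_inner \<Rightarrow> real"
  assumes lip: "L-lipschitz_on UNIV f" and D: "GDERIV f x :> D"
  shows "norm D \<le> L"
proof -
  have "D \<bullet> D \<le> L * norm D"
    by (rule tendsto_upperbound[OF GDERIV_diff_quot[OF D]])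
      (auto intro!: always_eventually abs_le_D1[OF diff_quot_bound[OF lip]])
  then have "norm D * norm D \<le> L * norm D" by (simp add: norm_eq_sqrt_inner)
  then show ?thesis
    using lipschitz_on_nonneg[OF lip] by (cases "D = 0") auto
qed

lemma AE_lborel_affine:
  fixes z :: "'a::euclidean_space"
  assumes "AE x in lborel. P x" and c: "c \<noteq> 0"
  shows "AE u in lborel. P (z + c *\<^sub>R u)"
proof -
  obtain N where N: "{x. \<not> P x} \<subseteq> N" "N \<in> null_sets lborel"
    using assms(1) by (auto simp: eventually_ae_filter)
  have [measurable]: "N \<in> sets borel" using N(2) by auto
  have "0 = emeasure (density (distr lborel borel (\<lambda>x. z + c *\<^sub>R x)) (\<lambda>_. \<bar>c\<bar> ^ DIM('a))) N"
    using N(2) lborel_affine[OF c, of z] by (simp add: null_sets_def)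
  also have "\<dots> = ennreal (\<bar>c\<bar> ^ DIM('a)) * emeasure lborel ((\<lambda>x. z + c *\<^sub>R x) -` N)"
    by (simp add: emeasure_density_const emeasure_distr)
  finally have "emeasure lborel ((\<lambda>x. z + c *\<^sub>R x) -` N) = 0" using c by auto
  then have "(\<lambda>x. z + c *\<^sub>R x) -` N \<in> null_sets lborel"
    using measurable_sets_borel[of "\<lambda>x. z + c *\<^sub>R x" borel N] by (auto simp: null_sets_def)
  from AE_not_in[OF this] show ?thesis using N(1) by (auto elim!: eventually_mono)
qed

text \<open>Tilting the density moves the shift off \<open>g\<close>, so that the shifted integral can be differentiated in \<open>v\<close>
  without differentiating \<open>g\<close>.\<close>

lemma gaussian_shift:
  fixes g :: "'a::euclidean_space \<Rightarrow> real"
  assumes [measurable]: "g \<in> borel_measurable borel"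
  shows "(\<integral>u. g (u + v) \<partial>std_gaussian) =
    (\<integral>u. exp (u \<bullet> v - (norm v)\<^sup>2 / 2) * g u \<partial>std_gaussian)"
proof -
  have dens: "gauss_density (u - v) = gauss_density u * exp (u \<bullet> v - (norm v)\<^sup>2 / 2)" for u :: 'a
  proof -
    have "- (norm (u - v))\<^sup>2 / 2 = - (norm u)\<^sup>2 / 2 + (u \<bullet> v - (norm v)\<^sup>2 / 2)"
      by (simp add: power2_norm_eq_inner inner_diff_left inner_diff_right inner_commute field_simps)
    then show ?thesis by (simp only: gauss_density_def exp_add mult.assoc)
  qed
  have "(\<integral>u. exp (u \<bullet> v - (norm v)\<^sup>2 / 2) * g u \<partial>std_gaussian) =
      (\<integral>u. gauss_density (u - v) * g u \<partial>lborel)"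
    by (subst integral_std_gaussian) (auto simp: dens mult.assoc)
  also have "\<dots> = (\<integral>u. gauss_density (u - v) * g u \<partial>distr lborel borel ((+) v))"
    by (simp add: lborel_distr_plus)
  also have "\<dots> = (\<integral>u. gauss_density u * g (u + v) \<partial>lborel)"
    by (subst integral_distr) (auto simp: add.commute)
  also have "\<dots> = (\<integral>u. g (u + v) \<partial>std_gaussian)"
    by (subst integral_std_gaussian) auto
  finally show ?thesis ..
qed

lemma abs_exp_minus_one_le: "\<bar>exp y - 1\<bar> \<le> \<bar>y\<bar> * exp \<bar>y\<bar>" for y :: real
proof (cases "y \<ge> 0")
  case True
  have "1 - y \<le> exp (- y)" using exp_ge_add_one_self[of "- y"] by simp
  then have "(1 - y) * exp y \<le> exp (- y) * exp y" by (rule mult_right_mono) simp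
  then have "exp y - 1 \<le> y * exp y" by (simp add: exp_minus algebra_simps)
  then show ?thesis using True by simp
next
  case False
  have "1 - exp y \<le> - y" using exp_ge_add_one_self[of y] by linarith
  also have "\<dots> \<le> - y * exp (- y)" using False mult_left_mono[of 1 "exp (- y)" "- y"] by simp
  finally show ?thesis using False by simp
qed

section \<open>The gradient of the Gaussian smoothing\<close>

context
  fixes f :: "'a::euclidean_space \<Rightarrow> real" and L \<mu> :: real
  assumes lip: "L-lipschitz_on UNIV f" and \<mu>: "0 < \<mu>"
begin

lemma borel_measurable_lip[measurable]: "f \<in> borel_measurable borel"
  using lip by (intro borel_measurable_continuous_onI lipschitz_on_continuous_on)

lemma lip_nonneg: "0 \<le> L"
  using lipschitz_on_nonneg[OF lip] .

lemmas borel_measurable_ae_grad_lip[measurable] = borel_measurable_ae_grad[OF borel_measurable_lip]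

lemma AE_gradient:
  "AE u in std_gaussian. GDERIV f (z + \<mu> *\<^sub>R u) :> ae_grad f (z + \<mu> *\<^sub>R u)"
  using \<mu> by (intro AE_std_gaussianI AE_lborel_affine[OF Rademacher[OF lip]]) auto

lemma AE_norm_ae_grad_le: "AE u in std_gaussian. norm (ae_grad f (z + \<mu> *\<^sub>R u)) \<le> L"
  using AE_gradient by eventually_elim (rule norm_gradient_le[OF lip])

lemma integrable_ae_grad: "integrable std_gaussian (\<lambda>u. ae_grad f (z + \<mu> *\<^sub>R u))"
  by (rule std_gaussian.integrable_const_bound[OF AE_norm_ae_grad_le]) measurable

lemma integrable_shift: "integrable std_gaussian (\<lambda>u. f (z + \<mu> *\<^sub>R u))"
proof (rule integrable_std_gaussian)
  fix u
  have "\<bar>f (z + \<mu> *\<^sub>R u)\<bar> \<le> \<bar>f z\<bar> + L * (\<mu> * norm u)"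
    using lipschitz_on_absD[OF lip, of "z + \<mu> *\<^sub>R u" z] \<mu> by simp
  also have "\<dots> \<le> \<bar>f z\<bar> * exp ((norm u)\<^sup>2 / 4) + L * (\<mu> * exp ((norm u)\<^sup>2 / 4))"
    using \<mu> lip_nonneg norm_le_exp[of u] mult_left_mono[of 1 "exp ((norm u)\<^sup>2 / 4)" "\<bar>f z\<bar>"]
    by (intro add_mono mult_left_mono) auto
  finally show "norm (f (z + \<mu> *\<^sub>R u)) \<le> (\<bar>f z\<bar> + L * \<mu>) * exp ((norm u)\<^sup>2 / 4)"
    by (simp add: algebra_simps)
qed measurable

text \<open>The remainder of first order, divided by |h|, is bounded by \<open>2 * L\<close> and
  tends to 0 almost surely by Rademacher, so dominated convergence differentiates under the
  integral. Convergence is tested along sequences for that purpose.\<close>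

lemma GDERIV_gaussian_smoothing:
  "GDERIV (gaussian_smoothing \<mu> f) z :> (\<integral>u. ae_grad f (z + \<mu> *\<^sub>R u) \<partial>std_gaussian)"
  unfolding gderiv_def has_derivative_at
proof (intro conjI)
  let ?A = "\<lambda>u. ae_grad f (z + \<mu> *\<^sub>R u)"
  let ?r = "\<lambda>h u. f (z + h + \<mu> *\<^sub>R u) - f (z + \<mu> *\<^sub>R u) - h \<bullet> ?A u"
  show "bounded_linear (\<lambda>h. h \<bullet> (\<integral>u. ?A u \<partial>std_gaussian))" by (rule bounded_linear_inner_left)
  have rint: "integrable std_gaussian (?r h)" for h
    using integrable_shift[of "z + h"] integrable_shift[of z] integrable_ae_grad[of z] by (simp add: add.assoc)
  have rem: "gaussian_smoothing \<mu> f (z + h) - gaussian_smoothing \<mu> f z - h \<bullet> (\<integral>u. ?A u \<partial>std_gaussian) =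
      (\<integral>u. ?r h u \<partial>std_gaussian)" for h
    unfolding gaussian_smoothing_def
    using integrable_shift[of "z + h"] integrable_shift[of z] integrable_ae_grad[of z]
    by (simp add: add.assoc)
  have "((\<lambda>h. \<integral>u. \<bar>?r h u\<bar> / norm h \<partial>std_gaussian) \<longlongrightarrow> 0) (at 0)"
    unfolding tendsto_at_iff_sequentially comp_def
  proof (intro allI impI)
    fix X :: "nat \<Rightarrow> 'a" assume X: "\<forall>i. X i \<in> UNIV - {0}" "X \<longlonglongrightarrow> 0"
    have "(\<lambda>i. \<integral>u. \<bar>?r (X i) u\<bar> / norm (X i) \<partial>std_gaussian) \<longlonglongrightarrow> (\<integral>u. 0 \<partial>(std_gaussian :: 'a measure))"
    proof (rule integral_dominated_convergence[where w = "\<lambda>_. 2 * L"])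
      show "AE u in std_gaussian. (\<lambda>i. \<bar>?r (X i) u\<bar> / norm (X i)) \<longlonglongrightarrow> 0"
        using AE_gradient[of z]
      proof eventually_elim
        case (elim u)
        have "((\<lambda>h. norm (f (z + \<mu> *\<^sub>R u + h) - f (z + \<mu> *\<^sub>R u) - h \<bullet> ?A u) / norm h) \<longlongrightarrow> 0) (at 0)"
          using elim by (simp add: gderiv_def has_derivative_at)
        then show ?case
          using X unfolding tendsto_at_iff_sequentially comp_def by (auto simp: add_ac)
      qed
      show "AE u in std_gaussian. norm (\<bar>?r (X i) u\<bar> / norm (X i)) \<le> 2 * L" for i
        using AE_norm_ae_grad_le[of z]
      proof eventually_elim
        case (elim u)
        have "\<bar>X i \<bullet> ?A u\<bar> \<le> norm (X i) * L"
          using elim by (intro order_trans[OF Cauchy_Schwarz_ineq2] mult_left_mono) auto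
        moreover have "\<bar>f (z + X i + \<mu> *\<^sub>R u) - f (z + \<mu> *\<^sub>R u)\<bar> \<le> L * norm (X i)"
          using lipschitz_on_absD[OF lip, of "z + X i + \<mu> *\<^sub>R u" "z + \<mu> *\<^sub>R u"] by simp
        ultimately have "\<bar>?r (X i) u\<bar> \<le> L * norm (X i) + norm (X i) * L"
          using abs_triangle_ineq4[of "f (z + X i + \<mu> *\<^sub>R u) - f (z + \<mu> *\<^sub>R u)" "X i \<bullet> ?A u"]
          by linarith
        then show ?case using X(1) by (simp add: pos_divide_le_eq algebra_simps)
      qed
    qed auto
    then show "(\<lambda>i. \<integral>u. \<bar>?r (X i) u\<bar> / norm (X i) \<partial>std_gaussian) \<longlonglongrightarrow> 0" by simp
  qed
  then show "(\<lambda>h. norm (gaussian_smoothing \<mu> f (z + h) - gaussian_smoothing \<mu> f z -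
      h \<bullet> (\<integral>u. ?A u \<partial>std_gaussian)) / norm h) \<midarrow>0\<rightarrow> 0"
  proof (rule Lim_null_comparison[rotated])
    show "\<forall>\<^sub>F h in at 0. norm (norm (gaussian_smoothing \<mu> f (z + h) - gaussian_smoothing \<mu> f z -
      h \<bullet> (\<integral>u. ?A u \<partial>std_gaussian)) / norm h) \<le> (\<integral>u. \<bar>?r h u\<bar> / norm h \<partial>std_gaussian)"
    proof (rule always_eventually, rule allI)
      fix h
      show "norm (norm (gaussian_smoothing \<mu> f (z + h) - gaussian_smoothing \<mu> f z -
        h \<bullet> (\<integral>u. ?A u \<partial>std_gaussian)) / norm h) \<le> (\<integral>u. \<bar>?r h u\<bar> / norm h \<partial>std_gaussian)"
        unfolding rem by (simp add: divide_right_mono integral_abs_bound)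
    qed
  qed
qed

text \<open>Both sides are limits of the same difference quotients of the smoothing. After tilting,
  the step \<open>s\<close> survives only in the weight (exp(s (u . v) - s^2 / 2) - 1) / s, whose
  limit is u . v, while \<open>f\<close> is never differentiated inside this computation.\<close>

lemma stein_inner:
  fixes z v :: 'a
  assumes v: "norm v = 1"
  shows "(\<integral>u. ((f (z + \<mu> *\<^sub>R u) - f z) / \<mu>) * (u \<bullet> v) \<partial>std_gaussian) =
    v \<bullet> grad (gaussian_smoothing \<mu> f) z"
proof -
  let ?t = "\<lambda>n. 1 / real (Suc n)"
  let ?g = "\<lambda>u. (f (z + \<mu> *\<^sub>R u) - f z) / \<mu>"
  let ?E = "\<lambda>n u. exp (?t n * (u \<bullet> v) - (?t n)\<^sup>2 / 2)"
  have gbnd: "\<bar>?g u\<bar> \<le> L * norm u" for u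
    using lipschitz_on_absD[OF lip, of "z + \<mu> *\<^sub>R u" z] \<mu>
    by (simp add: abs_divide pos_divide_le_eq ac_simps)
  \<comment> \<open>Moving \<open>z\<close> by \<open>\<mu> * s\<close> along \<open>v\<close> is
    the same as moving \<open>u\<close> by \<open>s\<close> along \<open>v\<close>, which
    \<open>gaussian_shift\<close> converts into a change of weight.\<close>
  have sm: "(gaussian_smoothing \<mu> f (z + (\<mu> * s) *\<^sub>R v) - f z) / \<mu> =
      (\<integral>u. exp (s * (u \<bullet> v) - s\<^sup>2 / 2) * ?g u \<partial>std_gaussian)" for s
  proof -
    have "(gaussian_smoothing \<mu> f (z + (\<mu> * s) *\<^sub>R v) - f z) / \<mu> =
        (\<integral>u. (f (z + (\<mu> * s) *\<^sub>R v + \<mu> *\<^sub>R u) - f z) / \<mu> \<partial>std_gaussian)"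
      unfolding gaussian_smoothing_def
      using integrable_shift[of "z + (\<mu> * s) *\<^sub>R v"] by simp
    also have "\<dots> = (\<integral>u. ?g (u + s *\<^sub>R v) \<partial>std_gaussian)"
      by (simp add: algebra_simps)
    also have "\<dots> = (\<integral>u. exp (u \<bullet> (s *\<^sub>R v) - (norm (s *\<^sub>R v))\<^sup>2 / 2) * ?g u \<partial>std_gaussian)"
      by (rule gaussian_shift) measurable
    finally show ?thesis by (simp add: v)
  qed
  have dom: "\<bar>(exp (s * (u \<bullet> v) - s\<^sup>2 / 2) - 1) / s * ?g u\<bar> \<le> L * exp 10 * exp ((norm u)\<^sup>2 / 4)"
    if s: "0 < s" "s \<le> 1" for s u
  proof -
    let ?y = "s * (u \<bullet> v) - s\<^sup>2 / 2"
    have uv: "\<bar>u \<bullet> v\<bar> \<le> norm u" using Cauchy_Schwarz_ineq2[of u v] v by simp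
    have "?y = s * (u \<bullet> v - s / 2)" by (simp add: power2_eq_square algebra_simps)
    then have "\<bar>?y\<bar> = s * \<bar>u \<bullet> v - s / 2\<bar>" using s by (simp add: abs_mult)
    also have "\<dots> \<le> s * (norm u + 1)" using uv s by (intro mult_left_mono) auto
    finally have y: "\<bar>?y\<bar> \<le> s * (norm u + 1)" .
    also have "\<dots> \<le> norm u + 1" using s by (simp add: mult_left_le_one_le)
    finally have y': "\<bar>?y\<bar> \<le> norm u + 1" .
    have "\<bar>exp ?y - 1\<bar> \<le> \<bar>?y\<bar> * exp \<bar>?y\<bar>" by (rule abs_exp_minus_one_le)
    also have "\<dots> \<le> (s * (norm u + 1)) * exp (norm u + 1)"
      using y y' s by (intro mult_mono) auto
    finally have "\<bar>exp ?y - 1\<bar> / s \<le> (norm u + 1) * exp (norm u + 1)"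
      using s by (simp add: pos_divide_le_eq ac_simps)
    also have "\<dots> \<le> exp (norm u) * exp (norm u + 1)"
      using exp_ge_add_one_self[of "norm u"] by (intro mult_right_mono) (auto simp: add.commute)
    finally have 1: "\<bar>(exp ?y - 1) / s\<bar> \<le> exp (norm u) * exp (norm u + 1)"
      using s by (simp add: abs_divide)
    have "\<bar>?g u\<bar> \<le> L * exp (norm u)"
    proof -
      have "norm u \<le> exp (norm u)" using exp_ge_add_one_self[of "norm u"] by linarith
      then show ?thesis using gbnd[of u] lip_nonneg by (meson mult_left_mono order_trans)
    qed
    with 1 have "\<bar>(exp ?y - 1) / s\<bar> * \<bar>?g u\<bar> \<le> (exp (norm u) * exp (norm u + 1)) * (L * exp (norm u))"
      by (intro mult_mono) auto
    also have "\<dots> = L * exp (3 * norm u + 1)" by (simp add: exp_add[symmetric] ac_simps)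
    also have "\<dots> \<le> L * exp (10 + (norm u)\<^sup>2 / 4)"
    proof -
      \<comment> \<open>The 10 is 9 + 1, with the 9 coming from the square (|u| / 2 - 3)^2. The
        quadratic term then matches the available exponential moment.\<close>
      have "3 * norm u + 1 \<le> 10 + (norm u)\<^sup>2 / 4"
        using zero_le_power2[of "norm u / 2 - 3"] by (simp add: power2_eq_square algebra_simps)
      then show ?thesis using lip_nonneg by (intro mult_left_mono) auto
    qed
    finally show ?thesis by (simp add: abs_mult exp_add)
  qed
  have "(\<lambda>n. \<integral>u. (?E n u - 1) / ?t n * ?g u \<partial>std_gaussian) \<longlonglongrightarrow> (\<integral>u. (u \<bullet> v) * ?g u \<partial>std_gaussian)"
  proof (rule integral_dominated_convergence[where w = "\<lambda>u. L * exp 10 * exp ((norm u)\<^sup>2 / 4)"])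
    show "integrable std_gaussian (\<lambda>u::'a. L * exp 10 * exp ((norm u)\<^sup>2 / 4))"
      using has_bochner_integral_exp_std_gaussian by (auto simp: has_bochner_integral_iff)
    show "AE u in std_gaussian. norm ((?E n u - 1) / ?t n * ?g u) \<le> L * exp 10 * exp ((norm u)\<^sup>2 / 4)" for n
      using dom[of "?t n"] by (intro AE_I2) simp
    show "AE u in std_gaussian. (\<lambda>n. (?E n u - 1) / ?t n * ?g u) \<longlonglongrightarrow> (u \<bullet> v) * ?g u"
    proof (rule AE_I2)
      fix u
      have "((\<lambda>s. exp (s * (u \<bullet> v) - s\<^sup>2 / 2)) has_field_derivative (u \<bullet> v)) (at 0)"
        by (auto intro!: derivative_eq_intros)
      then have "((\<lambda>s. (exp (s * (u \<bullet> v) - s\<^sup>2 / 2) - 1) / s) \<longlongrightarrow> u \<bullet> v) (at 0)"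
        by (simp add: DERIV_def)
      from filterlim_compose[OF this filterlim_inverse_Suc_at_0]
      show "(\<lambda>n. (?E n u - 1) / ?t n * ?g u) \<longlonglongrightarrow> (u \<bullet> v) * ?g u"
        by (intro tendsto_mult tendsto_const)
    qed
  qed auto
  moreover have "(\<integral>u. (?E n u - 1) / ?t n * ?g u \<partial>std_gaussian) =
      diff_quot (gaussian_smoothing \<mu> f) v z (\<mu> * ?t n)" for n
  proof -
    have gint: "integrable std_gaussian ?g"
      using integrable_shift[of z] by simp
    have diffint: "integrable std_gaussian (\<lambda>u. (?E n u - 1) / ?t n * ?g u)"
      by (rule integrable_std_gaussian[where K = "L * exp 10"]) (use dom[of "?t n"] in auto)
    have solve: "I = D / t" if "t * I = D" "t \<noteq> 0" for I D t :: real
      using that by (auto simp: eq_divide_eq)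
    have tn: "?t n \<noteq> 0" by simp
    have id: "e * c = t * ((e - 1) / t * c) + c" if "t \<noteq> 0" for e t c :: real
      using that by (simp add: field_simps)
    have "(\<integral>u. ?E n u * ?g u \<partial>std_gaussian) =
        (\<integral>u. ?t n * ((?E n u - 1) / ?t n * ?g u) + ?g u \<partial>std_gaussian)"
      by (rule Bochner_Integration.integral_cong[OF refl]) (rule id[OF tn])
    also have "\<dots> = (\<integral>u. ?t n * ((?E n u - 1) / ?t n * ?g u) \<partial>std_gaussian) + (\<integral>u. ?g u \<partial>std_gaussian)"
      by (intro Bochner_Integration.integral_add integrable_mult_right diffint gint)
    also have "(\<integral>u. ?t n * ((?E n u - 1) / ?t n * ?g u) \<partial>std_gaussian) =
        ?t n * (\<integral>u. (?E n u - 1) / ?t n * ?g u \<partial>std_gaussian)"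
      by (rule integral_mult_right_zero)
    also have "(\<integral>u. ?g u \<partial>std_gaussian) = (gaussian_smoothing \<mu> f z - f z) / \<mu>"
      using sm[of 0, symmetric] by simp
    finally have "?t n * (\<integral>u. (?E n u - 1) / ?t n * ?g u \<partial>std_gaussian) =
        (gaussian_smoothing \<mu> f (z + (\<mu> * ?t n) *\<^sub>R v) - gaussian_smoothing \<mu> f z) / \<mu>"
      using sm[of "?t n"] by (simp add: diff_divide_distrib)
    then have "(\<integral>u. (?E n u - 1) / ?t n * ?g u \<partial>std_gaussian) =
        (gaussian_smoothing \<mu> f (z + (\<mu> * ?t n) *\<^sub>R v) - gaussian_smoothing \<mu> f z) / \<mu> / ?t n"
      by (rule solve) (rule tn)
    then show ?thesis by (simp only: diff_quot_def divide_divide_eq_left)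
  qed
  ultimately have 1: "(\<lambda>n. diff_quot (gaussian_smoothing \<mu> f) v z (\<mu> * ?t n))
      \<longlonglongrightarrow> (\<integral>u. (u \<bullet> v) * ?g u \<partial>std_gaussian)" by simp
  have "filterlim (\<lambda>n. \<mu> * ?t n) (at 0) sequentially"
    using \<mu> tendsto_mult[OF tendsto_const LIMSEQ_Suc[OF lim_1_over_n], of \<mu>]
    unfolding filterlim_at by (auto simp del: of_nat_Suc)
  from filterlim_compose[OF GDERIV_diff_quot[OF GDERIV_gaussian_smoothing] this]
  have 2: "(\<lambda>n. diff_quot (gaussian_smoothing \<mu> f) v z (\<mu> * ?t n))
      \<longlonglongrightarrow> v \<bullet> grad (gaussian_smoothing \<mu> f) z"
    using grad_eq[OF GDERIV_gaussian_smoothing] by simp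
  from LIMSEQ_unique[OF 1 2] show ?thesis by (simp add: mult.commute)
qed

lemma stein:
  shows "integrable std_gaussian (\<lambda>u. ((f (z + \<mu> *\<^sub>R u) - f z) / \<mu>) *\<^sub>R u)" (is ?int)
    and "(\<integral>u. ((f (z + \<mu> *\<^sub>R u) - f z) / \<mu>) *\<^sub>R u \<partial>std_gaussian) = grad (gaussian_smoothing \<mu> f) z"
proof -
  have "norm (((f (z + \<mu> *\<^sub>R u) - f z) / \<mu>) *\<^sub>R u) \<le> L * 4 * exp ((norm u)\<^sup>2 / 4)" for u
  proof -
    have "norm (((f (z + \<mu> *\<^sub>R u) - f z) / \<mu>) *\<^sub>R u) \<le> (L * norm u) * norm u"
      unfolding norm_scaleR using lipschitz_on_absD[OF lip, of "z + \<mu> *\<^sub>R u" z] \<mu>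
      by (intro mult_right_mono) (simp_all add: abs_divide pos_divide_le_eq ac_simps)
    also have "\<dots> = L * (4 * ((norm u)\<^sup>2 / 4))" by (simp add: power2_eq_square)
    also have "\<dots> \<le> L * (4 * exp ((norm u)\<^sup>2 / 4))"
      using exp_ge_add_one_self[of "(norm u)\<^sup>2 / 4"] lip_nonneg by (intro mult_left_mono) linarith+
    finally show ?thesis by simp
  qed
  then show int: ?int by (intro integrable_std_gaussian) auto
  show "(\<integral>u. ((f (z + \<mu> *\<^sub>R u) - f z) / \<mu>) *\<^sub>R u \<partial>std_gaussian) = grad (gaussian_smoothing \<mu> f) z"
  proof (rule euclidean_eqI)
    fix b :: 'a assume b: "b \<in> Basis"
    have "(\<integral>u. ((f (z + \<mu> *\<^sub>R u) - f z) / \<mu>) *\<^sub>R u \<partial>std_gaussian) \<bullet> b =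
        (\<integral>u. (((f (z + \<mu> *\<^sub>R u) - f z) / \<mu>) *\<^sub>R u) \<bullet> b \<partial>std_gaussian)"
      by (rule integral_inner_left[of b std_gaussian "\<lambda>u. ((f (z + \<mu> *\<^sub>R u) - f z) / \<mu>) *\<^sub>R u", symmetric])
        (rule int)
    also have "\<dots> = (\<integral>u. ((f (z + \<mu> *\<^sub>R u) - f z) / \<mu>) * (u \<bullet> b) \<partial>std_gaussian)"
      by (simp only: inner_scaleR_left)
    also have "\<dots> = grad (gaussian_smoothing \<mu> f) z \<bullet> b"
      unfolding stein_inner[OF norm_Basis[OF b]] by (rule inner_commute)
    finally show "(\<integral>u. ((f (z + \<mu> *\<^sub>R u) - f z) / \<mu>) *\<^sub>R u \<partial>std_gaussian) \<bullet> b =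
        grad (gaussian_smoothing \<mu> f) z \<bullet> b" .
  qed
qed

end


section \<open>The Goldstein subdifferential\<close>

text \<open>The set under the hull in \<open>clarke_gradient\<close>. The nested hulls of the
  Goldstein subdifferential collapse to a single one, so topological properties need checking only
  for limits of gradients.\<close>

definition limiting_grad :: "('a::euclidean_space \<Rightarrow> real) \<Rightarrow> 'a \<Rightarrow> 'a set" where
  "limiting_grad f z =
    {g. \<exists>w. w \<longlonglongrightarrow> z \<and> (\<forall>j::nat. f differentiable (at (w j))) \<and> (\<lambda>j. grad f (w j)) \<longlonglongrightarrow> g}"

definition goldstein_grads :: "real \<Rightarrow> ('a::euclidean_space \<Rightarrow> real) \<Rightarrow> 'a \<Rightarrow> 'a set" where
  "goldstein_grads \<delta> f z = (\<Union>z'\<in>cball z \<delta>. limiting_grad f z')"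

text \<open>Seen as a relation between point and limit, the limiting gradients are the closure of
  the graph of the gradient, hence closed jointly in both variables.\<close>

lemma limiting_grad_iff:
  "g \<in> limiting_grad f z \<longleftrightarrow> (z, g) \<in> closure {(w, grad f w) |w. f differentiable (at w)}"
proof
  assume "g \<in> limiting_grad f z"
  then obtain w where w: "w \<longlonglongrightarrow> z" "\<And>j::nat. f differentiable (at (w j))" "(\<lambda>j. grad f (w j)) \<longlonglongrightarrow> g"
    by (auto simp: limiting_grad_def)
  then show "(z, g) \<in> closure {(w, grad f w) |w. f differentiable (at w)}"
    unfolding closure_sequential
    by (intro exI[of _ "\<lambda>j. (w j, grad f (w j))"]) (auto intro: tendsto_Pair)
next
  assume "(z, g) \<in> closure {(w, grad f w) |w. f differentiable (at w)}"
  then obtain p where p: "\<And>n. p n \<in> {(w, grad f w) |w. f differentiable (at w)}" "p \<longlonglongrightarrow> (z, g)"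
    by (auto simp: closure_sequential)
  have "snd (p n) = grad f (fst (p n))" "f differentiable (at (fst (p n)))" for n
    using p(1)[of n] by auto
  then show "g \<in> limiting_grad f z"
    using tendsto_fst[OF p(2)] tendsto_snd[OF p(2)]
    by (auto simp: limiting_grad_def intro!: exI[of _ "\<lambda>n. fst (p n)"])
qed

lemma goldstein_subdifferential_eq:
  "goldstein_subdifferential \<delta> f z = convex hull (goldstein_grads \<delta> f z)"
proof (rule antisym)
  have "clarke_gradient f z' \<subseteq> convex hull (goldstein_grads \<delta> f z)" if "z' \<in> cball z \<delta>" for z'
    unfolding clarke_gradient_def limiting_grad_def[symmetric]
    using that by (intro hull_mono) (auto simp: goldstein_grads_def)
  then show "goldstein_subdifferential \<delta> f z \<subseteq> convex hull (goldstein_grads \<delta> f z)"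
    unfolding goldstein_subdifferential_def by (intro hull_minimal UN_least convex_convex_hull)
  show "convex hull (goldstein_grads \<delta> f z) \<subseteq> goldstein_subdifferential \<delta> f z"
    unfolding goldstein_subdifferential_def goldstein_grads_def clarke_gradient_def limiting_grad_def[symmetric]
    by (intro hull_mono UN_mono hull_subset) auto
qed

text \<open>The base points lie in balls of fixed radius around a convergent sequence, so a
  subsequence of them converges. With constant \<open>zs\<close> this yields closedness of one set
  of gradients, with varying \<open>zs\<close> the semicontinuity of the minimal norm.\<close>

lemma goldstein_grads_closed_graph:
  assumes z: "zs \<longlonglongrightarrow> z" and g: "gs \<longlonglongrightarrow> g" and mem: "\<And>n::nat. gs n \<in> goldstein_grads \<delta> f (zs n)"
  shows "g \<in> goldstein_grads \<delta> f z"
proof -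
  have "\<exists>x. dist (zs n) x \<le> \<delta> \<and> gs n \<in> limiting_grad f x" for n
    using mem[of n] by (auto simp: goldstein_grads_def)
  then obtain w where w: "\<And>n. dist (zs n) (w n) \<le> \<delta>" "\<And>n. gs n \<in> limiting_grad f (w n)"
    by metis
  obtain B where B: "\<And>n. norm (zs n) \<le> B"
    using convergent_imp_bounded[OF z] by (auto simp: bounded_iff)
  have "norm (w n) \<le> B + \<delta>" for n
    using w(1)[of n] B[of n] norm_triangle_ineq[of "zs n" "w n - zs n"]
    by (simp add: dist_norm norm_minus_commute)
  then have "bounded (range w)" by (auto simp: bounded_iff)
  then obtain l r where r: "strict_mono r" "(w \<circ> r) \<longlonglongrightarrow> l"
    using bounded_imp_convergent_subsequence by blast
  have zr: "(zs \<circ> r) \<longlonglongrightarrow> z" and gr: "(gs \<circ> r) \<longlonglongrightarrow> g"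
    using LIMSEQ_subseq_LIMSEQ[OF z r(1)] LIMSEQ_subseq_LIMSEQ[OF g r(1)] .
  have "dist z l \<le> \<delta>"
    by (rule LIMSEQ_le_const2[OF tendsto_dist[OF zr r(2)]]) (use w(1) in auto)
  moreover have "g \<in> limiting_grad f l"
    unfolding limiting_grad_iff
    by (rule closed_sequentially[OF closed_closure _ tendsto_Pair[OF r(2) gr]])
      (use w(2) in \<open>auto simp: limiting_grad_iff\<close>)
  ultimately show ?thesis by (auto simp: goldstein_grads_def)
qed

context
  fixes f :: "'a::euclidean_space \<Rightarrow> real" and L \<delta> :: real
  assumes lip: "L-lipschitz_on UNIV f" and \<delta>: "0 < \<delta>"
begin

lemma norm_goldstein_grads_le:
  assumes "g \<in> goldstein_grads \<delta> f z"
  shows "norm g \<le> L"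
proof -
  obtain w where w: "\<And>j::nat. f differentiable (at (w j))" "(\<lambda>j. grad f (w j)) \<longlonglongrightarrow> g"
    using assms by (auto simp: goldstein_grads_def limiting_grad_def)
  show ?thesis
    by (rule LIMSEQ_le_const2[OF tendsto_norm[OF w(2)]])
      (use norm_gradient_le[OF lip GDERIV_grad[OF w(1)]] in blast)
qed

lemma compact_goldstein_grads: "compact (goldstein_grads \<delta> f z)"
  unfolding compact_eq_bounded_closed
proof
  show "bounded (goldstein_grads \<delta> f z)"
    using norm_goldstein_grads_le by (auto simp: bounded_iff)
  show "closed (goldstein_grads \<delta> f z)"
    unfolding closed_sequential_limits
  proof safe
    fix gs g assume gs: "\<forall>n::nat. gs n \<in> goldstein_grads \<delta> f z" "gs \<longlonglongrightarrow> g"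
    show "g \<in> goldstein_grads \<delta> f z"
      using gs(1) by (intro goldstein_grads_closed_graph[OF tendsto_const gs(2)]) blast
  qed
qed

lemma grad_in_goldstein_grads:
  "dist z w \<le> \<delta> \<Longrightarrow> GDERIV f w :> D \<Longrightarrow> D \<in> goldstein_grads \<delta> f z"
  unfolding goldstein_grads_def limiting_grad_def
  by (auto intro!: bexI[of _ w] exI[of _ "\<lambda>_. w"] simp: grad_eq gderiv_def differentiable_def)

text \<open>Otherwise the ball of radius \<delta> would contain no point of differentiability and
  would be a null set by Rademacher, which its positive radius excludes.\<close>

lemma goldstein_grads_nonempty: "goldstein_grads \<delta> f z \<noteq> {}"
proof
  assume empty: "goldstein_grads \<delta> f z = {}"
  have "AE x in lborel. x \<notin> ball z \<delta>"
    using Rademacher[OF lip]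
  proof eventually_elim
    case (elim x)
    then show ?case using grad_in_goldstein_grads[of z x, OF _ elim] empty by auto
  qed
  then have "ball z \<delta> \<in> null_sets lborel" by (subst AE_iff_null_sets) auto
  then have "negligible (ball z \<delta>)" by (simp add: negligible_iff_null_sets null_sets_completion_iff)
  then show False using open_not_negligible[of "ball z \<delta>"] \<delta> by auto
qed

text \<open>The vector \<open>m\<close> is the projection of the origin onto a nonempty compact
  convex set; the inequality is the obtuse-angle characterization of a projection.\<close>

lemma goldstein_min_norm_attained:
  obtains m where "m \<in> goldstein_subdifferential \<delta> f z" "goldstein_min_norm \<delta> f z = norm m"
    "\<And>g. g \<in> goldstein_subdifferential \<delta> f z \<Longrightarrow> (norm m)\<^sup>2 \<le> m \<bullet> g" "norm m \<le> L"
proof -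
  let ?C = "goldstein_subdifferential \<delta> f z"
  have C: "compact ?C" "convex ?C" "?C \<noteq> {}"
    unfolding goldstein_subdifferential_eq
    using compact_convex_hull[OF compact_goldstein_grads] goldstein_grads_nonempty by auto
  obtain m where m: "m \<in> ?C" "\<And>g. g \<in> ?C \<Longrightarrow> dist 0 m \<le> dist 0 g"
    using distance_attains_inf[OF compact_imp_closed[OF C(1)] C(3), of 0] by blast
  show thesis
  proof
    show "m \<in> ?C" by fact
    show "goldstein_min_norm \<delta> f z = norm m"
      unfolding goldstein_min_norm_def using m by (intro cInf_eq_minimum) auto
    show "(norm m)\<^sup>2 \<le> m \<bullet> g" if "g \<in> ?C" for g
      using any_closest_point_dot[OF C(2) compact_imp_closed[OF C(1)] m(1) that, of 0] m(2)
      by (simp add: power2_norm_eq_inner inner_diff_right)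
    have "?C \<subseteq> cball 0 L"
      unfolding goldstein_subdifferential_eq by (intro hull_minimal) (auto intro: norm_goldstein_grads_le)
    then show "norm m \<le> L" using m(1) by auto
  qed
qed

lemma goldstein_min_norm_bounds:
  "0 \<le> goldstein_min_norm \<delta> f z" "goldstein_min_norm \<delta> f z \<le> L"
  by (rule goldstein_min_norm_attained[of z]; simp)+

text \<open>Lower semicontinuity of the minimal norm, from which the measurability of the final
  random variable follows. A half-space normal to the shortest element \<open>m\<close> is the right
  test set: by Cauchy-Schwarz its points have norm above \<open>c\<close>, and being convex it
  absorbs the hull.\<close>

lemma open_goldstein_min_norm_greater: "open {z. c < goldstein_min_norm \<delta> f z}"
proof (cases "c < 0")
  case True
  then have "{z. c < goldstein_min_norm \<delta> f z} = UNIV"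
    using goldstein_min_norm_bounds(1) by (auto intro: less_le_trans)
  then show ?thesis by simp
next
  case False
  show ?thesis
    unfolding open_contains_ball
  proof safe
    fix z assume c: "c < goldstein_min_norm \<delta> f z"
    obtain m where m: "goldstein_min_norm \<delta> f z = norm m"
      "\<And>g. g \<in> goldstein_subdifferential \<delta> f z \<Longrightarrow> (norm m)\<^sup>2 \<le> m \<bullet> g"
      by (rule goldstein_min_norm_attained[of z]) blast
    have m0: "0 < norm m" using c False m(1) by linarith
    \<comment> \<open>By closedness of the graph, nearby Goldstein subdifferentials stay in this half-space.\<close>
    define H where "H = {y. c * norm m < m \<bullet> y}"
    have H: "convex H" "closed (- H)"
      unfolding H_def by (auto simp: convex_halfspace_gt closed_halfspace_le Compl_eq not_less)
    have zH: "goldstein_grads \<delta> f z \<subseteq> H"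
    proof
      fix g assume "g \<in> goldstein_grads \<delta> f z"
      then have "(norm m)\<^sup>2 \<le> m \<bullet> g"
        by (intro m(2)) (simp add: goldstein_subdifferential_eq hull_inc)
      moreover have "c * norm m < (norm m)\<^sup>2" using c m(1) m0 by (simp add: power2_eq_square)
      ultimately show "g \<in> H" by (simp add: H_def)
    qed
    have "\<exists>e>0. \<forall>z'\<in>ball z e. goldstein_grads \<delta> f z' \<subseteq> H"
    proof (rule ccontr)
      assume "\<not> ?thesis"
      then have "\<exists>z' g. dist z z' < 1 / Suc n \<and> g \<in> goldstein_grads \<delta> f z' \<and> g \<notin> H" for n
        by (auto simp: subset_iff dest!: spec[of _ "1 / real (Suc n)"])
      then obtain zs gs where s: "\<And>n. dist z (zs n) < 1 / Suc n"
        "\<And>n. gs n \<in> goldstein_grads \<delta> f (zs n)" "\<And>n. gs n \<notin> H" by metis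
      have "(\<lambda>n. dist (zs n) z) \<longlonglongrightarrow> 0"
      proof (rule tendsto_sandwich[OF _ _ tendsto_const LIMSEQ_Suc[OF lim_1_over_n]])
        show "\<forall>\<^sub>F n in sequentially. 0 \<le> dist (zs n) z" by simp
        have "dist (zs n) z \<le> 1 / real (Suc n)" for n
          using s(1)[of n] by (metis dist_commute less_imp_le)
        then show "\<forall>\<^sub>F n in sequentially. dist (zs n) z \<le> 1 / real (Suc n)"
          by (intro always_eventually allI)
      qed
      then have zs: "zs \<longlonglongrightarrow> z" by (rule iffD2[OF tendsto_dist_iff])
      have "bounded (range gs)"
        using norm_goldstein_grads_le s(2) by (auto simp: bounded_iff)
      then obtain g r where r: "strict_mono r" "(gs \<circ> r) \<longlonglongrightarrow> g"
        using bounded_imp_convergent_subsequence by blast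
      have "g \<in> goldstein_grads \<delta> f z"
        by (rule goldstein_grads_closed_graph[OF LIMSEQ_subseq_LIMSEQ[OF zs r(1)] r(2)]) (simp add: s(2))
      moreover have "g \<in> - H"
        by (rule closed_sequentially[OF H(2) _ r(2)]) (simp add: s(3))
      ultimately show False using zH by blast
    qed
    then obtain e where e: "e > 0" "\<And>z'. z' \<in> ball z e \<Longrightarrow> goldstein_grads \<delta> f z' \<subseteq> H" by blast
    have "c < goldstein_min_norm \<delta> f z'" if z': "z' \<in> ball z e" for z'
    proof -
      obtain m' where m': "m' \<in> goldstein_subdifferential \<delta> f z'" "goldstein_min_norm \<delta> f z' = norm m'"
        by (rule goldstein_min_norm_attained[of z']) blast
      have "convex hull (goldstein_grads \<delta> f z') \<subseteq> H"
        using e(2)[OF z'] H(1) by (rule hull_minimal)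
      then have "m' \<in> H"
        using m'(1) by (auto simp: goldstein_subdifferential_eq)
      then have "norm m * c < norm m * norm m'"
        using norm_cauchy_schwarz[of m m'] by (simp add: H_def mult.commute)
      then show ?thesis using m0 m'(2) by simp
    qed
    with e(1) show "\<exists>e>0. ball z e \<subseteq> {z. c < goldstein_min_norm \<delta> f z}" by blast
  qed
qed

lemma borel_measurable_goldstein_min_norm: "goldstein_min_norm \<delta> f \<in> borel_measurable borel"
  unfolding borel_measurable_iff_greater
  using open_goldstein_min_norm_greater by (auto intro: borel_open)

text \<open>Where |\<mu> u| exceeds \<delta>, the integrand m . grad f may fall short of |m|^2 by at
  most 2 L |m|, since |m| and the gradient are bounded by \<open>L\<close>. The indicator of that
  event is replaced by the larger p exp(|u|^2 / 4), whose mean is known; dividing by |m| ends the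
  argument.\<close>

lemma goldstein_min_norm_le:
  assumes \<mu>: "0 < \<mu>"
  shows "goldstein_min_norm \<delta> f z \<le> norm (grad (gaussian_smoothing \<mu> f) z) +
    2 * L * (exp (- (\<delta> / \<mu>)\<^sup>2 / 4) * sqrt 2 ^ DIM('a))"
proof -
  obtain m where m: "m \<in> goldstein_subdifferential \<delta> f z" "goldstein_min_norm \<delta> f z = norm m"
    "\<And>g. g \<in> goldstein_subdifferential \<delta> f z \<Longrightarrow> (norm m)\<^sup>2 \<le> m \<bullet> g" "norm m \<le> L"
    by (rule goldstein_min_norm_attained[of z]) blast
  define p where "p = exp (- (\<delta> / \<mu>)\<^sup>2 / 4)"
  let ?A = "\<lambda>u. ae_grad f (z + \<mu> *\<^sub>R u)"
  note GA = AE_gradient[OF lip \<mu>, of z] and intA = integrable_ae_grad[OF lip \<mu>, of z]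
  have "AE u in std_gaussian. (norm m)\<^sup>2 - 2 * L * norm m * (p * exp ((norm u)\<^sup>2 / 4)) \<le> m \<bullet> ?A u"
    using GA
  proof eventually_elim
    case (elim u)
    have L: "0 \<le> L" using lipschitz_on_nonneg[OF lip] .
    show ?case
    proof (cases "\<mu> * norm u \<le> \<delta>")
      case True
      then have "?A u \<in> goldstein_grads \<delta> f z"
        using elim \<mu> by (intro grad_in_goldstein_grads) (auto simp: dist_norm)
      then have "(norm m)\<^sup>2 \<le> m \<bullet> ?A u"
        by (intro m(3)) (simp add: goldstein_subdifferential_eq hull_inc)
      moreover have "0 \<le> 2 * L * norm m * (p * exp ((norm u)\<^sup>2 / 4))" using L by (simp add: p_def)
      ultimately show ?thesis by linarith
    next
      case False
      then have "\<delta> / \<mu> \<le> norm u" using \<mu> by (simp add: pos_divide_le_eq mult.commute)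
      then have "(\<delta> / \<mu>)\<^sup>2 \<le> (norm u)\<^sup>2" using \<delta> \<mu> by (intro power_mono) auto
      then have "1 \<le> p * exp ((norm u)\<^sup>2 / 4)" by (simp add: p_def exp_add[symmetric])
      then have 1: "2 * (L * norm m) \<le> 2 * L * norm m * (p * exp ((norm u)\<^sup>2 / 4))"
        using L mult_left_mono[of 1 "p * exp ((norm u)\<^sup>2 / 4)" "2 * L * norm m"] by simp
      have "norm m * norm (?A u) \<le> L * norm m"
        using norm_gradient_le[OF lip elim] by (subst mult.commute) (rule mult_right_mono, auto)
      then have 2: "- (L * norm m) \<le> m \<bullet> ?A u"
        using Cauchy_Schwarz_ineq2[of m "?A u"] by linarith
      have 3: "(norm m)\<^sup>2 \<le> L * norm m" using m(4) by (simp add: power2_eq_square mult_right_mono)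
      from 1 2 3 show ?thesis by linarith
    qed
  qed
  then have "(\<integral>u. (norm m)\<^sup>2 - 2 * L * norm m * (p * exp ((norm u)\<^sup>2 / 4)) \<partial>(std_gaussian :: 'a measure)) \<le>
      (\<integral>u. m \<bullet> ?A u \<partial>std_gaussian)"
    using intA has_bochner_integral_exp_std_gaussian[where 'a = 'a]
    by (intro integral_mono_AE) (auto simp: has_bochner_integral_iff)
  also have "(\<integral>u. (norm m)\<^sup>2 - 2 * L * norm m * (p * exp ((norm u)\<^sup>2 / 4)) \<partial>(std_gaussian :: 'a measure)) =
      (norm m)\<^sup>2 - 2 * L * norm m * (p * sqrt 2 ^ DIM('a))"
    using has_bochner_integral_exp_std_gaussian[where 'a = 'a]
    by (subst Bochner_Integration.integral_diff) (auto simp: has_bochner_integral_iff)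
  also have "(\<integral>u. m \<bullet> ?A u \<partial>std_gaussian) = m \<bullet> grad (gaussian_smoothing \<mu> f) z"
    using intA grad_eq[OF GDERIV_gaussian_smoothing[OF lip \<mu>, of z]] by simp
  also have "\<dots> \<le> norm m * norm (grad (gaussian_smoothing \<mu> f) z)" by (rule norm_cauchy_schwarz)
  finally have "norm m * norm m \<le> norm m * (norm (grad (gaussian_smoothing \<mu> f) z) + 2 * L * (p * sqrt 2 ^ DIM('a)))"
    by (simp add: power2_eq_square algebra_simps)
  then have "norm m \<le> norm (grad (gaussian_smoothing \<mu> f) z) + 2 * L * (p * sqrt 2 ^ DIM('a))"
    using lipschitz_on_nonneg[OF lip] by (cases "m = 0") (auto simp: p_def)
  then show ?thesis by (simp add: m(2) p_def)
qed

end

text \<open>Both sides are compared as \<open>d\<close>-th powers with x = s^(1/d). Since \<pi> e is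
  at least 6, the hypothesis gives (\<delta> / \<mu>)^2 at least 6 d / x^2, and the estimate in one
  dimension is sqrt 2 / x <= 2 / x <= 1 + 1 / x^2 <= exp(3 / (2 x^2)).\<close>

lemma gaussian_tail_small:
  fixes d :: nat
  assumes d: "0 < d" and pos: "0 < \<delta>" "0 < \<mu>" "0 < s"
    and \<mu>: "\<mu> \<le> \<delta> / sqrt (real d * pi * exp 1) * s powr (1 / real d)"
  shows "exp (- (\<delta> / \<mu>)\<^sup>2 / 4) * sqrt 2 ^ d \<le> s"
proof -
  define x where "x = s powr (1 / real d)"
  define Q where "Q = real d * pi * exp 1"
  have x: "0 < x" using pos(3) by (simp add: x_def)
  then have "x ^ d = x powr real d" by (simp add: powr_realpow)
  then have xd: "x ^ d = s" using pos(3) d by (simp add: x_def powr_powr)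
  have Q: "0 < Q" using d by (simp add: Q_def)
  have "\<mu> * sqrt Q \<le> (\<delta> / sqrt Q * x) * sqrt Q"
    using \<mu> Q by (intro mult_right_mono) (simp_all add: x_def Q_def)
  then have "sqrt Q * \<mu> \<le> \<delta> * x" using Q by (simp add: mult.commute)
  then have "sqrt Q / x \<le> \<delta> / \<mu>" using pos x by (simp add: pos_divide_le_eq pos_le_divide_eq)
  then have "(sqrt Q / x)\<^sup>2 \<le> (\<delta> / \<mu>)\<^sup>2" using x Q by (intro power_mono) auto
  then have R: "Q / x\<^sup>2 \<le> (\<delta> / \<mu>)\<^sup>2" using Q by (simp add: power_divide)
  have "3 * 2 \<le> pi * exp 1"
    using pi_gt3 exp_ge_add_one_self[of 1] by (intro mult_mono) auto
  then have "real d * (6 / x\<^sup>2) \<le> Q / x\<^sup>2"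
    using x d by (simp add: Q_def divide_right_mono)
  then have "exp (- (\<delta> / \<mu>)\<^sup>2 / 4) \<le> exp (real d * (- (6 / x\<^sup>2) / 4))"
    using R by (simp add: mult.commute)
  also have "\<dots> = exp (- (6 / x\<^sup>2) / 4) ^ d" by (rule exp_of_nat_mult)
  finally have "exp (- (\<delta> / \<mu>)\<^sup>2 / 4) * sqrt 2 ^ d \<le> (exp (- (6 / x\<^sup>2) / 4) * sqrt 2) ^ d"
    by (simp add: power_mult_distrib)
  also have "\<dots> \<le> x ^ d"
  proof (rule power_mono)
    define y where "y = 1 / x"
    have y: "0 < y" using x by (simp add: y_def)
    have "sqrt 2 \<le> 2" by (rule real_le_lsqrt) auto
    then have "sqrt 2 * y \<le> 2 * y" using y by simp
    also have "\<dots> \<le> 1 + y\<^sup>2" using zero_le_power2[of "y - 1"] by (simp add: power2_eq_square algebra_simps)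
    also have "\<dots> \<le> 1 + (3 / 2) * y\<^sup>2" by simp
    also have "(3 / 2) * y\<^sup>2 = (6 / x\<^sup>2) / 4" by (simp add: y_def power_divide)
    also have "1 + (6 / x\<^sup>2) / 4 \<le> exp ((6 / x\<^sup>2) / 4)" using exp_ge_add_one_self[of "(6 / x\<^sup>2) / 4"] by simp
    finally have "sqrt 2 / x \<le> exp ((6 / x\<^sup>2) / 4)" by (simp add: y_def)
    then have "sqrt 2 \<le> x * exp ((6 / x\<^sup>2) / 4)" using x by (simp add: pos_divide_le_eq mult.commute)
    then have "exp (- (6 / x\<^sup>2) / 4) * sqrt 2 \<le> exp (- (6 / x\<^sup>2) / 4) * (x * exp ((6 / x\<^sup>2) / 4))"
      by (rule mult_left_mono) simp
    also have "\<dots> = x" by (simp add: exp_minus)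
    finally show "exp (- (6 / x\<^sup>2) / 4) * sqrt 2 \<le> x" .
  qed auto
  finally show ?thesis by (simp add: xd)
qed


section \<open>The stochastic extragradient iteration\<close>

text \<open>\<open>F\<close> and \<open>Fh\<close> are the field at \<open>z\<close> and at the extrapolated point \<open>zh\<close>, and \<open>x\<close> is the oracle noise. Only
  the part \<open>A1\<close> of \<open>Fh - F\<close> depends on the noise, so the cross term \<open>A2 \<bullet> x\<close> has mean zero; completing the square
  keeps all terms nonnegative, which allows integration without integrability conditions.\<close>

lemma weak_minty_descent:
  fixes z zs zh F Fh x A1 A2 :: "'a::real_inner"
  assumes zh: "zh = z - h1 *\<^sub>R (F + x)" and Fh: "Fh = F + A1 + A2"
    and A1: "norm A1 \<le> norm x" and A12: "norm (A1 + A2) \<le> norm (F + x)"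
    and wm: "0 \<le> Fh \<bullet> (zh - zs) + \<rho> / 2 * (norm Fh)\<^sup>2"
    and h: "0 \<le> h1" "0 \<le> h2" and a: "a + h2 * \<rho> + h2\<^sup>2 \<le> h1 * h2"
  shows "(norm (z - zs - h2 *\<^sub>R Fh))\<^sup>2 + a * (norm Fh)\<^sup>2 + h1 * h2 / 3 * (norm A2)\<^sup>2
    \<le> (norm (z - zs))\<^sup>2 + 3 * (h1 * h2) * (norm (x - A2 /\<^sub>R 3))\<^sup>2"
proof -
  let ?g = "F + x"
  \<comment> \<open>Polarization, as \<open>Fh - ?g\<close> equals \<open>A1 + A2 - x\<close>. The
    term |g|^2 pays for |A1 + A2|^2, which is where the Lipschitz bound on the extrapolation step is
    used.\<close>
  have "2 * (Fh \<bullet> ?g) = (norm Fh)\<^sup>2 + (norm ?g)\<^sup>2 - (norm (A1 + A2 - x))\<^sup>2"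
    unfolding Fh by (simp add: power2_norm_eq_inner inner_add_left inner_add_right inner_diff_left inner_diff_right inner_commute)
  moreover have "(norm (A1 + A2 - x))\<^sup>2 = (norm (A1 + A2))\<^sup>2 - 2 * (A1 \<bullet> x) - 2 * (A2 \<bullet> x) + (norm x)\<^sup>2"
    by (simp add: power2_norm_eq_inner inner_add_left inner_add_right inner_diff_left inner_diff_right inner_commute)
  moreover have "(norm (A1 + A2))\<^sup>2 \<le> (norm ?g)\<^sup>2" using A12 by (intro power_mono) auto
  moreover have "- (A1 \<bullet> x) \<le> (norm x)\<^sup>2"
  proof -
    have "- (A1 \<bullet> x) \<le> norm A1 * norm x" using Cauchy_Schwarz_ineq2[of A1 x] by linarith
    also have "\<dots> \<le> norm x * norm x" using A1 by (intro mult_right_mono) auto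
    finally show ?thesis by (simp add: power2_eq_square)
  qed
  ultimately have fg: "(norm Fh)\<^sup>2 - 3 * (norm x)\<^sup>2 + 2 * (A2 \<bullet> x) \<le> 2 * (Fh \<bullet> ?g)" by linarith
  have "Fh \<bullet> (z - zs) = Fh \<bullet> (zh - zs) + h1 * (Fh \<bullet> ?g)"
    unfolding zh by (simp add: inner_diff_right)
  with wm have "- (\<rho> / 2 * (norm Fh)\<^sup>2) + h1 * (Fh \<bullet> ?g) \<le> Fh \<bullet> (z - zs)" by linarith
  then have "2 * h2 * (- (\<rho> / 2 * (norm Fh)\<^sup>2) + h1 * (Fh \<bullet> ?g)) \<le> 2 * h2 * (Fh \<bullet> (z - zs))"
    using h by (intro mult_left_mono) auto
  moreover have "h1 * h2 * ((norm Fh)\<^sup>2 - 3 * (norm x)\<^sup>2 + 2 * (A2 \<bullet> x)) \<le> h1 * h2 * (2 * (Fh \<bullet> ?g))"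
    using fg h by (intro mult_left_mono) auto
  moreover have "(a + h2 * \<rho> + h2\<^sup>2) * (norm Fh)\<^sup>2 \<le> h1 * h2 * (norm Fh)\<^sup>2"
    using a by (intro mult_right_mono) auto
  moreover have "(norm (z - zs - h2 *\<^sub>R Fh))\<^sup>2 = (norm (z - zs))\<^sup>2 - 2 * h2 * (Fh \<bullet> (z - zs)) + h2\<^sup>2 * (norm Fh)\<^sup>2"
    unfolding power2_norm_eq_inner
    by (simp add: inner_diff_left inner_diff_right inner_commute power2_eq_square algebra_simps)
  \<comment> \<open>The shift by a third of \<open>A2\<close> absorbs the cross term; the surplus
    |A2|^2 / 3 is matched by the extra term on the left of the claim.\<close>
  moreover have "3 * (h1 * h2) * (norm (x - A2 /\<^sub>R 3))\<^sup>2 =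
      h1 * h2 * (3 * (norm x)\<^sup>2 - 2 * (A2 \<bullet> x)) + h1 * h2 / 3 * (norm A2)\<^sup>2"
    by (simp add: power2_norm_eq_inner inner_diff_left inner_diff_right inner_commute algebra_simps)
  ultimately show ?thesis by (simp add: algebra_simps)
qed

section \<open>Second moments under independence\<close>

lemma (in prob_space) nn_integral_norm_add_square:
  fixes \<xi> :: "'a \<Rightarrow> 'z::euclidean_space"
  assumes "integrable M \<xi>" "integral\<^sup>L M \<xi> = 0" "integrable M (\<lambda>u. (norm (\<xi> u))\<^sup>2)"
  shows "(\<integral>\<^sup>+u. ennreal ((norm (a + \<xi> u))\<^sup>2) \<partial>M) = ennreal ((norm a)\<^sup>2 + (\<integral>u. (norm (\<xi> u))\<^sup>2 \<partial>M))"
proof -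
  have eq: "(norm (a + \<xi> u))\<^sup>2 = (norm a)\<^sup>2 + 2 * (a \<bullet> \<xi> u) + (norm (\<xi> u))\<^sup>2" for u
    by (simp add: power2_norm_eq_inner inner_add_left inner_add_right inner_commute)
  have int: "integrable M (\<lambda>u. (norm a)\<^sup>2 + 2 * (a \<bullet> \<xi> u) + (norm (\<xi> u))\<^sup>2)"
    using assms by auto
  have "(\<integral>\<^sup>+u. ennreal ((norm (a + \<xi> u))\<^sup>2) \<partial>M) = ennreal (\<integral>u. (norm (a + \<xi> u))\<^sup>2 \<partial>M)"
    using int by (intro nn_integral_eq_integral) (auto simp: eq[symmetric])
  also have "(\<integral>u. (norm (a + \<xi> u))\<^sup>2 \<partial>M) = (norm a)\<^sup>2 + (\<integral>u. (norm (\<xi> u))\<^sup>2 \<partial>M)"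
    unfolding eq using assms by (simp add: prob_space)
  finally show ?thesis .
qed

text \<open>Coordinates are integrated out one at a time. With the others frozen, their partial sum
  joins the free vector \<open>a\<close>, and centredness of the last one kills the cross term, so
  each coordinate adds its own variance.\<close>

lemma (in prob_space) nn_integral_PiM_sum_square:
  fixes \<xi> :: "'a \<Rightarrow> 'z::euclidean_space"
  assumes \<xi>: "integrable M \<xi>" "integral\<^sup>L M \<xi> = 0" "integrable M (\<lambda>u. (norm (\<xi> u))\<^sup>2)"
    and I: "finite I"
  shows "(\<integral>\<^sup>+v. ennreal ((norm (a + (\<Sum>i\<in>I. \<xi> (v i))))\<^sup>2) \<partial>PiM I (\<lambda>_. M)) =
    ennreal ((norm a)\<^sup>2 + real (card I) * (\<integral>u. (norm (\<xi> u))\<^sup>2 \<partial>M))"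
  using I
proof induction
  case empty
  show ?case by (simp add: PiM_empty nn_integral_count_space_finite)
next
  case (insert i I)
  interpret product_sigma_finite "\<lambda>_. M" by standard
  interpret P: prob_space "PiM I (\<lambda>_. M)" by (intro prob_space_PiM) (rule prob_space_axioms)
  note [measurable] = borel_measurable_integrable[OF \<xi>(1)]
  let ?V = "\<integral>u. (norm (\<xi> u))\<^sup>2 \<partial>M"
  have V: "0 \<le> ?V" by simp
  have "(\<integral>\<^sup>+v. ennreal ((norm (a + (\<Sum>j\<in>insert i I. \<xi> (v j))))\<^sup>2) \<partial>PiM (insert i I) (\<lambda>_. M)) =
      (\<integral>\<^sup>+x. (\<integral>\<^sup>+y. ennreal ((norm (a + (\<Sum>j\<in>insert i I. \<xi> ((x(i := y)) j))))\<^sup>2) \<partial>M) \<partial>PiM I (\<lambda>_. M))"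
    using insert by (intro product_nn_integral_insert) auto
  also have "\<dots> = (\<integral>\<^sup>+x. ennreal ((norm (a + (\<Sum>j\<in>I. \<xi> (x j))))\<^sup>2) + ennreal ?V \<partial>PiM I (\<lambda>_. M))"
  proof (intro nn_integral_cong)
    fix x
    have "(\<Sum>j\<in>insert i I. \<xi> ((x(i := y)) j)) = (\<Sum>j\<in>I. \<xi> (x j)) + \<xi> y" for y
      using insert by (simp add: add.commute) (intro sum.cong, auto)
    then have "(\<integral>\<^sup>+y. ennreal ((norm (a + (\<Sum>j\<in>insert i I. \<xi> ((x(i := y)) j))))\<^sup>2) \<partial>M) =
        (\<integral>\<^sup>+y. ennreal ((norm (a + (\<Sum>j\<in>I. \<xi> (x j)) + \<xi> y))\<^sup>2) \<partial>M)"
      by (simp add: add.assoc)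
    then show "(\<integral>\<^sup>+y. ennreal ((norm (a + (\<Sum>j\<in>insert i I. \<xi> ((x(i := y)) j))))\<^sup>2) \<partial>M) =
        ennreal ((norm (a + (\<Sum>j\<in>I. \<xi> (x j))))\<^sup>2) + ennreal ?V"
      using V by (simp add: nn_integral_norm_add_square[OF \<xi>])
  qed
  also have "\<dots> = ennreal ((norm a)\<^sup>2 + real (card I) * ?V) + ennreal ?V"
    using insert.IH by (subst nn_integral_add) (auto simp: P.emeasure_space_1)
  also have "\<dots> = ennreal ((norm a)\<^sup>2 + real (card (insert i I)) * ?V)"
    using insert V by (simp add: ennreal_plus[symmetric] algebra_simps del: ennreal_plus)
  finally show ?case .
qed

lemma (in prob_space) nn_integral_indep_var:
  assumes ind: "indep_var S X T Y" and h[measurable]: "h \<in> borel_measurable (S \<Otimes>\<^sub>M T)"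
  shows "(\<integral>\<^sup>+\<omega>. h (X \<omega>, Y \<omega>) \<partial>M) = (\<integral>\<^sup>+\<omega>. (\<integral>\<^sup>+y. h (X \<omega>, y) \<partial>distr M T Y) \<partial>M)"
proof -
  have [measurable]: "X \<in> M \<rightarrow>\<^sub>M S" "Y \<in> M \<rightarrow>\<^sub>M T"
    using indep_var_rv1[OF ind] indep_var_rv2[OF ind] by auto
  interpret Y: prob_space "distr M T Y" by (rule prob_space_distr) measurable
  have [measurable_cong]: "sets (distr M T Y) = sets T" by simp
  have "(\<integral>\<^sup>+\<omega>. h (X \<omega>, Y \<omega>) \<partial>M) = (\<integral>\<^sup>+p. h p \<partial>distr M (S \<Otimes>\<^sub>M T) (\<lambda>\<omega>. (X \<omega>, Y \<omega>)))"
    by (subst nn_integral_distr) auto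
  also have "\<dots> = (\<integral>\<^sup>+p. h p \<partial>(distr M S X \<Otimes>\<^sub>M distr M T Y))"
    using ind by (simp add: indep_var_distribution_eq)
  also have "\<dots> = (\<integral>\<^sup>+x. (\<integral>\<^sup>+y. h (x, y) \<partial>distr M T Y) \<partial>distr M S X)"
    by (subst Y.nn_integral_fst[symmetric]) (auto cong: measurable_cong_sets)
  also have "\<dots> = (\<integral>\<^sup>+\<omega>. (\<integral>\<^sup>+y. h (X \<omega>, y) \<partial>distr M T Y) \<partial>M)"
    by (subst nn_integral_distr) auto
  finally show ?thesis .
qed

lemma batch_oracle_cong:
  "(\<And>i. i \<in> {1..t} \<Longrightarrow> v i = v' i) \<Longrightarrow> batch_oracle \<mu> f t v z = batch_oracle \<mu> f t v' z"
  unfolding batch_oracle_def by (intro arg_cong[where f = "scaleR (1 / real t)"] sum.cong) auto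

text \<open>Adaptedness of the iteration. It permits feeding in families restricted to the past,
  whose remaining values are unspecified.\<close>

lemma zoeg_z_cong:
  assumes "\<And>j i. j < k \<Longrightarrow> i \<in> {1..t} \<Longrightarrow> uh j i = uh' j i"
    and "\<And>j i. j < k \<Longrightarrow> i \<in> {1..t} \<Longrightarrow> u j i = u' j i"
  shows "zoeg_z f \<mu> h1 h2 (\<lambda>_. t) z0 uh u k = zoeg_z f \<mu> h1 h2 (\<lambda>_. t) z0 uh' u' k"
  using assms
proof (induction k)
  case (Suc k)
  have IH: "zoeg_z f \<mu> h1 h2 (\<lambda>_. t) z0 uh u k = zoeg_z f \<mu> h1 h2 (\<lambda>_. t) z0 uh' u' k"
    using Suc.prems by (intro Suc.IH) auto
  have 1: "batch_oracle \<mu> f t (uh k) z = batch_oracle \<mu> f t (uh' k) z" for z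
    using Suc.prems by (intro batch_oracle_cong) auto
  have 2: "batch_oracle \<mu> f t (u k) z = batch_oracle \<mu> f t (u' k) z" for z
    using Suc.prems by (intro batch_oracle_cong) auto
  show ?case by (simp add: zoeg_extrapolate_def IH 1 2)
qed simp

text \<open>A linear isometry carrying the gradient of the smoothing to the saddle field and the
  plain oracle to the signed one, so means and norms pass through unchanged.\<close>

definition flip_snd :: "'a \<times> 'b::uminus \<Rightarrow> 'a \<times> 'b" where
  "flip_snd p = (fst p, - snd p)"

lemma norm_flip_snd[simp]:
  "norm (flip_snd p) = norm p" for p :: "'a::real_normed_vector \<times> 'b::real_normed_vector"
  by (simp add: flip_snd_def norm_prod_def)

lemma bounded_linear_flip_snd:
  "bounded_linear (flip_snd :: 'a::real_normed_vector \<times> 'b::real_normed_vector \<Rightarrow> _)"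
  unfolding flip_snd_def[abs_def]
  by (intro bounded_linear_Pair bounded_linear_fst bounded_linear_compose[OF bounded_linear_minus[OF bounded_linear_ident] bounded_linear_snd])

lemma saddle_grad_eq_flip:
  assumes "GDERIV (gaussian_smoothing \<mu> f) z :> G"
  shows "saddle_grad \<mu> f z = flip_snd G"
proof -
  have "GDERIV (\<lambda>x. gaussian_smoothing \<mu> f (x, snd z)) (fst z) :> fst G"
  proof -
    have "((\<lambda>x. (x, snd z)) has_derivative (\<lambda>h. (h, 0))) (at (fst z))"
      by (intro has_derivative_Pair has_derivative_ident has_derivative_const)
    moreover have "(gaussian_smoothing \<mu> f has_derivative (\<lambda>h. h \<bullet> G)) (at (fst z, snd z))"
      using assms by (simp add: gderiv_def)
    ultimately have "((\<lambda>x. gaussian_smoothing \<mu> f (x, snd z)) has_derivative (\<lambda>h. (h, 0) \<bullet> G)) (at (fst z))"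
      by (rule has_derivative_compose)
    then show ?thesis by (simp add: gderiv_def inner_prod_def)
  qed
  moreover have "GDERIV (\<lambda>y. gaussian_smoothing \<mu> f (fst z, y)) (snd z) :> snd G"
  proof -
    have "((\<lambda>y. (fst z, y)) has_derivative (\<lambda>h. (0, h))) (at (snd z))"
      by (intro has_derivative_Pair has_derivative_ident has_derivative_const)
    moreover have "(gaussian_smoothing \<mu> f has_derivative (\<lambda>h. h \<bullet> G)) (at (fst z, snd z))"
      using assms by (simp add: gderiv_def)
    ultimately have "((\<lambda>y. gaussian_smoothing \<mu> f (fst z, y)) has_derivative (\<lambda>h. (0, h) \<bullet> G)) (at (snd z))"
      by (rule has_derivative_compose)
    then show ?thesis by (simp add: gderiv_def inner_prod_def)
  qed
  ultimately show ?thesis by (simp add: saddle_grad_def flip_snd_def grad_eq)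
qed

locale smoothed_saddle =
  fixes f :: "'a::euclidean_space \<times> 'b::euclidean_space \<Rightarrow> real" and L0 L1 \<mu> \<sigma> :: real
  assumes lip: "L0-lipschitz_on UNIV f" and \<mu>: "0 < \<mu>"
    and L1: "0 < L1" "L1-lipschitz_on UNIV (grad (gaussian_smoothing \<mu> f))"
    and var: "\<And>z. (\<integral>u. (norm (zo_oracle \<mu> f z u - saddle_grad \<mu> f z))\<^sup>2 \<partial>std_gaussian) \<le> \<sigma>\<^sup>2"
begin

abbreviation "F \<equiv> saddle_grad \<mu> f"

lemma F_eq: "F z = flip_snd (grad (gaussian_smoothing \<mu> f) z)"
  using saddle_grad_eq_flip[OF GDERIV_gaussian_smoothing[OF lip \<mu>, of z]]
    grad_eq[OF GDERIV_gaussian_smoothing[OF lip \<mu>, of z]] by simp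

lemma norm_F: "norm (F z) = norm (grad (gaussian_smoothing \<mu> f) z)"
  by (simp add: F_eq)

lemma norm_F_diff_le: "norm (F x - F y) \<le> L1 * norm (x - y)"
proof -
  have "F x - F y = flip_snd (grad (gaussian_smoothing \<mu> f) x - grad (gaussian_smoothing \<mu> f) y)"
    unfolding F_eq by (simp add: flip_snd_def)
  then show ?thesis using lipschitz_onD[OF L1(2), of x y] by (simp add: dist_norm)
qed

lemma borel_measurable_F[measurable]: "F \<in> borel_measurable borel"
  using L1(1) norm_F_diff_le
  by (intro borel_measurable_continuous_onI lipschitz_on_continuous_on[of L1] lipschitz_onI) (auto simp: dist_norm)

lemma continuous_zo_oracle: "continuous_on UNIV (\<lambda>p. zo_oracle \<mu> f (fst p) (snd p))"
proof -
  have contf: "continuous_on UNIV f" using lip by (rule lipschitz_on_continuous_on)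
  show ?thesis
    unfolding zo_oracle_def
    by (intro continuous_intros continuous_on_compose2[OF contf]) (use \<mu> in auto)
qed

lemma borel_measurable_zo_oracle[measurable (raw)]:
  assumes "z \<in> borel_measurable P" "u \<in> borel_measurable P"
  shows "(\<lambda>w. zo_oracle \<mu> f (z w) (u w)) \<in> borel_measurable P"
  using borel_measurable_continuous_on[OF continuous_zo_oracle borel_measurable_Pair[OF assms]] by simp

lemma borel_measurable_batch_oracle:
  assumes "\<And>i. i \<in> {1..t} \<Longrightarrow> (\<lambda>w. v w i) \<in> borel_measurable P" "z \<in> borel_measurable P"
  shows "(\<lambda>w. batch_oracle \<mu> f t (v w) (z w)) \<in> borel_measurable P"
  unfolding batch_oracle_def
  by (intro borel_measurable_scaleR borel_measurable_const borel_measurable_sum borel_measurable_zo_oracle assms)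

lemma borel_measurable_zoeg_z:
  assumes "\<And>j i. j < k \<Longrightarrow> i \<in> {1..t} \<Longrightarrow> (\<lambda>w. uh w j i) \<in> borel_measurable P"
    and "\<And>j i. j < k \<Longrightarrow> i \<in> {1..t} \<Longrightarrow> (\<lambda>w. u w j i) \<in> borel_measurable P"
  shows "(\<lambda>w. zoeg_z f \<mu> h1 h2 (\<lambda>_. t) z0 (uh w) (u w) k) \<in> borel_measurable P"
  using assms
proof (induction k)
  case (Suc k)
  have IH: "(\<lambda>w. zoeg_z f \<mu> h1 h2 (\<lambda>_. t) z0 (uh w) (u w) k) \<in> borel_measurable P"
    using Suc.prems by (intro Suc.IH) auto
  show ?case
    unfolding zoeg_z.simps zoeg_extrapolate_def using Suc.prems
    by (intro borel_measurable_diff borel_measurable_scaleR borel_measurable_const borel_measurable_batch_oracle IH) auto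
qed simp

text \<open>Unbiasedness is Gaussian integration by parts. Square integrability is proved from |G|
  <= L0 |u|^2, because \<open>var\<close> bounds only a Bochner integral, whose value would be 0 by
  default if the integrand were not integrable.\<close>

lemma zo_oracle_moments:
  shows "integrable std_gaussian (\<lambda>u. zo_oracle \<mu> f z u - F z)"
    and "(\<integral>u. zo_oracle \<mu> f z u - F z \<partial>std_gaussian) = 0"
    and "integrable std_gaussian (\<lambda>u. (norm (zo_oracle \<mu> f z u - F z))\<^sup>2)"
proof -
  have eq: "zo_oracle \<mu> f z u = flip_snd (((f (z + \<mu> *\<^sub>R u) - f z) / \<mu>) *\<^sub>R u)" for u
    by (simp add: zo_oracle_def flip_snd_def)
  have int: "integrable std_gaussian (zo_oracle \<mu> f z)"
    unfolding eq by (intro integrable_bounded_linear[OF bounded_linear_flip_snd] stein(1)[OF lip \<mu>])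
  have "integral\<^sup>L std_gaussian (zo_oracle \<mu> f z) = F z"
    unfolding eq F_eq stein(2)[OF lip \<mu>, symmetric]
    by (intro integral_bounded_linear[OF bounded_linear_flip_snd] stein(1)[OF lip \<mu>])
  with int show "integrable std_gaussian (\<lambda>u. zo_oracle \<mu> f z u - F z)"
    "(\<integral>u. zo_oracle \<mu> f z u - F z \<partial>std_gaussian) = 0" by auto
  have L0: "0 \<le> L0" using lipschitz_on_nonneg[OF lip] .
  show "integrable std_gaussian (\<lambda>u. (norm (zo_oracle \<mu> f z u - F z))\<^sup>2)"
  proof (rule integrable_std_gaussian)
    show "(\<lambda>u. (norm (zo_oracle \<mu> f z u - F z))\<^sup>2) \<in> borel_measurable borel" by measurable
    fix u :: "'a \<times> 'b"
    have "\<bar>(f (z + \<mu> *\<^sub>R u) - f z) / \<mu>\<bar> \<le> L0 * norm u"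
      using lipschitz_on_absD[OF lip, of "z + \<mu> *\<^sub>R u" z] \<mu>
      by (simp add: abs_divide pos_divide_le_eq ac_simps)
    then have "norm (zo_oracle \<mu> f z u) \<le> L0 * norm u * norm u"
      unfolding eq norm_flip_snd norm_scaleR by (rule mult_right_mono) simp
    then have "(norm (zo_oracle \<mu> f z u))\<^sup>2 \<le> (L0 * norm u * norm u)\<^sup>2"
      by (rule power_mono) simp
    also have "\<dots> = L0\<^sup>2 * norm u ^ 4" by (simp add: power2_eq_square power4_eq_xxxx ac_simps)
    also have "\<dots> \<le> L0\<^sup>2 * (32 * exp ((norm u)\<^sup>2 / 4))"
      using norm_pow4_le_exp by (intro mult_left_mono) auto
    finally have 1: "(norm (zo_oracle \<mu> f z u))\<^sup>2 \<le> L0\<^sup>2 * 32 * exp ((norm u)\<^sup>2 / 4)" by simp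
    have 2: "(norm (F z))\<^sup>2 \<le> (norm (F z))\<^sup>2 * exp ((norm u)\<^sup>2 / 4)"
      using mult_left_mono[of 1 "exp ((norm u)\<^sup>2 / 4)" "(norm (F z))\<^sup>2"] by simp
    have "(norm (zo_oracle \<mu> f z u - F z))\<^sup>2 \<le> (norm (zo_oracle \<mu> f z u) + norm (F z))\<^sup>2"
      by (intro power_mono norm_triangle_ineq4) auto
    also have "\<dots> \<le> 2 * (norm (zo_oracle \<mu> f z u))\<^sup>2 + 2 * (norm (F z))\<^sup>2"
      using zero_le_power2[of "norm (zo_oracle \<mu> f z u) - norm (F z)"]
      by (simp add: power2_eq_square algebra_simps)
    also have "\<dots> \<le> (2 * (L0\<^sup>2 * 32) + 2 * (norm (F z))\<^sup>2) * exp ((norm u)\<^sup>2 / 4)"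
      using 1 2 by (simp add: algebra_simps)
    finally show "norm ((norm (zo_oracle \<mu> f z u - F z))\<^sup>2) \<le>
        (2 * (L0\<^sup>2 * 32) + 2 * (norm (F z))\<^sup>2) * exp ((norm u)\<^sup>2 / 4)" by simp
  qed
qed

abbreviation batch_measure :: "nat \<Rightarrow> (nat \<Rightarrow> 'a \<times> 'b) measure" where
  "batch_measure t \<equiv> PiM {1..t} (\<lambda>_. std_gaussian)"

text \<open>Each of the \<open>t\<close> independent centred errors carries the factor
  \<open>c / t\<close>, so together they contribute c^2 \<sigma>^2 / t. The bound is applied with
  \<open>c = - h2\<close> to the update and with \<open>c = 1\<close> to the extrapolation
  noise.\<close>

lemma batch_second_moment:
  assumes t: "1 \<le> t"
  shows "(\<integral>\<^sup>+v. ennreal ((norm (a + c *\<^sub>R (batch_oracle \<mu> f t v z - F z)))\<^sup>2) \<partial>batch_measure t)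
    \<le> ennreal ((norm a)\<^sup>2 + c\<^sup>2 * (\<sigma>\<^sup>2 / real t))"
proof -
  let ?\<xi> = "\<lambda>u. (c / real t) *\<^sub>R (zo_oracle \<mu> f z u - F z)"
  note m = zo_oracle_moments[of z]
  have sq: "(norm (?\<xi> u))\<^sup>2 = (c / real t)\<^sup>2 * (norm (zo_oracle \<mu> f z u - F z))\<^sup>2" for u
    by (simp only: norm_scaleR power_mult_distrib power2_abs)
  have "c *\<^sub>R (batch_oracle \<mu> f t v z - F z) = (\<Sum>i\<in>{1..t}. ?\<xi> (v i))" for v
    using t by (simp add: batch_oracle_def scaleR_sum_right[symmetric] sum_subtractf scaleR_diff_right sum_constant_scaleR)
  then have "(\<integral>\<^sup>+v. ennreal ((norm (a + c *\<^sub>R (batch_oracle \<mu> f t v z - F z)))\<^sup>2) \<partial>batch_measure t) =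
      (\<integral>\<^sup>+v. ennreal ((norm (a + (\<Sum>i\<in>{1..t}. ?\<xi> (v i))))\<^sup>2) \<partial>batch_measure t)" by simp
  also have "\<dots> = ennreal ((norm a)\<^sup>2 + real (card {1..t}) * (\<integral>u. (norm (?\<xi> u))\<^sup>2 \<partial>std_gaussian))"
    by (rule std_gaussian.nn_integral_PiM_sum_square) (use m in \<open>auto simp only: sq integrable_mult_right
        integrable_scaleR_right integral_scaleR_right scaleR_zero_right finite_atLeastAtMost\<close>)
  also have "(\<integral>u. (norm (?\<xi> u))\<^sup>2 \<partial>std_gaussian) =
      (c / real t)\<^sup>2 * (\<integral>u. (norm (zo_oracle \<mu> f z u - F z))\<^sup>2 \<partial>std_gaussian)"
    unfolding sq by (rule integral_mult_right_zero)
  also have "ennreal ((norm a)\<^sup>2 + real (card {1..t}) *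
      ((c / real t)\<^sup>2 * (\<integral>u. (norm (zo_oracle \<mu> f z u - F z))\<^sup>2 \<partial>std_gaussian))) \<le>
      ennreal ((norm a)\<^sup>2 + c\<^sup>2 * (\<sigma>\<^sup>2 / real t))"
  proof (intro ennreal_leI add_left_mono)
    have "real (card {1..t}) * ((c / real t)\<^sup>2 * (\<integral>u. (norm (zo_oracle \<mu> f z u - F z))\<^sup>2 \<partial>std_gaussian)) =
        c\<^sup>2 * ((\<integral>u. (norm (zo_oracle \<mu> f z u - F z))\<^sup>2 \<partial>std_gaussian) / real t)"
      using t by (simp add: power_divide power2_eq_square)
    also have "\<dots> \<le> c\<^sup>2 * (\<sigma>\<^sup>2 / real t)"
      using var[of z] by (intro mult_left_mono divide_right_mono) auto
    finally show "real (card {1..t}) * ((c / real t)\<^sup>2 * (\<integral>u. (norm (zo_oracle \<mu> f z u - F z))\<^sup>2 \<partial>std_gaussian))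
        \<le> c\<^sup>2 * (\<sigma>\<^sup>2 / real t)" .
  qed
  finally show ?thesis .
qed

lemma borel_measurable_component_batch:
  "i \<in> {1..t} \<Longrightarrow> (\<lambda>v. v i) \<in> borel_measurable (batch_measure t)"
  using measurable_component_singleton[of i "{1..t}" "\<lambda>_. std_gaussian"]
  by (simp cong: measurable_cong_sets)

text \<open>The update batch is integrated first, with the extrapolated point frozen; being unbiased
  it costs only h2^2 \<sigma>^2 / t. The descent inequality is then averaged over the extrapolation
  batch.\<close>

lemma extragradient_step:
  assumes t: "1 \<le> t"
    and wm: "\<And>z. 0 \<le> F z \<bullet> (z - zs) + \<rho> / 2 * (norm (F z))\<^sup>2"
    and h: "0 \<le> h1" "0 \<le> h2" "L1 * h1 \<le> 1" and a: "0 \<le> a" "a + h2 * \<rho> + h2\<^sup>2 \<le> h1 * h2"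
  shows "(\<integral>\<^sup>+vh. (\<integral>\<^sup>+v.
        ennreal ((norm (z - h2 *\<^sub>R batch_oracle \<mu> f t v (z - h1 *\<^sub>R batch_oracle \<mu> f t vh z) - zs))\<^sup>2) +
        ennreal (a * (norm (F (z - h1 *\<^sub>R batch_oracle \<mu> f t vh z)))\<^sup>2) \<partial>batch_measure t) \<partial>batch_measure t)
    \<le> ennreal ((norm (z - zs))\<^sup>2 + (h2\<^sup>2 + 3 * (h1 * h2)) * (\<sigma>\<^sup>2 / real t))"
proof -
  define P :: "(nat \<Rightarrow> 'a \<times> 'b) measure" where "P = batch_measure t"
  interpret B: prob_space P
    unfolding P_def by (intro prob_space_PiM prob_space_std_gaussian)
  note moment = batch_second_moment[OF t, folded P_def]
  define zh where "zh = (\<lambda>vh. z - h1 *\<^sub>R batch_oracle \<mu> f t vh z)"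
  have [measurable]: "(\<lambda>v. batch_oracle \<mu> f t v y) \<in> borel_measurable (P)" for y
    unfolding P_def by (intro borel_measurable_batch_oracle borel_measurable_component_batch) auto
  have [measurable]: "zh \<in> borel_measurable (P)" unfolding zh_def by measurable
  define X where "X = (\<lambda>vh. (norm (z - zs - h2 *\<^sub>R F (zh vh)))\<^sup>2 + a * (norm (F (zh vh)))\<^sup>2)"
  have [measurable]: "X \<in> borel_measurable (P)" unfolding X_def by measurable
  have X0: "0 \<le> X vh" for vh using a by (simp add: X_def)
  \<comment> \<open>The change of the field up to the noiseless extrapolated point. It does not
    depend on the batch, so its inner product with the noise has mean zero.\<close>
  define A2 where "A2 = F (z - h1 *\<^sub>R F z) - F z"
  define c1 where "c1 = h1 * h2"
  have c1: "0 \<le> c1" using h by (simp add: c1_def)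
  define s where "s = \<sigma>\<^sup>2 / real t"
  have s: "0 \<le> s" by (simp add: s_def)
  have inner: "(\<integral>\<^sup>+v. ennreal ((norm (z - h2 *\<^sub>R batch_oracle \<mu> f t v (zh vh) - zs))\<^sup>2) +
        ennreal (a * (norm (F (zh vh)))\<^sup>2) \<partial>P) \<le> ennreal (X vh) + ennreal (h2\<^sup>2 * s)" for vh
  proof -
    have eq: "z - h2 *\<^sub>R g - zs = (z - zs - h2 *\<^sub>R F (zh vh)) + (- h2) *\<^sub>R (g - F (zh vh))" for g
      by (simp add: algebra_simps)
    have "(\<integral>\<^sup>+v. ennreal ((norm (z - h2 *\<^sub>R batch_oracle \<mu> f t v (zh vh) - zs))\<^sup>2) +
        ennreal (a * (norm (F (zh vh)))\<^sup>2) \<partial>P) =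
        (\<integral>\<^sup>+v. ennreal ((norm (z - h2 *\<^sub>R batch_oracle \<mu> f t v (zh vh) - zs))\<^sup>2) \<partial>P) +
        ennreal (a * (norm (F (zh vh)))\<^sup>2)"
      by (subst nn_integral_add) (auto simp: B.emeasure_space_1)
    also have "\<dots> \<le> ennreal ((norm (z - zs - h2 *\<^sub>R F (zh vh)))\<^sup>2 + (- h2)\<^sup>2 * s) +
        ennreal (a * (norm (F (zh vh)))\<^sup>2)"
      unfolding eq s_def by (intro add_right_mono moment)
    also have "\<dots> = ennreal (X vh) + ennreal (h2\<^sup>2 * s)"
      using a s by (simp add: X_def ennreal_plus[symmetric] ac_simps del: ennreal_plus)
    finally show ?thesis .
  qed
  have "(\<integral>\<^sup>+vh. ennreal (X vh) \<partial>P) + ennreal (c1 / 3 * (norm A2)\<^sup>2) =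
      (\<integral>\<^sup>+vh. ennreal (X vh) + ennreal (c1 / 3 * (norm A2)\<^sup>2) \<partial>P)"
    by (subst nn_integral_add) (auto simp: B.emeasure_space_1)
  also have "\<dots> \<le> (\<integral>\<^sup>+vh. ennreal ((norm (z - zs))\<^sup>2) + ennreal (3 * c1) *
      ennreal ((norm (- (A2 /\<^sub>R 3) + 1 *\<^sub>R (batch_oracle \<mu> f t vh z - F z)))\<^sup>2) \<partial>P)"
  proof (intro nn_integral_mono)
    fix vh
    define x where "x = batch_oracle \<mu> f t vh z - F z"
    have zh: "zh vh = z - h1 *\<^sub>R (F z + x)" by (simp add: zh_def x_def)
    have "X vh + c1 / 3 * (norm A2)\<^sup>2 \<le> (norm (z - zs))\<^sup>2 + 3 * c1 * (norm (x - A2 /\<^sub>R 3))\<^sup>2"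
      unfolding X_def c1_def
    proof (rule weak_minty_descent[OF zh _ _ _ wm h(1,2) a(2)])
      show "F (zh vh) = F z + (F (zh vh) - F (z - h1 *\<^sub>R F z)) + A2" by (simp add: A2_def)
      have "norm (F (zh vh) - F (z - h1 *\<^sub>R F z)) \<le> L1 * norm (zh vh - (z - h1 *\<^sub>R F z))"
        by (rule norm_F_diff_le)
      also have "zh vh - (z - h1 *\<^sub>R F z) = - (h1 *\<^sub>R x)" unfolding zh by (simp add: algebra_simps)
      also have "L1 * norm (- (h1 *\<^sub>R x)) = (L1 * h1) * norm x" using h by simp
      also have "\<dots> \<le> 1 * norm x" using h by (intro mult_right_mono) auto
      finally show "norm (F (zh vh) - F (z - h1 *\<^sub>R F z)) \<le> norm x" by simp
      have "norm (F (zh vh) - F z) \<le> L1 * norm (zh vh - z)" by (rule norm_F_diff_le)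
      also have "zh vh - z = - (h1 *\<^sub>R (F z + x))" unfolding zh by (simp add: algebra_simps)
      also have "L1 * norm (- (h1 *\<^sub>R (F z + x))) = (L1 * h1) * norm (F z + x)" using h by simp
      also have "\<dots> \<le> 1 * norm (F z + x)" using h by (intro mult_right_mono) auto
      finally show "norm (F (zh vh) - F (z - h1 *\<^sub>R F z) + A2) \<le> norm (F z + x)" by (simp add: A2_def)
    qed
    moreover have "- (A2 /\<^sub>R 3) + 1 *\<^sub>R (batch_oracle \<mu> f t vh z - F z) = x - A2 /\<^sub>R 3" by (simp add: x_def)
    ultimately show "ennreal (X vh) + ennreal (c1 / 3 * (norm A2)\<^sup>2) \<le> ennreal ((norm (z - zs))\<^sup>2) +
        ennreal (3 * c1) * ennreal ((norm (- (A2 /\<^sub>R 3) + 1 *\<^sub>R (batch_oracle \<mu> f t vh z - F z)))\<^sup>2)"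
      using c1 X0 by (simp add: ennreal_plus[symmetric] ennreal_mult[symmetric] del: ennreal_plus)
  qed
  also have "\<dots> = ennreal ((norm (z - zs))\<^sup>2) + ennreal (3 * c1) *
      (\<integral>\<^sup>+vh. ennreal ((norm (- (A2 /\<^sub>R 3) + 1 *\<^sub>R (batch_oracle \<mu> f t vh z - F z)))\<^sup>2) \<partial>P)"
    by (subst nn_integral_add) (auto simp: B.emeasure_space_1 nn_integral_cmult)
  also have "\<dots> \<le> ennreal ((norm (z - zs))\<^sup>2) + ennreal (3 * c1) * ennreal ((norm (- (A2 /\<^sub>R 3)))\<^sup>2 + 1\<^sup>2 * s)"
    unfolding s_def by (intro add_left_mono mult_left_mono moment) auto
  also have "\<dots> = ennreal ((norm (z - zs))\<^sup>2 + 3 * c1 * s) + ennreal (c1 / 3 * (norm A2)\<^sup>2)"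
  proof -
    \<comment> \<open>The mean of the completed square returns exactly the |A2|^2 term carried on
      the left. That term is a finite real, so it may be cancelled in
      \<open>ennreal\<close>.\<close>
    have "3 * c1 * ((norm (- (A2 /\<^sub>R 3)))\<^sup>2 + 1\<^sup>2 * s) = 3 * c1 * s + c1 / 3 * (norm A2)\<^sup>2"
      by (simp add: power_divide algebra_simps)
    then show ?thesis
      using c1 s by (simp only: ennreal_plus[symmetric] ennreal_mult[symmetric] zero_le_power2 mult_nonneg_nonneg
          add_nonneg_nonneg zero_le_numeral divide_nonneg_nonneg add.assoc one_power2 mult_1)
  qed
  finally have "(\<integral>\<^sup>+vh. ennreal (X vh) \<partial>P) \<le> ennreal ((norm (z - zs))\<^sup>2 + 3 * c1 * s)"
    by (subst (asm) (1 2) add.commute) (simp add: ennreal_add_left_cancel_le del: ennreal_plus)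
  then have "(\<integral>\<^sup>+vh. ennreal (X vh) + ennreal (h2\<^sup>2 * s) \<partial>P) \<le>
      ennreal ((norm (z - zs))\<^sup>2 + 3 * c1 * s) + ennreal (h2\<^sup>2 * s)"
    by (subst nn_integral_add) (auto simp: B.emeasure_space_1 intro: add_right_mono simp del: ennreal_plus)
  also have "\<dots> = ennreal ((norm (z - zs))\<^sup>2 + (h2\<^sup>2 + 3 * (h1 * h2)) * s)"
  proof -
    have "(norm (z - zs))\<^sup>2 + 3 * c1 * s + h2\<^sup>2 * s = (norm (z - zs))\<^sup>2 + (h2\<^sup>2 + 3 * (h1 * h2)) * s"
      by (simp add: c1_def algebra_simps)
    moreover have "0 \<le> (norm (z - zs))\<^sup>2 + 3 * c1 * s" "0 \<le> h2\<^sup>2 * s" using c1 s by simp_all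
    ultimately show ?thesis by (metis ennreal_plus)
  qed
  finally have "(\<integral>\<^sup>+vh. ennreal (X vh) + ennreal (h2\<^sup>2 * s) \<partial>P) \<le>
      ennreal ((norm (z - zs))\<^sup>2 + (h2\<^sup>2 + 3 * (h1 * h2)) * s)" .
  then have "(\<integral>\<^sup>+vh. (\<integral>\<^sup>+v. ennreal ((norm (z - h2 *\<^sub>R batch_oracle \<mu> f t v (zh vh) - zs))\<^sup>2) +
        ennreal (a * (norm (F (zh vh)))\<^sup>2) \<partial>P) \<partial>P) \<le>
      ennreal ((norm (z - zs))\<^sup>2 + (h2\<^sup>2 + 3 * (h1 * h2)) * s)"
    by (rule order_trans[OF nn_integral_mono[OF inner]])
  then show ?thesis unfolding zh_def P_def s_def .
qed

end


section \<open>The iterates as random variables\<close>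

locale zoeg_process = smoothed_saddle f L0 L1 \<mu> \<sigma> + prob_space M
  for f :: "'a::euclidean_space \<times> 'b::euclidean_space \<Rightarrow> real" and L0 L1 \<mu> \<sigma> and M :: "'w measure" +
  fixes Uhat U :: "nat \<Rightarrow> nat \<Rightarrow> 'w \<Rightarrow> 'a \<times> 'b" and N t :: nat and z0 :: "'a \<times> 'b" and h1 h2 :: real
  assumes t: "1 \<le> t"
    and indep: "indep_vars (\<lambda>_. borel) (case_sum (\<lambda>(k, i). Uhat k i) (\<lambda>(k, i). U k i))
      (({0..N} \<times> {1..t}) <+> ({0..N} \<times> {1..t}))"
    and gaussian: "\<And>k i. k \<in> {0..N} \<Longrightarrow> i \<in> {1..t} \<Longrightarrow>
      distr M borel (Uhat k i) = std_gaussian \<and> distr M borel (U k i) = std_gaussian"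
begin

abbreviation W :: "(nat \<times> nat) + (nat \<times> nat) \<Rightarrow> 'w \<Rightarrow> 'a \<times> 'b" where
  "W \<equiv> case_sum (\<lambda>(k, i). Uhat k i) (\<lambda>(k, i). U k i)"

definition ix :: "((nat \<times> nat) + (nat \<times> nat)) set" where
  "ix = ({0..N} \<times> {1..t}) <+> ({0..N} \<times> {1..t})"

definition past :: "nat \<Rightarrow> ((nat \<times> nat) + (nat \<times> nat)) set" where
  "past k = ({..<k} \<times> {1..t}) <+> ({..<k} \<times> {1..t})"

abbreviation zk :: "nat \<Rightarrow> 'w \<Rightarrow> 'a \<times> 'b" where
  "zk k \<omega> \<equiv> zoeg_z f \<mu> h1 h2 (\<lambda>_. t) z0 (\<lambda>j i. Uhat j i \<omega>) (\<lambda>j i. U j i \<omega>) k"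

abbreviation zhatk :: "nat \<Rightarrow> 'w \<Rightarrow> 'a \<times> 'b" where
  "zhatk k \<omega> \<equiv> zoeg_zhat f \<mu> h1 h2 (\<lambda>_. t) z0 (\<lambda>j i. Uhat j i \<omega>) (\<lambda>j i. U j i \<omega>) k"

abbreviation borel_batch :: "(nat \<Rightarrow> 'a \<times> 'b) measure" where
  "borel_batch \<equiv> PiM {1..t} (\<lambda>_. borel)"

lemma indep_ix: "indep_vars (\<lambda>_. borel) W ix"
  using indep by (simp add: ix_def)

lemma W_measurable: "p \<in> ix \<Longrightarrow> W p \<in> borel_measurable M"
  using indep_ix by (auto simp: indep_vars_def2)

lemma W_law: "p \<in> ix \<Longrightarrow> distr M borel (W p) = std_gaussian"
  using gaussian by (auto simp: ix_def)

lemma restrict_W_measurable: "A \<subseteq> ix \<Longrightarrow> (\<lambda>\<omega>. \<lambda>p\<in>A. W p \<omega>) \<in> M \<rightarrow>\<^sub>M PiM A (\<lambda>_. borel)"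
  using W_measurable by (intro measurable_restrict) blast

lemma sets_batch_measure: "sets (batch_measure t) = sets borel_batch"
  by (intro sets_PiM_cong) auto

text \<open>Independence with Gaussian marginals makes the restriction to \<open>J\<close> a product
  measure, and reindexing along the injective \<open>c\<close> moves it to \<open>{1..t}\<close>.
  Nonemptiness of \<open>J\<close> comes from \<open>t\<close> being at least 1.\<close>

lemma batch_law:
  assumes c: "inj_on c {1..t}" "c ` {1..t} \<subseteq> ix"
  defines "J \<equiv> c ` {1..t}"
  shows "distr (distr M (PiM J (\<lambda>_. borel)) (\<lambda>\<omega>. \<lambda>p\<in>J. W p \<omega>)) (batch_measure t) (\<lambda>w. \<lambda>i\<in>{1..t}. w (c i)) =
    batch_measure t"
proof -
  have J: "J \<noteq> {}" "J \<subseteq> ix" using t c by (auto simp: J_def)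
  have "indep_vars (\<lambda>_. borel) W J" using indep_ix J(2) by (rule indep_vars_subset)
  then have "distr M (PiM J (\<lambda>_. borel)) (\<lambda>\<omega>. \<lambda>p\<in>J. W p \<omega>) = PiM J (\<lambda>p. distr M borel (W p))"
    using J by (subst (asm) indep_vars_iff_distr_eq_PiM'[OF J(1)]) (auto intro: W_measurable)
  also have "\<dots> = PiM J (\<lambda>_. std_gaussian)"
    using J by (intro PiM_cong refl W_law) blast
  finally show ?thesis
    using c(1) by (subst distr_PiM_reindex[symmetric, of J "\<lambda>_. std_gaussian" c])
      (auto intro: prob_space_std_gaussian simp: J_def)
qed

text \<open>\<open>indep_var\<close> requires both variables to have the same value type, hence both sides are kept as
  families over sets of indices and \<open>H\<close> extracts the iterate.\<close>

lemma nn_integral_fresh_batch: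
  assumes A: "A \<subseteq> ix" and c: "inj_on c {1..t}" "c ` {1..t} \<subseteq> ix" "A \<inter> c ` {1..t} = {}"
    and H: "H \<in> PiM A (\<lambda>_. borel) \<rightarrow>\<^sub>M S"
    and h: "h \<in> borel_measurable (S \<Otimes>\<^sub>M borel_batch)"
  shows "(\<integral>\<^sup>+\<omega>. h (H (\<lambda>p\<in>A. W p \<omega>), \<lambda>i\<in>{1..t}. W (c i) \<omega>) \<partial>M) =
    (\<integral>\<^sup>+\<omega>. (\<integral>\<^sup>+v. h (H (\<lambda>p\<in>A. W p \<omega>), v) \<partial>batch_measure t) \<partial>M)"
proof -
  let ?J = "c ` {1..t}"
  let ?R = "\<lambda>\<omega>. \<lambda>p\<in>?J. W p \<omega>"
  let ?G = "\<lambda>w. \<lambda>i\<in>{1..t}. w (c i)"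
  have G: "?G \<in> PiM ?J (\<lambda>_. borel) \<rightarrow>\<^sub>M borel_batch"
    by (intro measurable_restrict measurable_component_singleton) auto
  have R: "?R \<in> M \<rightarrow>\<^sub>M PiM ?J (\<lambda>_. borel)" using c(2) by (rule restrict_W_measurable)
  have hHG: "(\<lambda>p. h (H (fst p), ?G (snd p))) \<in> borel_measurable (PiM A (\<lambda>_. borel) \<Otimes>\<^sub>M PiM ?J (\<lambda>_. borel))"
    by (intro measurable_compose[OF _ h] measurable_Pair measurable_compose[OF measurable_fst H]
        measurable_compose[OF measurable_snd G])
  have "?G (?R \<omega>) = (\<lambda>i\<in>{1..t}. W (c i) \<omega>)" for \<omega>
    by (auto simp: fun_eq_iff)
  then have "(\<integral>\<^sup>+\<omega>. h (H (\<lambda>p\<in>A. W p \<omega>), \<lambda>i\<in>{1..t}. W (c i) \<omega>) \<partial>M) =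
      (\<integral>\<^sup>+\<omega>. h (H (\<lambda>p\<in>A. W p \<omega>), ?G (?R \<omega>)) \<partial>M)" by simp
  also have "\<dots> = (\<integral>\<^sup>+\<omega>. (\<integral>\<^sup>+w. h (H (\<lambda>p\<in>A. W p \<omega>), ?G w) \<partial>distr M (PiM ?J (\<lambda>_. borel)) ?R) \<partial>M)"
    using nn_integral_indep_var[OF indep_var_restrict[OF indep_ix c(3) A c(2)] hHG] by (simp only: fst_conv snd_conv)
  also have "\<dots> = (\<integral>\<^sup>+\<omega>. (\<integral>\<^sup>+v. h (H (\<lambda>p\<in>A. W p \<omega>), v) \<partial>batch_measure t) \<partial>M)"
  proof (intro nn_integral_cong)
    fix \<omega> assume \<omega>: "\<omega> \<in> space M"
    let ?D = "distr M (PiM ?J (\<lambda>_. borel)) ?R"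
    have GD: "?G \<in> ?D \<rightarrow>\<^sub>M batch_measure t"
      using G by (simp only: measurable_distr_eq1 measurable_cong_sets[OF refl sets_batch_measure])
    have HW: "H (\<lambda>p\<in>A. W p \<omega>) \<in> space S"
      using measurable_space[OF H measurable_space[OF restrict_W_measurable[OF A] \<omega>]] .
    have "(\<lambda>v. h (H (\<lambda>p\<in>A. W p \<omega>), v)) \<in> borel_measurable (distr ?D (batch_measure t) ?G)"
      using measurable_compose[OF measurable_Pair1'[OF HW] h]
      by (simp only: measurable_distr_eq1 measurable_cong_sets[OF sets_batch_measure refl])
    from nn_integral_distr[OF GD this]
    show "(\<integral>\<^sup>+w. h (H (\<lambda>p\<in>A. W p \<omega>), ?G w) \<partial>?D) = (\<integral>\<^sup>+v. h (H (\<lambda>p\<in>A. W p \<omega>), v) \<partial>batch_measure t)"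
      unfolding batch_law[OF c(1,2)] by (rule sym)
  qed
  finally show ?thesis .
qed

text \<open>The iterate as a function of sampled values rather than of the sample point: the form in
  which a product law can be substituted.\<close>

definition zfun :: "nat \<Rightarrow> ((nat \<times> nat) + (nat \<times> nat) \<Rightarrow> 'a \<times> 'b) \<Rightarrow> 'a \<times> 'b" where
  "zfun k w = zoeg_z f \<mu> h1 h2 (\<lambda>_. t) z0 (\<lambda>j i. w (Inl (j, i))) (\<lambda>j i. w (Inr (j, i))) k"

lemma zfun_measurable: "past k \<subseteq> A \<Longrightarrow> zfun k \<in> borel_measurable (PiM A (\<lambda>_. borel))"
  unfolding zfun_def[abs_def]
  by (intro borel_measurable_zoeg_z measurable_component_singleton) (auto simp: past_def)

lemma zfun_W:
  assumes "past k \<subseteq> A"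
  shows "zfun k (\<lambda>p\<in>A. W p \<omega>) = zk k \<omega>"
proof -
  have "Inl (j, i) \<in> A" "Inr (j, i) \<in> A" if "j < k" "i \<in> {1..t}" for j i
    using that by (auto intro!: subsetD[OF assms] simp: past_def)
  then show ?thesis unfolding zfun_def by (intro zoeg_z_cong) auto
qed

text \<open>The iterate after the last round \<open>N\<close> still uses only batches up to
  \<open>N\<close>, hence the bound \<open>Suc N\<close>.\<close>

lemma past_subset: "k \<le> Suc N \<Longrightarrow> past k \<subseteq> ix"
  by (auto simp: past_def ix_def)

lemma zk_measurable: "k \<le> Suc N \<Longrightarrow> zk k \<in> borel_measurable M"
  using measurable_compose[OF restrict_W_measurable[OF past_subset] zfun_measurable[OF order_refl]]
  by (simp add: zfun_W)

lemma zhatk_measurable: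
  assumes "k \<le> N"
  shows "zhatk k \<in> borel_measurable M"
proof -
  have "Uhat k i \<in> borel_measurable M" if "i \<in> {1..t}" for i
  proof -
    have "Inl (k, i) \<in> ix" using assms that by (auto simp: ix_def)
    from W_measurable[OF this] show ?thesis by simp
  qed
  moreover have "zk k \<in> borel_measurable M" using assms by (intro zk_measurable) auto
  ultimately show ?thesis
    unfolding zoeg_zhat_def[abs_def] zoeg_extrapolate_def
    by (intro borel_measurable_diff borel_measurable_scaleR borel_measurable_const borel_measurable_batch_oracle)
qed

text \<open>The batches of a round are integrated out in reverse order of sampling: the update batch
  given all that precedes it, then the extrapolation batch given the past. This turns the bound for
  a fixed \<open>z\<close> into one for the random iterate, even where expectations might be
  infinite.\<close>

lemma expected_descent:
  assumes k: "k \<le> N"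
    and wm: "\<And>z. 0 \<le> F z \<bullet> (z - zs) + \<rho> / 2 * (norm (F z))\<^sup>2"
    and h: "0 \<le> h1" "0 \<le> h2" "L1 * h1 \<le> 1" and a: "0 \<le> a" "a + h2 * \<rho> + h2\<^sup>2 \<le> h1 * h2"
  shows "(\<integral>\<^sup>+\<omega>. ennreal ((norm (zk (Suc k) \<omega> - zs))\<^sup>2) \<partial>M) + (\<integral>\<^sup>+\<omega>. ennreal (a * (norm (F (zhatk k \<omega>)))\<^sup>2) \<partial>M)
    \<le> (\<integral>\<^sup>+\<omega>. ennreal ((norm (zk k \<omega> - zs))\<^sup>2) \<partial>M) + ennreal ((h2\<^sup>2 + 3 * (h1 * h2)) * (\<sigma>\<^sup>2 / real t))"
proof -
  define g where "g = (\<lambda>v z. batch_oracle \<mu> f t v z)"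
  define q where "q = (\<lambda>((z, vh), v). ennreal ((norm (z - h2 *\<^sub>R g v (z - h1 *\<^sub>R g vh z) - zs))\<^sup>2) +
    ennreal (a * (norm (F (z - h1 *\<^sub>R g vh z)))\<^sup>2))"
  define q' where "q' = (\<lambda>p. \<integral>\<^sup>+v. q (p, v) \<partial>batch_measure t)"
  define Vh where "Vh = (\<lambda>\<omega>. \<lambda>i\<in>{1..t}. W (Inl (k, i)) \<omega>)"
  define V where "V = (\<lambda>\<omega>. \<lambda>i\<in>{1..t}. W (Inr (k, i)) \<omega>)"
  \<comment> \<open>All indices on which the extrapolated point of round \<open>k\<close> depends;
    the update batch of the same round is fresh relative to them.\<close>
  define B where "B = past k \<union> (\<lambda>i. Inl (k, i)) ` {1..t}"
  interpret B: prob_space "batch_measure t"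
    by (intro prob_space_PiM prob_space_std_gaussian)
  have past: "past k \<subseteq> ix" using k by (intro past_subset) simp
  have Bix: "B \<subseteq> ix" using past k by (auto simp: B_def ix_def)
  have comp: "(\<lambda>w. v w i) \<in> borel_measurable P" if "v \<in> P \<rightarrow>\<^sub>M borel_batch" "i \<in> {1..t}" for P v i
    using measurable_compose[OF that(1) measurable_component_singleton[OF that(2)]] .
  have g: "(\<lambda>w. g (v w) (z w)) \<in> borel_measurable P" if "v \<in> P \<rightarrow>\<^sub>M borel_batch" "z \<in> borel_measurable P" for P v z
    unfolding g_def by (rule borel_measurable_batch_oracle[OF comp[OF that(1)] that(2)])
  have q: "q \<in> borel_measurable ((borel \<Otimes>\<^sub>M borel_batch) \<Otimes>\<^sub>M borel_batch)"
  proof -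
    let ?P = "(borel \<Otimes>\<^sub>M borel_batch) \<Otimes>\<^sub>M borel_batch :: ((('a \<times> 'b) \<times> (nat \<Rightarrow> 'a \<times> 'b)) \<times> (nat \<Rightarrow> 'a \<times> 'b)) measure"
    have z: "(\<lambda>p. fst (fst p)) \<in> borel_measurable ?P" and vh: "(\<lambda>p. snd (fst p)) \<in> ?P \<rightarrow>\<^sub>M borel_batch"
      and v: "snd \<in> ?P \<rightarrow>\<^sub>M borel_batch"
      by measurable
    have zh[measurable]: "(\<lambda>p. fst (fst p) - h1 *\<^sub>R g (snd (fst p)) (fst (fst p))) \<in> borel_measurable ?P"
      by (intro borel_measurable_diff borel_measurable_scaleR borel_measurable_const g z vh)
    have [measurable]: "(\<lambda>p. g (snd p) (fst (fst p) - h1 *\<^sub>R g (snd (fst p)) (fst (fst p)))) \<in> borel_measurable ?P"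
      by (intro g v zh)
    have "(\<lambda>p. ennreal ((norm (fst (fst p) - h2 *\<^sub>R g (snd p) (fst (fst p) - h1 *\<^sub>R g (snd (fst p)) (fst (fst p))) - zs))\<^sup>2) +
        ennreal (a * (norm (F (fst (fst p) - h1 *\<^sub>R g (snd (fst p)) (fst (fst p)))))\<^sup>2)) \<in> borel_measurable ?P"
      using z by measurable
    then show ?thesis by (simp add: q_def case_prod_beta')
  qed
  have q': "q' \<in> borel_measurable (borel \<Otimes>\<^sub>M borel_batch)"
    unfolding q'_def
  proof (rule B.borel_measurable_nn_integral)
    show "case_prod (\<lambda>p v. q (p, v)) \<in> borel_measurable ((borel \<Otimes>\<^sub>M borel_batch) \<Otimes>\<^sub>M batch_measure t)"
      using q by (simp add: measurable_cong_sets[OF sets_pair_measure_cong[OF refl sets_batch_measure] refl])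
  qed
  have zhat: "zhatk k \<omega> = zk k \<omega> - h1 *\<^sub>R g (Vh \<omega>) (zk k \<omega>)" for \<omega>
    unfolding zoeg_zhat_def zoeg_extrapolate_def g_def Vh_def
    by (intro arg_cong[where f = "\<lambda>x. zk k \<omega> - h1 *\<^sub>R x"] batch_oracle_cong) auto
  have zSuc: "zk (Suc k) \<omega> = zk k \<omega> - h2 *\<^sub>R g (V \<omega>) (zhatk k \<omega>)" for \<omega>
    unfolding zoeg_z.simps zoeg_zhat_def g_def V_def
    by (intro arg_cong[where f = "\<lambda>x. zk k \<omega> - h2 *\<^sub>R x"] batch_oracle_cong) auto
  have "(\<integral>\<^sup>+\<omega>. ennreal ((norm (zk (Suc k) \<omega> - zs))\<^sup>2) \<partial>M) + (\<integral>\<^sup>+\<omega>. ennreal (a * (norm (F (zhatk k \<omega>)))\<^sup>2) \<partial>M) =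
      (\<integral>\<^sup>+\<omega>. ennreal ((norm (zk (Suc k) \<omega> - zs))\<^sup>2) + ennreal (a * (norm (F (zhatk k \<omega>)))\<^sup>2) \<partial>M)"
  proof (rule nn_integral_add[symmetric])
    have [measurable]: "zk (Suc k) \<in> borel_measurable M" "zhatk k \<in> borel_measurable M"
      using k by (auto intro!: zk_measurable zhatk_measurable simp del: zoeg_z.simps)
    show "(\<lambda>\<omega>. ennreal ((norm (zk (Suc k) \<omega> - zs))\<^sup>2)) \<in> borel_measurable M" by measurable
    show "(\<lambda>\<omega>. ennreal (a * (norm (F (zhatk k \<omega>)))\<^sup>2)) \<in> borel_measurable M" by measurable
  qed
  also have "\<dots> = (\<integral>\<^sup>+\<omega>. q ((zk k \<omega>, Vh \<omega>), V \<omega>) \<partial>M)"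
    unfolding zSuc zhat q_def by simp
  also have "\<dots> = (\<integral>\<^sup>+\<omega>. (\<integral>\<^sup>+v. q ((zk k \<omega>, Vh \<omega>), v) \<partial>batch_measure t) \<partial>M)"
  proof -
    define H where "H = (\<lambda>w. (zfun k w, \<lambda>i\<in>{1..t}. w (Inl (k, i))))"
    have H: "H \<in> PiM B (\<lambda>_. borel) \<rightarrow>\<^sub>M borel \<Otimes>\<^sub>M borel_batch"
      unfolding H_def
      by (intro measurable_Pair zfun_measurable measurable_restrict measurable_component_singleton) (auto simp: B_def)
    have "H (\<lambda>p\<in>B. W p \<omega>) = (zk k \<omega>, Vh \<omega>)" for \<omega>
      using zfun_W[of k B \<omega>] by (auto simp: H_def Vh_def B_def fun_eq_iff)
    moreover have "B \<inter> (\<lambda>i. Inr (k, i)) ` {1..t} = {}" "(\<lambda>i. Inr (k, i)) ` {1..t} \<subseteq> ix"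
      using k by (auto simp: B_def past_def ix_def)
    ultimately show ?thesis
      using nn_integral_fresh_batch[OF Bix _ _ _ H q, of "\<lambda>i. Inr (k, i)"] by (simp add: V_def inj_on_def)
  qed
  also have "\<dots> = (\<integral>\<^sup>+\<omega>. q' (zk k \<omega>, Vh \<omega>) \<partial>M)" by (simp add: q'_def)
  also have "\<dots> = (\<integral>\<^sup>+\<omega>. (\<integral>\<^sup>+vh. q' (zk k \<omega>, vh) \<partial>batch_measure t) \<partial>M)"
  proof -
    have "past k \<inter> (\<lambda>i. Inl (k, i)) ` {1..t} = {}" "(\<lambda>i. Inl (k, i)) ` {1..t} \<subseteq> ix"
      using k by (auto simp: past_def ix_def)
    then show ?thesis
      using nn_integral_fresh_batch[OF past _ _ _ zfun_measurable[OF order_refl] q', of "\<lambda>i. Inl (k, i)"]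
      by (simp add: Vh_def inj_on_def zfun_W)
  qed
  also have "\<dots> \<le> (\<integral>\<^sup>+\<omega>. ennreal ((norm (zk k \<omega> - zs))\<^sup>2) + ennreal ((h2\<^sup>2 + 3 * (h1 * h2)) * (\<sigma>\<^sup>2 / real t)) \<partial>M)"
  proof (intro nn_integral_mono)
    fix \<omega>
    have "(\<integral>\<^sup>+vh. q' (zk k \<omega>, vh) \<partial>batch_measure t)
        \<le> ennreal ((norm (zk k \<omega> - zs))\<^sup>2 + (h2\<^sup>2 + 3 * (h1 * h2)) * (\<sigma>\<^sup>2 / real t))"
      using extragradient_step[OF t wm h a, of "zk k \<omega>"] unfolding q'_def q_def g_def by simp
    then show "(\<integral>\<^sup>+vh. q' (zk k \<omega>, vh) \<partial>batch_measure t)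
        \<le> ennreal ((norm (zk k \<omega> - zs))\<^sup>2) + ennreal ((h2\<^sup>2 + 3 * (h1 * h2)) * (\<sigma>\<^sup>2 / real t))"
      using h by (subst ennreal_plus[symmetric]) auto
  qed
  also have "\<dots> = (\<integral>\<^sup>+\<omega>. ennreal ((norm (zk k \<omega> - zs))\<^sup>2) \<partial>M) + ennreal ((h2\<^sup>2 + 3 * (h1 * h2)) * (\<sigma>\<^sup>2 / real t))"
  proof -
    have [measurable]: "zk k \<in> borel_measurable M" using k by (intro zk_measurable) simp
    show ?thesis by (subst nn_integral_add) (auto simp: emeasure_space_1)
  qed
  finally show ?thesis .
qed

text \<open>After telescoping, the \<open>N + 1\<close> terms have a sum of at most
  \<open>r + (N + 1) * c\<close>, so they cannot all exceed their average.\<close>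

lemma best_iterate:
  assumes wm: "\<And>z. 0 \<le> F z \<bullet> (z - zs) + \<rho> / 2 * (norm (F z))\<^sup>2"
    and h: "0 \<le> h1" "0 \<le> h2" "L1 * h1 \<le> 1" and a: "0 \<le> a" "a + h2 * \<rho> + h2\<^sup>2 \<le> h1 * h2"
  shows "\<exists>k\<le>N. (\<integral>\<^sup>+\<omega>. ennreal (a * (norm (F (zhatk k \<omega>)))\<^sup>2) \<partial>M) \<le>
    ennreal ((norm (z0 - zs))\<^sup>2 / (real N + 1) + (h2\<^sup>2 + 3 * (h1 * h2)) * (\<sigma>\<^sup>2 / real t))"
proof (rule ccontr)
  define c where "c = (h2\<^sup>2 + 3 * (h1 * h2)) * (\<sigma>\<^sup>2 / real t)"
  define r where "r = (norm (z0 - zs))\<^sup>2"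
  define E where "E = (\<lambda>k. \<integral>\<^sup>+\<omega>. ennreal ((norm (zk k \<omega> - zs))\<^sup>2) \<partial>M)"
  define D where "D = (\<lambda>k. \<integral>\<^sup>+\<omega>. ennreal (a * (norm (F (zhatk k \<omega>)))\<^sup>2) \<partial>M)"
  have c: "0 \<le> c" and r: "0 \<le> r" using h by (auto simp: c_def r_def)
  assume "\<not> ?thesis"
  then have "\<not> (\<exists>k\<le>N. D k \<le> ennreal (r / (real N + 1) + c))" unfolding D_def r_def c_def .
  then have D: "ennreal (r / (real N + 1) + c) < D k" if "k \<le> N" for k
    using that by (meson not_le)
  have sum_le: "E n + (\<Sum>k<n. D k) \<le> ennreal (r + real n * c)" if "n \<le> Suc N" for n
    using that
  proof (induction n)
    case 0
    show ?case by (simp add: E_def r_def emeasure_space_1)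
  next
    case (Suc n)
    have "E (Suc n) + (\<Sum>k<Suc n. D k) = (E (Suc n) + D n) + (\<Sum>k<n. D k)" by (simp add: ac_simps)
    also have "\<dots> \<le> (E n + ennreal c) + (\<Sum>k<n. D k)"
      using expected_descent[OF _ wm h a, of n] Suc.prems unfolding E_def D_def c_def
      by (intro add_right_mono) auto
    also have "\<dots> = (E n + (\<Sum>k<n. D k)) + ennreal c" by (simp add: ac_simps)
    also have "\<dots> \<le> ennreal (r + real n * c) + ennreal c"
      using Suc by (intro add_right_mono) auto
    also have "\<dots> = ennreal (r + real (Suc n) * c)"
      using c r by (subst ennreal_plus[symmetric]) (auto simp: algebra_simps)
    finally show ?case .
  qed
  have Dsum: "(\<Sum>k<Suc N. D k) \<le> ennreal (r + real (Suc N) * c)"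
    by (rule order_trans[OF _ sum_le[OF order_refl]]) simp
  \<comment> \<open>Finiteness is available only now, from the telescoped bound with its
    deterministic start. It lets the strict inequalities be summed in the reals, since addition in
    \<open>ennreal\<close> is not strictly monotone at infinity.\<close>
  have fin: "ennreal (enn2real (D k)) = D k" if "k < Suc N" for k
  proof -
    have "D k \<le> (\<Sum>k<Suc N. D k)" using that by (intro member_le_sum) auto
    also have "\<dots> < top" using Dsum by (rule order_le_less_trans) simp
    finally show ?thesis by (rule ennreal_enn2real)
  qed
  have "(\<Sum>k<Suc N. r / (real N + 1) + c) < (\<Sum>k<Suc N. enn2real (D k))"
  proof (rule sum_strict_mono)
    fix k assume "k \<in> {..<Suc N}"
    then have "ennreal (r / (real N + 1) + c) < ennreal (enn2real (D k))" using D[of k] fin[of k] by simp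
    then show "r / (real N + 1) + c < enn2real (D k)" using c r by (simp add: ennreal_less_iff del: ennreal_plus)
  qed auto
  moreover have "(\<Sum>k<Suc N. r / (real N + 1) + c) = r + real (Suc N) * c"
    by (simp add: distrib_left add.commute)
  moreover have "ennreal (\<Sum>k<Suc N. enn2real (D k)) = (\<Sum>k<Suc N. D k)"
    using fin by (subst sum_ennreal[symmetric]) auto
  with Dsum have "(\<Sum>k<Suc N. enn2real (D k)) \<le> r + real (Suc N) * c"
    using c r by (metis add_nonneg_nonneg ennreal_le_iff mult_nonneg_nonneg of_nat_0_le_iff)
  ultimately show False by linarith
qed

end

text \<open>Integrability belongs to the conclusion because a Bochner integral defaults to 0 and
  would satisfy the bound vacuously. Expectation over the whole sample space agrees with that over
  the batches up to round \<open>k\<close>, as the point depends on no others.\<close>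

theorem corollary12:
  fixes f :: "(real ^ 'n) \<times> (real ^ 'm) \<Rightarrow> real"
    and M :: "'w measure"
    and Uhat U :: "nat \<Rightarrow> nat \<Rightarrow> 'w \<Rightarrow> (real ^ 'n) \<times> (real ^ 'm)"
    and z0 zs :: "(real ^ 'n) \<times> (real ^ 'm)"
    and L0 L1 \<delta> \<gamma> \<mu> \<sigma> \<rho> h1 h2 r0 \<epsilon> :: real
    and d N t :: nat
  assumes d: "d = CARD('n) + CARD('m)"
    and L0: "L0 > 0" "L0-lipschitz_on UNIV f"
    and \<delta>: "0 < \<delta>" "\<delta> < 1"
    and \<gamma>: "0 < \<gamma>" "\<gamma> \<le> min (5 * L0) 1"
    and \<mu>: "\<mu> > 0" "\<mu> \<le> \<delta> / sqrt (real d * pi * exp 1) * (\<gamma> / (4 * L0)) powr (1 / real d)"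
    and L1: "L1 > 0" "L1-lipschitz_on UNIV (grad (gaussian_smoothing \<mu> f))"
    and \<sigma>: "\<sigma> \<ge> 0"
      "\<And>z. (\<integral>u. (norm (zo_oracle \<mu> f z u - saddle_grad \<mu> f z))\<^sup>2 \<partial>std_gaussian) \<le> \<sigma>\<^sup>2"
    and \<rho>: "0 \<le> \<rho>" "\<rho> < 1 / (4 * L1)"
    and weak_minty:
      "\<And>z. saddle_grad \<mu> f z \<bullet> (z - zs) + \<rho> / 2 * (norm (saddle_grad \<mu> f z))\<^sup>2 \<ge> 0"
    and t: "t \<ge> 1"
    and h1: "h1 > 0" "h1 \<le> 1 / L1"
    and h2: "h2 > 0" "sqrt (\<rho> / L1) < h2" "h2 \<le> h1 / 2"
    and r0: "r0 = norm (z0 - zs)"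
    and prob: "prob_space M"
    and indep: "prob_space.indep_vars M (\<lambda>_. borel)
        (case_sum (\<lambda>(k, i). Uhat k i) (\<lambda>(k, i). U k i))
        (({0..N} \<times> {1..t}) <+> ({0..N} \<times> {1..t}))"
    and gaussian: "\<And>k i. k \<in> {0..N} \<Longrightarrow> i \<in> {1..t} \<Longrightarrow>
        distr M borel (Uhat k i) = std_gaussian \<and> distr M borel (U k i) = std_gaussian"
    and \<epsilon>: "\<epsilon> > 0"
    and \<mu>_\<epsilon>: "\<mu> \<le> \<delta> / sqrt (real d * pi * exp 1) * (\<epsilon> / (8 * L0)) powr (1 / real d)"
    and N: "int N \<ge> \<lceil>16 * r0\<^sup>2 * L1 / (L1 * h2\<^sup>2 - \<rho>) * \<epsilon> powi (-2) - 1\<rceil>"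
    and t_\<epsilon>: "int t \<ge> \<lceil>24 * \<sigma>\<^sup>2 / (L1 * (L1 * h2\<^sup>2 - \<rho>)) * \<epsilon> powi (-2)\<rceil>"
  defines "zhat \<equiv> \<lambda>k \<omega>. zoeg_zhat f \<mu> h1 h2 (\<lambda>_. t) z0 (\<lambda>j i. Uhat j i \<omega>) (\<lambda>j i. U j i \<omega>) k"
  shows "\<exists>k\<in>{0..N}.
      integrable M (\<lambda>\<omega>. goldstein_min_norm \<delta> f (zhat k \<omega>)) \<and>
      prob_space.expectation M (\<lambda>\<omega>. goldstein_min_norm \<delta> f (zhat k \<omega>)) \<le> \<epsilon>"
proof -
  interpret zoeg_process f L0 L1 \<mu> \<sigma> M Uhat U N t z0 h1 h2
  proof (intro zoeg_process.intro smoothed_saddle.intro zoeg_process_axioms.intro)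
    show "prob_space M" by (rule prob)
    show "prob_space.indep_vars M (\<lambda>_. borel) (case_sum (\<lambda>(k, i). Uhat k i) (\<lambda>(k, i). U k i))
        (({0..N} \<times> {1..t}) <+> ({0..N} \<times> {1..t}))" by (rule indep)
  qed (use L0 \<mu> L1 \<sigma> t gaussian in blast)+
  \<comment> \<open>The net decrease per round, positive precisely by the lower bound on
    \<open>h2\<close>.\<close>
  define a where "a = h2\<^sup>2 - \<rho> / L1"
  have a: "0 < a"
  proof -
    have "(sqrt (\<rho> / L1))\<^sup>2 < h2\<^sup>2" using h2 L1 \<rho> by (intro power_strict_mono) auto
    then show ?thesis using L1 \<rho> by (simp add: a_def)
  qed
  have A: "L1 * h2\<^sup>2 - \<rho> = L1 * a" using L1 by (simp add: a_def right_diff_distrib)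
  have Lh1: "L1 * h1 \<le> 1" using h1 L1 by (simp add: pos_le_divide_eq mult.commute)
  have "L1 * (h1 / 2) \<le> 1 / 2" using Lh1 by simp
  then have Lh2: "L1 * h2 \<le> 1 / 2" using mult_left_mono[OF h2(3), of L1] L1 by linarith
  \<comment> \<open>The \<rho>-part of \<open>a\<close> pays for \<open>h2 * \<rho>\<close>, since
    \<open>h2\<close> is at most 1 / L1; the two remaining squares \<open>h2^2\<close> fit into
    \<open>h1 * h2\<close> because \<open>2 * h2\<close> is at most \<open>h1\<close>.\<close>
  have step: "a + h2 * \<rho> + h2\<^sup>2 \<le> h1 * h2"
  proof -
    have "h2 \<le> 1 / L1" using Lh2 L1 by (simp add: pos_le_divide_eq mult.commute)
    then have "h2 * \<rho> \<le> 1 / L1 * \<rho>" using \<rho> by (intro mult_right_mono) auto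
    moreover have "(2 * h2) * h2 \<le> h1 * h2" using h2 by (intro mult_right_mono) auto
    ultimately show ?thesis by (simp add: a_def power2_eq_square)
  qed
  have eps2: "\<epsilon> powi (-2) = 1 / \<epsilon>\<^sup>2"
    by (simp add: power_int_minus field_simps)
  have initial: "r0\<^sup>2 / (real N + 1) \<le> a * \<epsilon>\<^sup>2 / 16"
  proof -
    have "16 * r0\<^sup>2 * L1 / (L1 * a) * (1 / \<epsilon>\<^sup>2) - 1 \<le> real N"
      using N unfolding A eps2 ceiling_le_iff of_int_of_nat_eq .
    then have "16 * r0\<^sup>2 / (a * \<epsilon>\<^sup>2) \<le> real N + 1" using L1 by simp
    then show ?thesis using a \<epsilon> by (simp add: pos_divide_le_eq pos_le_divide_eq mult.commute)
  qed
  \<comment> \<open>Since L1 h1 <= 1 and L1 h2 <= 1/2, the coefficient times L1^2 is at most 1/4 +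
    3/2 <= 2, so the 24 in the sample size leaves a share of 1/12. With the share of 1/16 from the
    initial distance this stays below 1/4.\<close>
  have noise: "(h2\<^sup>2 + 3 * (h1 * h2)) * (\<sigma>\<^sup>2 / real t) \<le> a * \<epsilon>\<^sup>2 / 12"
  proof -
    have "24 * \<sigma>\<^sup>2 / (L1 * (L1 * a)) * (1 / \<epsilon>\<^sup>2) \<le> real t"
      using t_\<epsilon> unfolding A eps2 ceiling_le_iff of_int_of_nat_eq .
    then have "24 * \<sigma>\<^sup>2 / (L1\<^sup>2 * (a * \<epsilon>\<^sup>2)) \<le> real t" by (simp add: power2_eq_square ac_simps)
    then have "24 * \<sigma>\<^sup>2 \<le> real t * (L1\<^sup>2 * (a * \<epsilon>\<^sup>2))"
      using a \<epsilon> L1 by (simp add: pos_divide_le_eq)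
    then have s: "\<sigma>\<^sup>2 / real t \<le> L1\<^sup>2 * (a * \<epsilon>\<^sup>2) / 24"
      using t by (simp add: pos_divide_le_eq mult.commute)
    have "L1\<^sup>2 * (h2\<^sup>2 + 3 * (h1 * h2)) = (L1 * h2) * (L1 * h2) + 3 * ((L1 * h1) * (L1 * h2))"
      by (simp add: power2_eq_square algebra_simps)
    also have "\<dots> \<le> (1 / 2) * (1 / 2) + 3 * (1 * (1 / 2))"
      using Lh1 Lh2 L1 h1 h2 by (intro add_mono mult_mono mult_left_mono) auto
    also have "\<dots> \<le> 2" by simp
    finally have 2: "L1\<^sup>2 * (h2\<^sup>2 + 3 * (h1 * h2)) \<le> 2" .
    have "(h2\<^sup>2 + 3 * (h1 * h2)) * (\<sigma>\<^sup>2 / real t) \<le> (h2\<^sup>2 + 3 * (h1 * h2)) * (L1\<^sup>2 * (a * \<epsilon>\<^sup>2) / 24)"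
      using s h1 h2 by (intro mult_left_mono) auto
    also have "\<dots> = (L1\<^sup>2 * (h2\<^sup>2 + 3 * (h1 * h2))) * (a * \<epsilon>\<^sup>2 / 24)" by simp
    also have "\<dots> \<le> 2 * (a * \<epsilon>\<^sup>2 / 24)" using 2 a by (intro mult_right_mono) auto
    finally show ?thesis by simp
  qed
  obtain k where k: "k \<le> N" and
    "(\<integral>\<^sup>+\<omega>. ennreal (a * (norm (F (zhat k \<omega>)))\<^sup>2) \<partial>M) \<le>
      ennreal ((norm (z0 - zs))\<^sup>2 / (real N + 1) + (h2\<^sup>2 + 3 * (h1 * h2)) * (\<sigma>\<^sup>2 / real t))"
    using best_iterate[of zs \<rho> a] weak_minty h1 h2 a Lh1 step unfolding zhat_def by auto
  note this(2)
  also have "\<dots> \<le> ennreal (a * (\<epsilon>\<^sup>2 / 4))"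
  proof (intro ennreal_leI)
    have "(norm (z0 - zs))\<^sup>2 / (real N + 1) + (h2\<^sup>2 + 3 * (h1 * h2)) * (\<sigma>\<^sup>2 / real t) \<le>
        a * \<epsilon>\<^sup>2 / 16 + a * \<epsilon>\<^sup>2 / 12"
      using initial noise unfolding r0 by (rule add_mono)
    also have "\<dots> \<le> a * (\<epsilon>\<^sup>2 / 4)" using a by simp
    finally show "(norm (z0 - zs))\<^sup>2 / (real N + 1) + (h2\<^sup>2 + 3 * (h1 * h2)) * (\<sigma>\<^sup>2 / real t) \<le> a * (\<epsilon>\<^sup>2 / 4)" .
  qed
  finally have nn: "(\<integral>\<^sup>+\<omega>. ennreal (a * (norm (F (zhat k \<omega>)))\<^sup>2) \<partial>M) \<le> ennreal (a * (\<epsilon>\<^sup>2 / 4))" .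
  have zhat[measurable]: "zhat k \<in> borel_measurable M"
    unfolding zhat_def using k by (rule zhatk_measurable)
  have intF: "integrable M (\<lambda>\<omega>. (norm (F (zhat k \<omega>)))\<^sup>2)"
    and EF: "(\<integral>\<omega>. (norm (F (zhat k \<omega>)))\<^sup>2 \<partial>M) \<le> \<epsilon>\<^sup>2 / 4"
  proof -
    have int: "integrable M (\<lambda>\<omega>. a * (norm (F (zhat k \<omega>)))\<^sup>2)"
      using nn a by (intro integrableI_bounded) (auto simp: less_top[symmetric] top_unique)
    then show "integrable M (\<lambda>\<omega>. (norm (F (zhat k \<omega>)))\<^sup>2)" using a by simp
    have "ennreal (\<integral>\<omega>. a * (norm (F (zhat k \<omega>)))\<^sup>2 \<partial>M) \<le> ennreal (a * (\<epsilon>\<^sup>2 / 4))"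
      using nn a by (subst nn_integral_eq_integral[OF int, symmetric]) auto
    then have "(\<integral>\<omega>. a * (norm (F (zhat k \<omega>)))\<^sup>2 \<partial>M) \<le> a * (\<epsilon>\<^sup>2 / 4)"
      using a by (subst (asm) ennreal_le_iff) auto
    then show "(\<integral>\<omega>. (norm (F (zhat k \<omega>)))\<^sup>2 \<partial>M) \<le> \<epsilon>\<^sup>2 / 4" using a by simp
  qed
  note gm = borel_measurable_goldstein_min_norm[OF L0(2) \<delta>(1)]
  note gb = goldstein_min_norm_bounds[OF L0(2) \<delta>(1)]
  have intG: "integrable M (\<lambda>\<omega>. goldstein_min_norm \<delta> f (zhat k \<omega>))"
    using gb by (intro integrable_const_bound[where B = L0] AE_I2 measurable_compose[OF zhat gm]) auto
  \<comment> \<open>Young's inequality, from (|F| - \<epsilon> / 2)^2 >= 0, replaces Jensen's: it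
    passes from |F| to |F|^2 pointwise at the price of \<epsilon> / 4. Another \<epsilon> / 4 is the
    Gaussian tail, and the mean of |F|^2 / \<epsilon> adds a third \<epsilon> / 4.\<close>
  have le: "goldstein_min_norm \<delta> f z \<le> (norm (F z))\<^sup>2 / \<epsilon> + \<epsilon> / 2" for z
  proof -
    have "exp (- (\<delta> / \<mu>)\<^sup>2 / 4) * sqrt 2 ^ DIM((real ^ 'n) \<times> (real ^ 'm)) \<le> \<epsilon> / (8 * L0)"
      by (rule gaussian_tail_small) (use \<delta> \<mu> \<epsilon> L0 \<mu>_\<epsilon> d in auto)
    then have "2 * L0 * (exp (- (\<delta> / \<mu>)\<^sup>2 / 4) * sqrt 2 ^ DIM((real ^ 'n) \<times> (real ^ 'm))) \<le> 2 * L0 * (\<epsilon> / (8 * L0))"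
      using L0 by (intro mult_left_mono) auto
    also have "\<dots> = \<epsilon> / 4" using L0 by simp
    finally have "goldstein_min_norm \<delta> f z \<le> norm (F z) + \<epsilon> / 4"
      using goldstein_min_norm_le[OF L0(2) \<delta>(1) \<mu>(1), of z] by (simp add: norm_F)
    moreover have "norm (F z) \<le> (norm (F z))\<^sup>2 / \<epsilon> + \<epsilon> / 4"
    proof -
      have "\<epsilon> * norm (F z) \<le> (norm (F z))\<^sup>2 + \<epsilon>\<^sup>2 / 4"
        using zero_le_power2[of "norm (F z) - \<epsilon> / 2"] by (simp add: power2_eq_square algebra_simps)
      then have "norm (F z) \<le> ((norm (F z))\<^sup>2 + \<epsilon>\<^sup>2 / 4) / \<epsilon>"
        using \<epsilon> by (simp add: pos_le_divide_eq mult.commute)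
      then show ?thesis using \<epsilon> by (simp add: add_divide_distrib power2_eq_square)
    qed
    ultimately show ?thesis by simp
  qed
  have "expectation (\<lambda>\<omega>. goldstein_min_norm \<delta> f (zhat k \<omega>)) \<le>
      expectation (\<lambda>\<omega>. (norm (F (zhat k \<omega>)))\<^sup>2 / \<epsilon> + \<epsilon> / 2)"
    using intG intF le by (intro integral_mono) auto
  also have "\<dots> = expectation (\<lambda>\<omega>. (norm (F (zhat k \<omega>)))\<^sup>2) / \<epsilon> + \<epsilon> / 2"
    using intF by (simp add: prob_space)
  also have "\<dots> \<le> (\<epsilon>\<^sup>2 / 4) / \<epsilon> + \<epsilon> / 2"
    using EF \<epsilon> by (intro add_right_mono divide_right_mono) auto
  also have "\<dots> \<le> \<epsilon>" using \<epsilon> by (simp add: power2_eq_square)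
  finally show ?thesis using k intG by auto
qed

end
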